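(* Let $L$ be a link that is not an unlink. (i) Let $n = 4k+2$ with $k\ge 0$ an integer. Then for every integer $m \ge 3n+1$, $\beta_n(L) \le \beta_m(L)$. (ii) Let $n = 4k$ with $k \ge 1$ an integer. Then for every integer $m \ge 3n+1$, $\beta_n(L) \le \beta_m(L)+1$; moreover, if $m\equiv 0$ or $m \equiv 1 \pmod 4$, then $\beta_n(L)\le \beta_m(L)$.
   Context: An $n$-crossing ($n\ge 2$) in a link projection is a point where $n$ strands meet, each bisecting the crossing, with the strands assigned distinct levels $1,\dots,n$ (level $1$ on top) recording their heights. An $m$-string $n$-crossing braid is a braid diagram on $m$ strings all of whose crossings are $n$-crossings; each such crossing involves strings in consecutive positions $j,\dots,j+n-1$ and reverses their order. The $n$-crossing braid index $\beta_n(L)$ is the minimum number of strings of an $n$-crossing braid whose closure is isotopic to $L$, with $\beta_n(L)=\infty$ if none exists. *)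

theory Defs
  imports "HOL-Analysis.Analysis" "HOL-Library.Extended_Nat"
begin

type_synonym R3 = "real \<times> real \<times> real"

definition ambient_isotopic :: "R3 set \<Rightarrow> R3 set \<Rightarrow> bool" where
  "ambient_isotopic A B \<longleftrightarrow>
     (\<exists>H :: real \<Rightarrow> R3 \<Rightarrow> R3. \<exists>G.
        homeomorphism ({0..1} \<times> UNIV) ({0..1} \<times> UNIV) (\<lambda>(t, x). (t, H t x)) G
        \<and> (\<forall>x. H 0 x = x) \<and> H 1 ` A = B)"

definition std_unlink :: "nat \<Rightarrow> R3 set" where
  "std_unlink c = {(real (3 * i) + cos \<theta>, sin \<theta>, 0) | i \<theta>. i < c}"

definition is_link :: "R3 set \<Rightarrow> bool" where
  "is_link L \<longleftrightarrow> (\<exists>c\<ge>1. L homeomorphic std_unlink c)"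

definition is_unlink :: "R3 set \<Rightarrow> bool" where
  "is_unlink L \<longleftrightarrow> (\<exists>c\<ge>1. ambient_isotopic (std_unlink c) L)"

text \<open>A crossing is a pair (j, lev): it involves the strings in positions
  j, ..., j+n-1 (positions numbered 0..m-1) where n = length lev, and the string
  entering at position j+i gets level lev!i (level 1 on top).\<close>
type_synonym crossing = "nat \<times> nat list"

definition ncrossing :: "nat \<Rightarrow> nat \<Rightarrow> crossing \<Rightarrow> bool" where
  "ncrossing n m c \<longleftrightarrow> (case c of (j, lev) \<Rightarrow>
      length lev = n \<and> distinct lev \<and> set lev = {1..n} \<and> j + n \<le> m)"

definition nbraid :: "nat \<Rightarrow> nat \<Rightarrow> crossing list \<Rightarrow> bool" where
  "nbraid n m w \<longleftrightarrow> (\<forall>c\<in>set w. ncrossing n m c)"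

definition cross_target :: "crossing \<Rightarrow> nat \<Rightarrow> nat" where
  "cross_target c p = (case c of (j, lev) \<Rightarrow>
      if j \<le> p \<and> p < j + length lev then 2 * j + length lev - 1 - p else p)"

text \<open>Horizontal coordinate and height of the string piece starting at position p
  during crossing c, at local time s in [0,1]. Strings move on straight lines,
  all meeting (in projection) at the midpoint, with height given by the level.\<close>
definition piece_x :: "crossing \<Rightarrow> nat \<Rightarrow> real \<Rightarrow> real" where
  "piece_x c p s = real p + s * (real (cross_target c p) - real p)"

definition piece_z :: "crossing \<Rightarrow> nat \<Rightarrow> real \<Rightarrow> real" where
  "piece_z c p s = (case c of (j, lev) \<Rightarrow>
      if j \<le> p \<and> p < j + length lev
      then real (length lev + 1 - lev ! (p - j)) * (1 - \<bar>2 * s - 1\<bar>) else 0)"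

text \<open>Braid closure: the braid is wrapped around the z-axis; crossing k occupies the
  angular sector [2 pi k/N, 2 pi (k+1)/N], position p sits at radius p+1.\<close>
definition braid_point :: "crossing list \<Rightarrow> nat \<Rightarrow> nat \<Rightarrow> real \<Rightarrow> R3" where
  "braid_point w k p s =
     (let c = w ! k; r = piece_x c p s + 1;
          \<theta> = 2 * pi * (real k + s) / real (length w)
      in (r * cos \<theta>, r * sin \<theta>, piece_z c p s))"

definition braid_closure :: "nat \<Rightarrow> crossing list \<Rightarrow> R3 set" where
  "braid_closure m w =
     (if w = [] then {(real (p + 1) * cos \<theta>, real (p + 1) * sin \<theta>, 0) | p \<theta>. p < m}
      else (\<Union>k<length w. \<Union>p<m. braid_point w k p ` {0..1}))"

text \<open>n-crossing braid index (infinity if no n-crossing braid closes to L).\<close>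
definition beta :: "nat \<Rightarrow> R3 set \<Rightarrow> enat" where
  "beta n L = (INF m \<in> {m. \<exists>w. nbraid n m w \<and> ambient_isotopic (braid_closure m w) L}. enat m)"

end

theory Submission
  imports Defs
begin

text \<open>A crossing moves its strings at pairwise distinct heights.  Strings at distinct heights slide
  freely past each other, so such a braid is determined by its heights and its permutation, and an
  \<open>m\<close>-crossing can be replaced by \<open>n\<close>-crossings with the inherited levels as soon as
  its permutation is a product of reversals of \<open>n\<close> consecutive positions.  For even \<open>n\<close> these
  reversals generate all even permutations, and all permutations if \<open>n\<close> is \<open>2\<close> modulo \<open>4\<close>.
  If \<open>n\<close>-crossings are even and \<open>m\<close>-crossings are odd, consecutive
  \<open>m\<close>-crossings exchange disjoint adjacent transpositions to become even; if moreover the number of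
  \<open>m\<close>-crossings is odd, a stabilization first adds one string and one odd letter.

  An ambient isotopy is obtained from a homotopy \<open>F\<close> of a link which is linear in time and satisfies
  \<open>c |D x - D y| \<le> |F t x - F t y|\<close>, where \<open>D = F 1 - F 0\<close>: small time steps are
  Lipschitz-small perturbations of the identity, and these extend to space.\<close>

section \<open>Ambient isotopy and Lipschitz perturbations\<close>

text \<open>Strings move along straight lines with corners, so nothing here is smooth. Lipschitz
  control survives concatenation and is what the contraction principle needs to turn a motion of the
  link into a homeomorphism of space. Homotopies of braids keep the angle of every point, so
  equivalent tracks have equal durations. Hence letters are cut into pieces of prescribed duration,
  and all even permutations are written with one common number of reversals, by padding words with
  cancelling pairs. Successive crossings of the given braid assign unrelated heights to the strings,
  so they cannot be merged into one letter; a parity defect is handed over to the neighbour by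
  transpositions that do not interact. A link that is not an unlink forces at least one m-crossing,
  hence at least m strings, and \<open>m \<ge> 3 * n + 1\<close> then leaves room for two windows of
  n positions sharing a single point. Stabilization is carried out in space and not among braids,
  because removing the inner loop changes how often the string winds around the axis.\<close>

lemma ambient_isotopic_refl: "ambient_isotopic A A"
  unfolding ambient_isotopic_def
  by (rule exI[of _ "\<lambda>t x. x"], rule exI[of _ id]) (auto simp: homeomorphism_def case_prod_unfold)

lemma ambient_isotopic_trans:
  assumes "ambient_isotopic A B" "ambient_isotopic B C"
  shows "ambient_isotopic A C"
proof -
  obtain H1 G1 where 1: "homeomorphism ({0..1} \<times> UNIV) ({0..1::real} \<times> UNIV) (\<lambda>(t, x). (t, H1 t x)) G1"
     "\<And>x. H1 0 x = x" "H1 1 ` A = B"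
    using assms(1) unfolding ambient_isotopic_def by blast
  obtain H2 G2 where 2: "homeomorphism ({0..1} \<times> UNIV) ({0..1::real} \<times> UNIV) (\<lambda>(t, x). (t, H2 t x)) G2"
     "\<And>x. H2 0 x = x" "H2 1 ` B = C"
    using assms(2) unfolding ambient_isotopic_def by blast
  have "(\<lambda>(t, x). (t, H2 t x)) \<circ> (\<lambda>(t, x). (t, H1 t x)) = (\<lambda>(t, x). (t, H2 t (H1 t x)))"
    by auto
  then have "homeomorphism ({0..1} \<times> UNIV) ({0..1::real} \<times> UNIV) (\<lambda>(t, x). (t, H2 t (H1 t x))) (G1 \<circ> G2)"
    using homeomorphism_compose[OF 1(1) 2(1)] by simp
  moreover have "(\<lambda>x. H2 1 (H1 1 x)) ` A = C"
    using 1(3) 2(3) by (auto simp: image_image)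
  ultimately show ?thesis
    unfolding ambient_isotopic_def using 1(2) 2(2)
    by (intro exI[of _ "\<lambda>t x. H2 t (H1 t x)"] exI[of _ "G1 \<circ> G2"]) auto
qed

lemma ambient_isotopic_sym:
  assumes "ambient_isotopic A B"
  shows "ambient_isotopic B A"
proof -
  obtain H G where H: "homeomorphism ({0..1} \<times> UNIV) ({0..1::real} \<times> UNIV) (\<lambda>(t, x). (t, H t x)) G"
     "\<And>x. H 0 x = x" "H 1 ` A = B"
    using assms unfolding ambient_isotopic_def by blast
  define K where "K t y = snd (G (t, y))" for t y
  have GF: "G (t, H t x) = (t, x)" if "t \<in> {0..1}" for t x
    using homeomorphism_apply1[OF H(1), of "(t, x)"] that by simp
  have GK: "G (t, y) = (t, K t y)" if "t \<in> {0..1}" for t y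
  proof -
    have "(\<lambda>(t, x). (t, H t x)) (G (t, y)) = (t, y)"
      using homeomorphism_apply2[OF H(1), of "(t, y)"] that by simp
    then show ?thesis
      by (auto simp: K_def case_prod_unfold prod_eq_iff)
  qed
  have "homeomorphism ({0..1} \<times> UNIV) ({0..1} \<times> UNIV) (\<lambda>(t, x). (t, K t x)) (\<lambda>(t, x). (t, H t x))"
    by (rule homeomorphism_cong[OF homeomorphism_symD[OF H(1)]]) (auto simp: GK)
  moreover have "K 0 x = x" for x
    using GF[of 0 x] H(2)[of x] by (simp add: K_def)
  moreover have "K 1 ` B = A"
  proof -
    have "K 1 (H 1 x) = x" for x
      using GF[of 1 x] by (simp add: K_def)
    then have "K 1 ` (H 1 ` A) = A"
      by (simp add: image_image)
    then show ?thesis by (simp only: H(3))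
  qed
  ultimately show ?thesis
    unfolding ambient_isotopic_def by blast
qed

text \<open>McShane's formula: the infimum over \<open>X\<close> of
  \<open>g x + C * dist x y\<close> is the largest extension with the same constant.\<close>

lemma lipschitz_extension_real:
  fixes g :: "'a::metric_space \<Rightarrow> real"
  assumes "X \<noteq> {}" and g: "C-lipschitz_on X g"
  obtains G where "C-lipschitz_on UNIV G" "\<And>x. x \<in> X \<Longrightarrow> G x = g x"
proof -
  have C: "C \<ge> 0" using g lipschitz_on_nonneg by blast
  have gle: "g x \<le> g y + C * dist x y" if "x \<in> X" "y \<in> X" for x y
    using lipschitz_onD[OF g that] by (simp add: dist_real_def abs_le_iff)
  define G where "G y = (INF x\<in>X. g x + C * dist x y)" for y
  obtain a where a: "a \<in> X" using assms(1) by blast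
  have bdd: "bdd_below ((\<lambda>x. g x + C * dist x y) ` X)" for y
  proof (rule bdd_belowI2[where m = "g a - C * dist a y"])
    fix x assume x: "x \<in> X"
    have "C * dist a x \<le> C * dist a y + C * dist x y"
      using mult_left_mono[OF dist_triangle2[of a x y] C] by (simp add: algebra_simps)
    then show "g a - C * dist a y \<le> g x + C * dist x y"
      using gle[OF a x] by linarith
  qed
  have le: "G y \<le> G z + C * dist y z" for y z
  proof -
    have "G y - C * dist y z \<le> g x + C * dist x z" if "x \<in> X" for x
    proof -
      have "G y \<le> g x + C * dist x y"
        unfolding G_def by (rule cINF_lower[OF bdd that])
      moreover have "C * dist x y \<le> C * dist x z + C * dist y z"
        using mult_left_mono[OF dist_triangle2[of x y z] C] by (simp add: algebra_simps)
      ultimately show ?thesis by linarith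
    qed
    then have "G y - C * dist y z \<le> G z"
      unfolding G_def[of z] by (intro cINF_greatest[OF assms(1)])
    then show ?thesis by linarith
  qed
  have "C-lipschitz_on UNIV G"
  proof (rule lipschitz_onI[OF _ C])
    show "dist (G y) (G z) \<le> C * dist y z" for y z
      using le[of y z] le[of z y] by (simp add: dist_real_def abs_le_iff dist_commute)
  qed
  moreover have "G x = g x" if "x \<in> X" for x
  proof (rule antisym)
    show "G x \<le> g x"
      unfolding G_def using cINF_lower[OF bdd that, of x] by simp
    show "g x \<le> G x"
      unfolding G_def using gle[OF that] by (intro cINF_greatest[OF assms(1)]) (simp add: dist_commute)
  qed
  ultimately show ?thesis using that by blast
qed

text \<open>Extensions are built coordinate by coordinate, and the constants add because
  \<open>sqrt (D\<^sup>2 + E\<^sup>2) \<le> D + E\<close>. Three real coordinates therefore cost the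
  factor 3.\<close>

lemma lipschitz_extension_prod:
  fixes g :: "'a::metric_space \<Rightarrow> 'b::metric_space \<times> 'c::metric_space"
  assumes fst: "\<And>h. C-lipschitz_on X h \<Longrightarrow> \<exists>G. D-lipschitz_on UNIV G \<and> (\<forall>x\<in>X. G x = (h x :: 'b))"
    and snd: "\<And>h. C-lipschitz_on X h \<Longrightarrow> \<exists>G. E-lipschitz_on UNIV G \<and> (\<forall>x\<in>X. G x = (h x :: 'c))"
    and g: "C-lipschitz_on X g"
  shows "\<exists>G. (D + E)-lipschitz_on UNIV G \<and> (\<forall>x\<in>X. G x = g x)"
proof -
  have "C-lipschitz_on X (\<lambda>x. fst (g x))" "C-lipschitz_on X (\<lambda>x. snd (g x))"
    using g by (auto simp: lipschitz_on_def intro: order_trans[OF dist_fst_le] order_trans[OF dist_snd_le])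
  then obtain G1 G2 where G: "D-lipschitz_on UNIV G1" "\<forall>x\<in>X. G1 x = fst (g x)"
     "E-lipschitz_on UNIV G2" "\<forall>x\<in>X. G2 x = snd (g x)"
    using fst snd by metis
  have "sqrt (D\<^sup>2 + E\<^sup>2) \<le> D + E"
    using lipschitz_on_nonneg[OF G(1)] lipschitz_on_nonneg[OF G(3)] by (simp add: sqrt_sum_squares_le_sum)
  then have "(D + E)-lipschitz_on UNIV (\<lambda>x. (G1 x, G2 x))"
    using lipschitz_on_Pair[OF G(1,3)] lipschitz_on_leI lipschitz_on_mono by blast
  then show ?thesis using G by (intro exI[of _ "\<lambda>x. (G1 x, G2 x)"]) auto
qed

lemma lipschitz_extension_R3:
  fixes g :: "R3 \<Rightarrow> R3"
  assumes "X \<noteq> {}" and g: "C-lipschitz_on X g"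
  obtains G where "(3 * C)-lipschitz_on UNIV G" "\<And>x. x \<in> X \<Longrightarrow> G x = g x"
proof -
  have r: "\<exists>G. C-lipschitz_on UNIV G \<and> (\<forall>x\<in>X. G x = (h x :: real))" if "C-lipschitz_on X h" for h
    using lipschitz_extension_real[OF assms(1) that] by metis
  have "\<exists>G. (C + (C + C))-lipschitz_on UNIV G \<and> (\<forall>x\<in>X. G x = g x)"
    by (rule lipschitz_extension_prod[OF r lipschitz_extension_prod[OF r r] g])
  then show ?thesis using that by (auto simp: mult.commute[of 3] algebra_simps)
qed

text \<open>At each time the map is the identity plus a map with constant at most 1/2, so the
  contraction principle solves \<open>x + t *\<^sub>R g x = y\<close> uniquely. The remaining point
  is joint continuity of the solution in time and space.\<close>

lemma homeomorphism_small_perturbation: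
  fixes g :: "'a::banach \<Rightarrow> 'a"
  assumes g: "(1/2)-lipschitz_on UNIV g"
  shows "\<exists>G. homeomorphism ({0..1} \<times> UNIV) ({0..1::real} \<times> UNIV) (\<lambda>(t, x). (t, x + t *\<^sub>R g x)) G"
proof -
  have gd: "norm (g x - g y) \<le> norm (x - y) / 2" for x y
    using lipschitz_onD[OF g, of x y] by (simp add: dist_norm)
  have ex: "\<exists>x. x + t *\<^sub>R g x = y" if t: "t \<in> {0..1}" for t y
  proof -
    have "dist (y - t *\<^sub>R g x) (y - t *\<^sub>R g x') \<le> (1/2) * dist x x'" for x x'
    proof -
      have "dist (y - t *\<^sub>R g x) (y - t *\<^sub>R g x') = t * norm (g x - g x')"
        using t by (simp add: dist_norm norm_minus_commute flip: scaleR_diff_right)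
      also have "\<dots> \<le> 1 * (norm (x - x') / 2)"
        using t gd by (intro mult_mono) auto
      finally show ?thesis by (simp add: dist_norm)
    qed
    then have "\<exists>!x. y - t *\<^sub>R g x = x"
      by (intro banach_fix_type[where c = "1/2"]) auto
    then show ?thesis by (metis diff_add_cancel)
  qed
  then obtain K where K: "\<And>t y. t \<in> {0..1} \<Longrightarrow> K t y + t *\<^sub>R g (K t y) = y"
    by metis
  \<comment> \<open>The factor 2 is 1 / (1 - 1/2): the last term of \<open>eq\<close> is at most
    half the left side and is absorbed. Equal times give uniqueness of the solution, different times
    give the continuity of \<open>K\<close>.\<close>
  have est: "norm (x - x') \<le> (2::real) * norm ((x + t *\<^sub>R g x) - (x' + t' *\<^sub>R g x')) + 2 * \<bar>t - t'\<bar> * norm (g x)"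
    if "t' \<in> {0..1}" for x x' :: 'a and t t' :: real
  proof -
    have eq: "x - x' = ((x + t *\<^sub>R g x) - (x' + t' *\<^sub>R g x')) - (t - t') *\<^sub>R g x - t' *\<^sub>R (g x - g x')"
      by (simp add: algebra_simps)
    have "norm (x - x') \<le> norm ((x + t *\<^sub>R g x) - (x' + t' *\<^sub>R g x')) + norm ((t - t') *\<^sub>R g x) + norm (t' *\<^sub>R (g x - g x'))"
      by (subst eq) (intro order_trans[OF norm_triangle_ineq4] add_mono order_refl)
    moreover have "norm (t' *\<^sub>R (g x - g x')) \<le> 1 * (norm (x - x') / 2)"
      unfolding norm_scaleR using that gd by (intro mult_mono) auto
    ultimately show ?thesis by simp
  qed
  have KF: "K t (x + t *\<^sub>R g x) = x" if "t \<in> {0..1}" for t x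
    using est[OF that, where x = "K t (x + t *\<^sub>R g x)" and t = t and x' = x] K[OF that] by simp
  have contg: "continuous_on UNIV g"
    using g lipschitz_on_continuous_on by blast
  have "continuous_on ({0..1} \<times> UNIV) (\<lambda>(t, x). (t, K t x))"
    unfolding continuous_on_def
  proof (clarify)
    fix t :: real and y :: 'a assume t: "t \<in> {0..1}"
    let ?F = "at (t, y) within {0..1} \<times> UNIV"
    define x where "x = K t y"
    have "((\<lambda>p. 2 * norm (y - snd p) + 2 * \<bar>t - fst p\<bar> * norm (g x))
        \<longlongrightarrow> 2 * norm (y - snd (t, y)) + 2 * \<bar>t - fst (t, y)\<bar> * norm (g x)) ?F"
      by (intro tendsto_intros)
    then have lim: "((\<lambda>p. 2 * norm (y - snd p) + 2 * \<bar>t - fst p\<bar> * norm (g x)) \<longlongrightarrow> 0) ?F"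
      by simp
    have "((\<lambda>p. K (fst p) (snd p) - x) \<longlongrightarrow> 0) ?F"
    proof (rule Lim_null_comparison[OF _ lim])
      show "\<forall>\<^sub>F p in ?F. norm (K (fst p) (snd p) - x) \<le> 2 * norm (y - snd p) + 2 * \<bar>t - fst p\<bar> * norm (g x)"
        unfolding eventually_at_filter
      proof (rule always_eventually, clarsimp)
        fix t' y' assume "0 \<le> t'" "t' \<le> (1::real)"
        then show "norm (K t' y' - x) \<le> 2 * norm (y - y') + 2 * \<bar>t - t'\<bar> * norm (g x)"
          using est[where t = t and x = x and t' = t' and x' = "K t' y'"] K[of t' y'] K[OF t, of y] by (simp add: x_def norm_minus_commute)
      qed
    qed
    then have "((\<lambda>p. K (fst p) (snd p)) \<longlongrightarrow> x) ?F"
      by (simp add: LIM_zero_iff)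
    then show "((\<lambda>(t, x). (t, K t x)) \<longlongrightarrow> (t, K t y)) ?F"
      unfolding case_prod_unfold x_def
      by (intro tendsto_Pair) (auto intro!: tendsto_eq_intros)
  qed
  moreover have "continuous_on ({0..1} \<times> UNIV) (\<lambda>(t, x). (t, x + t *\<^sub>R g x))"
    unfolding case_prod_unfold
    by (intro continuous_intros continuous_on_compose2[OF contg]) auto
  ultimately have "homeomorphism ({0..1} \<times> UNIV) ({0..1::real} \<times> UNIV) (\<lambda>(t, x). (t, x + t *\<^sub>R g x)) (\<lambda>(t, x). (t, K t x))"
    by (intro homeomorphismI) (auto simp: K KF)
  then show ?thesis by blast
qed

text \<open>The hypothesis makes the displacement \<open>v x - u x\<close> a function of the point
  \<open>u x\<close> with constant 1/6, even if \<open>u\<close> repeats points, since equal points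
  have equal displacements. Extension to space multiplies 1/6 by 3, which gives the 1/2 of
  \<open>homeomorphism_small_perturbation\<close>.\<close>

lemma ambient_isotopic_small_perturbation:
  fixes u v :: "'x \<Rightarrow> R3"
  assumes "\<And>x y. x \<in> X \<Longrightarrow> y \<in> X \<Longrightarrow> norm ((v x - u x) - (v y - u y)) \<le> norm (u x - u y) / 6"
  shows "ambient_isotopic (u ` X) (v ` X)"
proof (cases "X = {}")
  case True
  then show ?thesis by (simp add: ambient_isotopic_refl)
next
  case False
  define g where "g p = v (inv_into X u p) - p" for p
  have g: "g (u x) = v x - u x" if x: "x \<in> X" for x
  proof -
    let ?y = "inv_into X u (u x)"
    have y: "?y \<in> X" "u ?y = u x" using x by (auto intro: inv_into_into f_inv_into_f)
    show ?thesis using assms[OF y(1) x] y(2) by (simp add: g_def)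
  qed
  have "(1/6)-lipschitz_on (u ` X) g"
    using assms by (intro lipschitz_onI) (auto simp: g dist_norm)
  then obtain G where G: "(3 * (1/6))-lipschitz_on UNIV G" "\<And>p. p \<in> u ` X \<Longrightarrow> G p = g p"
    using lipschitz_extension_R3[of "u ` X"] False by blast
  obtain K where K: "homeomorphism ({0..1} \<times> UNIV) ({0..1::real} \<times> UNIV) (\<lambda>(t, x). (t, x + t *\<^sub>R G x)) K"
    using homeomorphism_small_perturbation[of G] G(1) by auto
  show ?thesis
    unfolding ambient_isotopic_def
    by (rule exI[of _ "\<lambda>t x. x + t *\<^sub>R G x"], rule exI[of _ K])
      (use K in \<open>auto simp: G(2) g image_image\<close>)
qed

text \<open>By \<open>bound\<close>, the velocity is (1/c)-Lipschitz in the current position at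
  every time. A step of length 1/N with N > 6/c then has constant at most 1/6, and N small isotopies
  are composed.\<close>

lemma ambient_isotopic_linear_homotopy:
  fixes u v :: "'x \<Rightarrow> R3"
  assumes "c > 0"
    and bound: "\<And>t x y. t \<in> {0..1} \<Longrightarrow> x \<in> X \<Longrightarrow> y \<in> X \<Longrightarrow>
      c * norm ((v x - u x) - (v y - u y)) \<le> norm ((u x + t *\<^sub>R (v x - u x)) - (u y + t *\<^sub>R (v y - u y)))"
  shows "ambient_isotopic (u ` X) (v ` X)"
proof -
  obtain N :: nat where N: "6 / c < real N"
    using reals_Archimedean2 by blast
  then have N0: "real N > 0" using \<open>c > 0\<close> by (smt (verit) divide_pos_pos)
  define F where "F k x = u x + (real k / real N) *\<^sub>R (v x - u x)" for k x
  have step: "ambient_isotopic (F k ` X) (F (Suc k) ` X)" if k: "k < N" for k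
  proof (rule ambient_isotopic_small_perturbation)
    fix x y assume xy: "x \<in> X" "y \<in> X"
    have d: "F (Suc k) z - F k z = (1 / real N) *\<^sub>R (v z - u z)" for z
      by (simp add: F_def add_divide_distrib flip: scaleR_diff_left)
    have "norm ((F (Suc k) x - F k x) - (F (Suc k) y - F k y)) = (1 / real N) * norm ((v x - u x) - (v y - u y))"
      unfolding d scaleR_diff_right[symmetric] by simp
    also have "\<dots> \<le> (c / 6) * norm ((v x - u x) - (v y - u y))"
      using N N0 \<open>c > 0\<close> by (intro mult_right_mono) (auto simp: field_simps)
    also have "\<dots> \<le> norm (F k x - F k y) / 6"
      using bound[of "real k / real N" x y] xy k N0 by (simp add: F_def)
    finally show "norm ((F (Suc k) x - F k x) - (F (Suc k) y - F k y)) \<le> norm (F k x - F k y) / 6" .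
  qed
  have "ambient_isotopic (F 0 ` X) (F k ` X)" if "k \<le> N" for k
    using that
  proof (induction k)
    case (Suc k)
    then have "ambient_isotopic (F 0 ` X) (F k ` X)" by simp
    then show ?case
      using ambient_isotopic_trans step Suc.prems Suc_le_lessD by blast
  qed (simp add: ambient_isotopic_refl)
  from this[of N] show ?thesis using N0 by (simp add: F_def)
qed

section \<open>Closed braids as Lipschitz tracks\<close>

text \<open>The pair is radius and height in the half-plane at angle \<theta>. For a fixed angle the
  map is linear and isometric, so linear homotopies of pairs become linear homotopies in
  space.\<close>

definition cyl :: "real \<Rightarrow> real \<times> real \<Rightarrow> R3" where
  "cyl \<theta> q = (fst q * cos \<theta>, fst q * sin \<theta>, snd q)"

definition track_closure :: "nat \<Rightarrow> real \<Rightarrow> (nat \<Rightarrow> real \<Rightarrow> real \<times> real) \<Rightarrow> R3 set" where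
  "track_closure p T P = (\<lambda>(i, \<tau>). cyl (2 * pi * \<tau> / T) (P i \<tau>)) ` ({..<p} \<times> {0..T})"

lemma cyl_add: "cyl \<theta> (a + b) = cyl \<theta> a + cyl \<theta> b"
  and cyl_diff: "cyl \<theta> (a - b) = cyl \<theta> a - cyl \<theta> b"
  and cyl_scaleR: "cyl \<theta> (t *\<^sub>R a) = t *\<^sub>R cyl \<theta> a"
  by (auto simp: cyl_def algebra_simps)

lemma cyl_periodic [simp]: "cyl (\<theta> + 2 * pi) q = cyl \<theta> q"
  by (simp add: cyl_def)

lemma norm_cyl [simp]: "norm (cyl \<theta> q) = norm q"
proof -
  have "(fst q * cos \<theta>)\<^sup>2 + (fst q * sin \<theta>)\<^sup>2 = (fst q)\<^sup>2 * ((cos \<theta>)\<^sup>2 + (sin \<theta>)\<^sup>2)"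
    by (simp only: power_mult_distrib distrib_left)
  then have "(fst q * cos \<theta>)\<^sup>2 + (fst q * sin \<theta>)\<^sup>2 = (fst q)\<^sup>2" by simp
  then show ?thesis
    by (simp add: cyl_def norm_prod_def add.assoc[symmetric])
qed

lemma norm_cyl_angle_diff: "norm (cyl \<theta> q - cyl \<theta>' q) \<le> 2 * norm q * \<bar>\<theta> - \<theta>'\<bar>"
proof -
  have c: "\<bar>cos \<theta> - cos \<theta>'\<bar> \<le> \<bar>\<theta> - \<theta>'\<bar>"
  proof -
    have "\<bar>cos \<theta> - cos \<theta>'\<bar> = 2 * (\<bar>sin ((\<theta> + \<theta>') / 2)\<bar> * \<bar>sin ((\<theta>' - \<theta>) / 2)\<bar>)"
      by (simp add: cos_diff_cos abs_mult)
    also have "\<dots> \<le> 2 * (1 * \<bar>(\<theta>' - \<theta>) / 2\<bar>)"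
      by (intro mult_left_mono mult_mono abs_sin_x_le_abs_x) auto
    finally show ?thesis by simp
  qed
  have s: "\<bar>sin \<theta> - sin \<theta>'\<bar> \<le> \<bar>\<theta> - \<theta>'\<bar>"
  proof -
    have "\<bar>sin \<theta> - sin \<theta>'\<bar> = 2 * (\<bar>sin ((\<theta> - \<theta>') / 2)\<bar> * \<bar>cos ((\<theta> + \<theta>') / 2)\<bar>)"
      by (simp add: sin_diff_sin abs_mult)
    also have "\<dots> \<le> 2 * (\<bar>(\<theta> - \<theta>') / 2\<bar> * 1)"
      by (intro mult_left_mono mult_mono abs_sin_x_le_abs_x) auto
    finally show ?thesis by simp
  qed
  have "cyl \<theta> q - cyl \<theta>' q = (fst q * (cos \<theta> - cos \<theta>'), fst q * (sin \<theta> - sin \<theta>'), 0)"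
    by (simp add: cyl_def algebra_simps)
  then have "norm (cyl \<theta> q - cyl \<theta>' q) \<le> \<bar>fst q * (cos \<theta> - cos \<theta>')\<bar> + \<bar>fst q * (sin \<theta> - sin \<theta>')\<bar>"
    using norm_Pair_le[of "fst q * (cos \<theta> - cos \<theta>')" "(fst q * (sin \<theta> - sin \<theta>'), 0::real)"]
    by simp
  also have "\<dots> \<le> norm q * \<bar>\<theta> - \<theta>'\<bar> + norm q * \<bar>\<theta> - \<theta>'\<bar>"
    unfolding abs_mult using norm_fst_le[of "fst q" "snd q"]
    by (intro add_mono mult_mono c s) auto
  finally show ?thesis by simp
qed

lemma abs_sin_ge_half:
  fixes x :: real
  assumes "\<bar>x\<bar> \<le> pi / 2"
  shows "\<bar>x\<bar> / 2 \<le> \<bar>sin x\<bar>"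
proof -
  have "\<bar>sin x - (\<Sum>m<3. sin_coeff m * x ^ m)\<bar> \<le> inverse (fact 3) * \<bar>x\<bar> ^ 3"
    by (rule Maclaurin_sin_bound)
  then have 1: "\<bar>sin x - x\<bar> \<le> \<bar>x\<bar> ^ 3 / 6"
    by (simp add: numeral_3_eq_3 sin_coeff_def fact_numeral)
  \<comment> \<open>1.6 bounds pi/2 and its square is below 3, so the cubic error of the Taylor
    polynomial takes away at most half of \<open>\<bar>x\<bar>\<close>.\<close>
  have "\<bar>x\<bar> \<le> 1.6" using assms pi_less_4 pi_approx by simp
  then have "\<bar>x\<bar> * \<bar>x\<bar> \<le> 1.6 * 1.6" by (intro mult_mono) auto
  then have "\<bar>x\<bar> * (\<bar>x\<bar> * \<bar>x\<bar>) \<le> \<bar>x\<bar> * 3" by (intro mult_left_mono) auto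
  then have "\<bar>x\<bar> ^ 3 / 6 \<le> \<bar>x\<bar> / 2" by (simp add: power3_eq_cube mult.assoc)
  then show ?thesis using 1 by linarith
qed

text \<open>By the law of cosines the squared planar distance of points with radii r, s is at least
  \<open>2 * r * s * (1 - cos (\<theta> - \<theta>'))\<close>; radii at least 1 reduce this to the
  chord \<open>2 * \<bar>sin ((\<theta> - \<theta>') / 2)\<bar>\<close> of the unit circle.\<close>

lemma norm_cyl_diff_ge:
  assumes "1 \<le> fst q" "1 \<le> fst q'" "\<bar>\<theta> - \<theta>'\<bar> \<le> pi"
  shows "\<bar>\<theta> - \<theta>'\<bar> / 2 \<le> norm (cyl \<theta> q - cyl \<theta>' q')"
proof -
  let ?r = "fst q" and ?s = "fst q'"
  have "(?r * cos \<theta> - ?s * cos \<theta>')\<^sup>2 + (?r * sin \<theta> - ?s * sin \<theta>')\<^sup>2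
      = ?r\<^sup>2 * ((cos \<theta>)\<^sup>2 + (sin \<theta>)\<^sup>2) + ?s\<^sup>2 * ((cos \<theta>')\<^sup>2 + (sin \<theta>')\<^sup>2)
        - 2 * ?r * ?s * (cos \<theta> * cos \<theta>' + sin \<theta> * sin \<theta>')"
    by (simp add: power2_eq_square algebra_simps del: sin_cos_squared_add sin_cos_squared_add2 sin_cos_squared_add3)
  also have "\<dots> = (?r - ?s)\<^sup>2 + 2 * (?r * ?s) * (1 - cos (\<theta> - \<theta>'))"
    unfolding sin_cos_squared_add2 sin_cos_squared_add cos_diff by (simp add: power2_eq_square algebra_simps)
  also have "1 - cos (\<theta> - \<theta>') = 2 * (sin ((\<theta> - \<theta>') / 2))\<^sup>2"
  proof -
    have "2 * ((\<theta> - \<theta>') / 2) = \<theta> - \<theta>'" by simp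
    then show ?thesis using cos_double_sin[of "(\<theta> - \<theta>') / 2"] by (simp only:)
  qed
  also have "(?r - ?s)\<^sup>2 + 2 * (?r * ?s) * (2 * (sin ((\<theta> - \<theta>') / 2))\<^sup>2) \<ge> 0 + 2 * 1 * (2 * (sin ((\<theta> - \<theta>') / 2))\<^sup>2)"
    using assms(1,2) mult_mono[of 1 ?r 1 ?s]
    by (intro add_mono mult_mono) auto
  finally have "(2 * \<bar>sin ((\<theta> - \<theta>') / 2)\<bar>)\<^sup>2 \<le> (?r * cos \<theta> - ?s * cos \<theta>')\<^sup>2 + (?r * sin \<theta> - ?s * sin \<theta>')\<^sup>2"
    by (simp add: power_mult_distrib)
  then have "2 * \<bar>sin ((\<theta> - \<theta>') / 2)\<bar> \<le> norm (cyl \<theta> q - cyl \<theta>' q')"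
    unfolding cyl_def norm_prod_def
    by (intro real_le_rsqrt) (simp add: add.assoc[symmetric] add_increasing2)
  moreover have "\<bar>(\<theta> - \<theta>') / 2\<bar> / 2 \<le> \<bar>sin ((\<theta> - \<theta>') / 2)\<bar>"
    using assms(3) by (intro abs_sin_ge_half) simp
  ultimately show ?thesis by simp
qed

lemma lipschitz_on_cyl:
  fixes A :: "real \<Rightarrow> real \<times> real"
  assumes A: "L-lipschitz_on {a..b} A"
  shows "\<exists>K. K-lipschitz_on {a..b} (\<lambda>\<tau>. cyl (2 * pi * \<tau> / T) (A \<tau>))"
proof -
  have L: "L \<ge> 0" using A lipschitz_on_nonneg by blast
  have "compact (A ` {a..b})"
    using lipschitz_on_continuous_on[OF A] by (intro compact_continuous_image) auto
  then obtain M where M: "\<And>\<tau>. \<tau> \<in> {a..b} \<Longrightarrow> norm (A \<tau>) \<le> M"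
    by (meson bounded_iff compact_imp_bounded imageI)
  define K where "K = L + 2 * \<bar>M\<bar> * \<bar>2 * pi / T\<bar>"
  have "K-lipschitz_on {a..b} (\<lambda>\<tau>. cyl (2 * pi * \<tau> / T) (A \<tau>))"
  proof (rule lipschitz_onI)
    fix x y assume xy: "x \<in> {a..b}" "y \<in> {a..b}"
    let ?c = "\<lambda>x. cyl (2 * pi * x / T)"
    have "dist (?c x (A x)) (?c y (A y)) = norm (?c x (A x - A y) + (?c x (A y) - ?c y (A y)))"
      by (simp add: dist_norm cyl_diff)
    also have "\<dots> \<le> norm (A x - A y) + 2 * norm (A y) * \<bar>2 * pi * x / T - 2 * pi * y / T\<bar>"
      by (rule order_trans[OF norm_triangle_ineq]) (intro add_mono norm_cyl_angle_diff, simp)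
    also have "\<bar>2 * pi * x / T - 2 * pi * y / T\<bar> = \<bar>2 * pi / T\<bar> * dist x y"
    proof -
      have "2 * pi * x / T - 2 * pi * y / T = 2 * pi / T * (x - y)"
        by (simp add: right_diff_distrib diff_divide_distrib)
      then show ?thesis by (simp only: abs_mult dist_real_def)
    qed
    also have "norm (A x - A y) + 2 * norm (A y) * (\<bar>2 * pi / T\<bar> * dist x y)
        \<le> L * dist x y + 2 * \<bar>M\<bar> * (\<bar>2 * pi / T\<bar> * dist x y)"
      using lipschitz_onD[OF A xy] M[OF xy(2)]
      by (intro add_mono mult_mono) (auto simp: dist_norm)
    finally show "dist (?c x (A x)) (?c y (A y)) \<le> K * dist x y"
      by (simp add: K_def algebra_simps)
  qed (use L in \<open>simp add: K_def\<close>)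
  then show ?thesis by blast
qed

lemma uniform_lipschitz:
  assumes "finite I" "\<And>i. i \<in> I \<Longrightarrow> \<exists>K. K-lipschitz_on S (f i)"
  obtains K where "K \<ge> 0" "\<And>i. i \<in> I \<Longrightarrow> K-lipschitz_on S (f i)"
proof -
  obtain k where k: "\<And>i. i \<in> I \<Longrightarrow> (k i)-lipschitz_on S (f i)"
    using assms(2) by metis
  then have nn: "\<And>i. i \<in> I \<Longrightarrow> 0 \<le> k i" using lipschitz_on_nonneg by blast
  have "(sum k I)-lipschitz_on S (f i)" if "i \<in> I" for i
    using k[OF that] member_le_sum[OF that, of k] assms(1) nn lipschitz_on_le by (metis Diff_iff)
  moreover have "sum k I \<ge> 0" using nn by (simp add: sum_nonneg)
  ultimately show ?thesis using that by blast
qed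

lemma lipschitz_on_shift:
  fixes f :: "real \<Rightarrow> 'a::metric_space"
  assumes "K-lipschitz_on {0..b} f"
  shows "K-lipschitz_on {a..a + b} (\<lambda>x. f (x - a))"
proof (rule lipschitz_onI)
  fix x y assume "x \<in> {a..a + b}" "y \<in> {a..a + b}"
  then show "dist (f (x - a)) (f (y - a)) \<le> K * dist x y"
    using lipschitz_onD[OF assms, of "x - a" "y - a"] by (simp add: dist_real_def)
qed (use assms lipschitz_on_nonneg in blast)

lemma uniform_positive:
  fixes I :: "'i set"
  assumes "finite I" "\<And>i. i \<in> I \<Longrightarrow> \<exists>d>0::real. \<forall>y. R i y \<longrightarrow> d \<le> f i y"
  obtains d where "d > 0" "\<And>i y. i \<in> I \<Longrightarrow> R i y \<Longrightarrow> d \<le> f i y"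
proof -
  obtain k where k: "\<And>i. i \<in> I \<Longrightarrow> k i > 0" "\<And>i y. i \<in> I \<Longrightarrow> R i y \<Longrightarrow> k i \<le> f i y"
    using assms(2) by metis
  define d where "d = Min (insert 1 (k ` I))"
  have "d > 0" using k(1) assms(1) by (simp add: d_def)
  moreover have "d \<le> k i" if "i \<in> I" for i
    using that assms(1) by (simp add: d_def)
  ultimately show ?thesis using that k(2) order_trans by meson
qed

text \<open>The estimate required by \<open>ambient_isotopic_linear_homotopy\<close> rests on two
  facts: a gap in time is a gap in angle, and distinct strings at one angle stay a positive distance
  apart by compactness. Lipschitz bounds in time interpolate between them.\<close>

lemma track_closure_linear_homotopy:
  fixes P Q :: "nat \<Rightarrow> real \<Rightarrow> real \<times> real"
  assumes T: "T > 0" and \<sigma>: "\<sigma> ` {..<p} = {..<p}"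
    and LP: "\<And>i. i < p \<Longrightarrow> \<exists>K. K-lipschitz_on {0..T} (P i)"
    and LQ: "\<And>i. i < p \<Longrightarrow> \<exists>K. K-lipschitz_on {0..T} (Q i)"
    and perP: "\<And>i. i < p \<Longrightarrow> P i T = P (\<sigma> i) 0"
    and perQ: "\<And>i. i < p \<Longrightarrow> Q i T = Q (\<sigma> i) 0"
    and posP: "\<And>i \<tau>. i < p \<Longrightarrow> \<tau> \<in> {0..T} \<Longrightarrow> 1 \<le> fst (P i \<tau>)"
    and posQ: "\<And>i \<tau>. i < p \<Longrightarrow> \<tau> \<in> {0..T} \<Longrightarrow> 1 \<le> fst (Q i \<tau>)"
    and inj: "\<And>t \<tau> i j. t \<in> {0..1} \<Longrightarrow> \<tau> \<in> {0..T} \<Longrightarrow> i < p \<Longrightarrow> j < p \<Longrightarrow> i \<noteq> j \<Longrightarrow>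
       (1 - t) *\<^sub>R P i \<tau> + t *\<^sub>R Q i \<tau> \<noteq> (1 - t) *\<^sub>R P j \<tau> + t *\<^sub>R Q j \<tau>"
  shows "ambient_isotopic (track_closure p T P) (track_closure p T Q)"
proof -
  have \<sigma>lt: "\<sigma> i < p" if "i < p" for i using \<sigma> that by blast
  \<comment> \<open>Runs on for a second turn along the successor string \<open>\<sigma> i\<close>,
    so that points on both sides of the closing half-plane get nearby times.\<close>
  define ext where "ext A i \<tau> = (if \<tau> \<le> T then A i \<tau> else A (\<sigma> i) (\<tau> - T))"
    for A :: "nat \<Rightarrow> real \<Rightarrow> real \<times> real" and i \<tau>
  define c where "c A i \<tau> = cyl (2 * pi * \<tau> / T) (ext A i \<tau>)" for A i \<tau>
  have extL: "\<exists>K. K-lipschitz_on {0..2 * T} (ext A i)"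
    if A: "\<And>i. i < p \<Longrightarrow> \<exists>K. K-lipschitz_on {0..T} (A i)" "A i T = A (\<sigma> i) 0" "i < p" for A i
  proof -
    obtain K1 K2 where K: "K1-lipschitz_on {0..T} (A i)" "K2-lipschitz_on {0..T} (A (\<sigma> i))"
      using A \<sigma>lt by metis
    have "K2-lipschitz_on {T..2 * T} (\<lambda>x. A (\<sigma> i) (x - T))"
      using lipschitz_on_shift[OF K(2), of T] by simp
    then have "(max K1 K2)-lipschitz_on {0..2 * T} (\<lambda>x. if x \<le> T then A i x else A (\<sigma> i) (x - T))"
      using K(1) A(2) by (intro lipschitz_on_concat_max) auto
    then show ?thesis unfolding ext_def by blast
  qed
  have cL: "\<exists>K\<ge>0. \<forall>i<p. K-lipschitz_on {0..2 * T} (c A i)"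
    if A: "\<And>i. i < p \<Longrightarrow> \<exists>K. K-lipschitz_on {0..T} (A i)" "\<And>i. i < p \<Longrightarrow> A i T = A (\<sigma> i) 0" for A
  proof -
    have "\<exists>K. K-lipschitz_on {0..2 * T} (c A i)" if "i < p" for i
      using extL[of A i] lipschitz_on_cyl A that unfolding c_def by blast
    then show ?thesis
      using uniform_lipschitz[of "{..<p}" "{0..2 * T}" "c A"] by (metis finite_lessThan lessThan_iff)
  qed
  obtain KP where KP: "KP \<ge> 0" "\<And>i. i < p \<Longrightarrow> KP-lipschitz_on {0..2 * T} (c P i)"
    using cL[of P, OF LP perP] by blast
  obtain KQ where KQ: "KQ \<ge> 0" "\<And>i. i < p \<Longrightarrow> KQ-lipschitz_on {0..2 * T} (c Q i)"
    using cL[of Q, OF LQ perQ] by blast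
  define K where "K = KP + KQ"
  have K: "K \<ge> 0" using KP KQ by (simp add: K_def)
  define D where "D i \<tau> = c Q i \<tau> - c P i \<tau>" for i \<tau>
  define F where "F t i \<tau> = c P i \<tau> + t *\<^sub>R D i \<tau>" for t i \<tau>
  have LD: "norm (D i \<tau> - D i \<tau>') \<le> K * \<bar>\<tau> - \<tau>'\<bar>"
    if "i < p" "\<tau> \<in> {0..2 * T}" "\<tau>' \<in> {0..2 * T}" for i \<tau> \<tau>'
  proof -
    have "K-lipschitz_on {0..2 * T} (D i)"
      unfolding D_def K_def using lipschitz_on_diff[OF KQ(2) KP(2)] that(1) by (simp add: add.commute)
    then show ?thesis using lipschitz_onD that by (fastforce simp: dist_norm)
  qed
  have LF: "norm (F t i \<tau> - F t i \<tau>') \<le> K * \<bar>\<tau> - \<tau>'\<bar>"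
    if t: "t \<in> {0..1}" and i: "i < p" "\<tau> \<in> {0..2 * T}" "\<tau>' \<in> {0..2 * T}" for t i \<tau> \<tau>'
  proof -
    have "norm (c P i \<tau> - c P i \<tau>') \<le> KP * \<bar>\<tau> - \<tau>'\<bar>" "norm (c Q i \<tau> - c Q i \<tau>') \<le> KQ * \<bar>\<tau> - \<tau>'\<bar>"
      using lipschitz_onD[OF KP(2)] lipschitz_onD[OF KQ(2)] i by (simp_all add: dist_norm)
    moreover have "F t i \<tau> - F t i \<tau>' = (1 - t) *\<^sub>R (c P i \<tau> - c P i \<tau>') + t *\<^sub>R (c Q i \<tau> - c Q i \<tau>')"
      by (simp add: F_def D_def algebra_simps)
    then have "norm (F t i \<tau> - F t i \<tau>') \<le> (1 - t) * norm (c P i \<tau> - c P i \<tau>') + t * norm (c Q i \<tau> - c Q i \<tau>')"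
      using t norm_triangle_ineq[of "(1 - t) *\<^sub>R (c P i \<tau> - c P i \<tau>')" "t *\<^sub>R (c Q i \<tau> - c Q i \<tau>')"] by simp
    moreover have "(1 - t) * norm (c P i \<tau> - c P i \<tau>') \<le> 1 * norm (c P i \<tau> - c P i \<tau>')"
      "t * norm (c Q i \<tau> - c Q i \<tau>') \<le> 1 * norm (c Q i \<tau> - c Q i \<tau>')"
      using t by (intro mult_right_mono; simp)+
    ultimately show ?thesis by (simp add: K_def algebra_simps)
  qed
  have F_cyl: "F t i \<tau> = cyl (2 * pi * \<tau> / T) ((1 - t) *\<^sub>R ext P i \<tau> + t *\<^sub>R ext Q i \<tau>)" for t i \<tau>
    by (simp add: F_def D_def c_def cyl_add cyl_diff cyl_scaleR scaleR_diff_left scaleR_diff_right)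
  have pos: "1 \<le> fst ((1 - t) *\<^sub>R ext P i \<tau> + t *\<^sub>R ext Q i \<tau>)"
    if "t \<in> {0..1}" "i < p" "\<tau> \<in> {0..2 * T}" for t i \<tau>
  proof -
    have "1 \<le> fst (ext P i \<tau>)" "1 \<le> fst (ext Q i \<tau>)"
      using posP posQ that \<sigma>lt by (auto simp: ext_def)
    then have "(1 - t) * 1 + t * 1 \<le> (1 - t) * fst (ext P i \<tau>) + t * fst (ext Q i \<tau>)"
      using that(1) by (intro add_mono mult_left_mono) auto
    then show ?thesis by simp
  qed
  have ang: "(pi / T) * \<bar>\<tau> - \<tau>'\<bar> \<le> norm (F t i \<tau> - F t j \<tau>')"
    if "t \<in> {0..1}" "i < p" "j < p" "\<tau> \<in> {0..2 * T}" "\<tau>' \<in> {0..2 * T}" "\<bar>\<tau> - \<tau>'\<bar> \<le> T / 2" for t i j \<tau> \<tau>'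
  proof -
    have eq: "\<bar>2 * pi * \<tau> / T - 2 * pi * \<tau>' / T\<bar> = 2 * pi / T * \<bar>\<tau> - \<tau>'\<bar>"
      using T by (simp add: abs_mult flip: diff_divide_distrib right_diff_distrib)
    then have "\<bar>2 * pi * \<tau> / T - 2 * pi * \<tau>' / T\<bar> \<le> pi"
      using that(6) T by (simp add: field_simps)
    from norm_cyl_diff_ge[OF pos pos this] show ?thesis
      using that eq by (simp add: F_cyl)
  qed
  have sep: "\<exists>d>0. \<forall>y. (case y of (t, \<tau>) \<Rightarrow> t \<in> {0..1} \<and> \<tau> \<in> {0..2 * T}) \<longrightarrow>
      d \<le> (case y of (t, \<tau>) \<Rightarrow> norm (F t i \<tau> - F t j \<tau>))"
    if ij: "i < p" "j < p" "i \<noteq> j" for i j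
  proof -
    let ?f = "\<lambda>y. norm (F (fst y) i (snd y) - F (fst y) j (snd y))"
    have cont: "continuous_on {0..2 * T} (c P k)" "continuous_on {0..2 * T} (c Q k)" if "k < p" for k
      using KP(2) KQ(2) that lipschitz_on_continuous_on by blast+
    have "continuous_on ({0..1} \<times> {0..2 * T}) ?f"
      unfolding F_def D_def
      by (intro continuous_intros continuous_on_compose2[OF cont(1)] continuous_on_compose2[OF cont(2)] ij) auto
    then obtain m where m: "m \<in> {0..1} \<times> {0..2 * T}" "\<And>y. y \<in> {0..1} \<times> {0..2 * T} \<Longrightarrow> ?f m \<le> ?f y"
      using continuous_attains_inf[of "{0..1} \<times> {0..2 * T}" ?f] T by (force simp: compact_Times)
    obtain t \<tau> where t\<tau>: "m = (t, \<tau>)" "t \<in> {0..1}" "\<tau> \<in> {0..2 * T}" using m(1) by auto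
    have \<sigma>inj: "inj_on \<sigma> {..<p}"
      using \<sigma> by (simp add: eq_card_imp_inj_on)
    have "(1 - t) *\<^sub>R ext P i \<tau> + t *\<^sub>R ext Q i \<tau> \<noteq> (1 - t) *\<^sub>R ext P j \<tau> + t *\<^sub>R ext Q j \<tau>"
    proof (cases "\<tau> \<le> T")
      case True
      then show ?thesis using inj[of t \<tau> i j] t\<tau> ij by (simp add: ext_def)
    next
      case False
      moreover have "\<sigma> i \<noteq> \<sigma> j" using \<sigma>inj ij by (auto simp: inj_on_def)
      ultimately show ?thesis
        using inj[of t "\<tau> - T" "\<sigma> i" "\<sigma> j"] t\<tau> ij \<sigma>lt by (simp add: ext_def)
    qed
    then have "0 < norm (((1 - t) *\<^sub>R ext P i \<tau> + t *\<^sub>R ext Q i \<tau>) - ((1 - t) *\<^sub>R ext P j \<tau> + t *\<^sub>R ext Q j \<tau>))"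
      by simp
    then have "?f m > 0"
      unfolding t\<tau>(1) fst_conv snd_conv F_cyl cyl_diff[symmetric] norm_cyl .
    then show ?thesis using m(2) by (intro exI[of _ "?f m"]) auto
  qed
  obtain d where d: "d > 0" "\<And>i j t \<tau>. i < p \<Longrightarrow> j < p \<Longrightarrow> i \<noteq> j \<Longrightarrow> t \<in> {0..1} \<Longrightarrow> \<tau> \<in> {0..2 * T} \<Longrightarrow>
      d \<le> norm (F t i \<tau> - F t j \<tau>)"
  proof (rule uniform_positive[where I = "{(i, j). i < p \<and> j < p \<and> i \<noteq> j}"
        and R = "\<lambda>_ (t, \<tau>). t \<in> {0..1} \<and> \<tau> \<in> {0..2 * T}"
        and f = "\<lambda>(i, j) (t, \<tau>). norm (F t i \<tau> - F t j \<tau>)"])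
    show "finite {(i, j). i < p \<and> j < p \<and> i \<noteq> j}"
      by (rule finite_subset[of _ "{..<p} \<times> {..<p}"]) auto
  qed (use sep in \<open>auto\<close>)
  have "\<exists>M. \<forall>\<tau>\<in>{0..2 * T}. norm (D i \<tau>) \<le> M" if "i < p" for i
  proof (intro exI ballI)
    fix \<tau> assume \<tau>: "\<tau> \<in> {0..2 * T}"
    have "norm (D i \<tau>) \<le> norm (D i 0) + norm (D i \<tau> - D i 0)"
      using norm_triangle_sub by blast
    also have "norm (D i \<tau> - D i 0) \<le> K * (2 * T)"
      using LD[OF that \<tau>, of 0] \<tau> T mult_left_mono[OF _ K, of \<tau> "2 * T"] by simp
    finally show "norm (D i \<tau>) \<le> norm (D i 0) + K * (2 * T)" by simp
  qed
  then obtain m where m: "\<And>i \<tau>. i < p \<Longrightarrow> \<tau> \<in> {0..2 * T} \<Longrightarrow> norm (D i \<tau>) \<le> m i" by metis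
  define M where "M = (\<Sum>i<p. \<bar>m i\<bar>)"
  have M: "norm (D i \<tau>) \<le> M" if "i < p" "\<tau> \<in> {0..2 * T}" for i \<tau>
    using m[OF that] member_le_sum[of i "{..<p}" "\<lambda>i. \<bar>m i\<bar>"] that(1) unfolding M_def by fastforce
  have M0: "M \<ge> 0" by (simp add: M_def sum_nonneg)
  define a where "a = pi / T"
  have a: "a > 0" using T by (simp add: a_def)
  \<comment> \<open>First entry: one string at two times, where the displacement changes by at most
    \<open>K\<close> times the time gap. Second entry: two strings, where displacements are bounded
    by \<open>M\<close> and the distance is at least \<open>d / (1 + K / a)\<close>.\<close>
  define e where "e = min (a / (K + 1)) (d / ((1 + K / a) * (2 * M + 1)))"
  have "K + 1 > 0" "1 + K / a > 0" "2 * M + 1 > 0"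
    using a K M0 by (auto intro: add_pos_nonneg)
  then have e: "e > 0" using a d(1) by (simp add: e_def)
  have core: "e * norm (D i \<tau> - D j \<tau>') \<le> norm (F t i \<tau> - F t j \<tau>')"
    if t: "t \<in> {0..1}" and ij: "i < p" "j < p" and \<tau>: "\<tau> \<in> {0..2 * T}" "\<tau>' \<in> {0..2 * T}" "\<bar>\<tau> - \<tau>'\<bar> \<le> T / 2"
    for t i j \<tau> \<tau>'
  proof -
    let ?n = "norm (F t i \<tau> - F t j \<tau>')"
    have an: "\<bar>\<tau> - \<tau>'\<bar> \<le> ?n / a"
      using ang[OF t ij \<tau>] a by (simp add: a_def[symmetric] field_simps)
    then have Kn: "K * \<bar>\<tau> - \<tau>'\<bar> \<le> K * (?n / a)"
      using K by (intro mult_left_mono)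
    show ?thesis
    proof (cases "i = j")
      case True
      have "e * norm (D i \<tau> - D j \<tau>') \<le> (a / (K + 1)) * (K * (?n / a))"
        using LD[OF ij(1) \<tau>(1,2)] Kn True a K e by (intro mult_mono) (auto simp: e_def)
      also have "\<dots> = (K / (K + 1)) * ?n" using a by simp
      also have "\<dots> \<le> 1 * ?n" using K by (intro mult_right_mono) auto
      finally show ?thesis by simp
    next
      case False
      have "d \<le> norm (F t i \<tau> - F t j \<tau>)" using d(2) t ij \<tau> False by blast
      also have "\<dots> \<le> ?n + norm (F t j \<tau> - F t j \<tau>')"
        using norm_triangle_ineq[of "F t i \<tau> - F t j \<tau>'" "F t j \<tau>' - F t j \<tau>"] by (simp add: norm_minus_commute)
      also have "\<dots> \<le> ?n + K * (?n / a)"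
        using LF[OF t ij(2) \<tau>(1,2)] Kn by linarith
      also have "\<dots> = (1 + K / a) * ?n" by (simp add: algebra_simps)
      finally have dn: "d / (1 + K / a) \<le> ?n"
        using K a by (subst pos_divide_le_eq) (auto simp: add_pos_nonneg mult.commute)
      have "norm (D i \<tau> - D j \<tau>') \<le> 2 * M + 1"
        using norm_triangle_ineq4[of "D i \<tau>" "D j \<tau>'"] M[OF ij(1) \<tau>(1)] M[OF ij(2) \<tau>(2)] by linarith
      then have "e * norm (D i \<tau> - D j \<tau>') \<le> (d / ((1 + K / a) * (2 * M + 1))) * (2 * M + 1)"
        using e by (intro mult_mono) (auto simp: e_def)
      also have "\<dots> = d / (1 + K / a)" using M0 by simp
      finally show ?thesis using dn by linarith
    qed
  qed
  let ?u = "\<lambda>(i, \<tau>). cyl (2 * pi * \<tau> / T) (P i \<tau>)" and ?v = "\<lambda>(i, \<tau>). cyl (2 * pi * \<tau> / T) (Q i \<tau>)"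
  have wrap: "c A i' (\<tau> + T) = c A i \<tau>"
    if "\<sigma> i' = i" "i' < p" "\<tau> \<in> {0..T}" "\<And>i. i < p \<Longrightarrow> A i T = A (\<sigma> i) 0" for A i i' \<tau>
  proof -
    have "2 * pi * (\<tau> + T) / T = 2 * pi * \<tau> / T + 2 * pi" using T by (simp add: field_simps)
    moreover have "ext A i' (\<tau> + T) = ext A i \<tau>" using that by (auto simp: ext_def)
    ultimately show ?thesis by (simp add: c_def)
  qed
  \<comment> \<open>Two points of a circle are at most half a turn apart: adding a turn to one of
    the times, and passing to the predecessor string, brings the times within
    \<open>T / 2\<close>.\<close>
  have lift: "\<exists>i1 j1 \<tau>1 \<tau>1'. i1 < p \<and> j1 < p \<and> \<tau>1 \<in> {0..2 * T} \<and> \<tau>1' \<in> {0..2 * T} \<and> \<bar>\<tau>1 - \<tau>1'\<bar> \<le> T / 2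
      \<and> c P i1 \<tau>1 = c P i \<tau> \<and> c Q i1 \<tau>1 = c Q i \<tau> \<and> c P j1 \<tau>1' = c P j \<tau>' \<and> c Q j1 \<tau>1' = c Q j \<tau>'"
    if ij: "i < p" "j < p" and \<tau>: "\<tau> \<in> {0..T}" "\<tau>' \<in> {0..T}" for i j \<tau> \<tau>'
  proof -
    obtain i' where i': "i' < p" "\<sigma> i' = i" using \<sigma> ij(1) by (metis imageE lessThan_iff)
    obtain j' where j': "j' < p" "\<sigma> j' = j" using \<sigma> ij(2) by (metis imageE lessThan_iff)
    consider "\<bar>\<tau> - \<tau>'\<bar> \<le> T / 2" | "\<bar>\<tau> + T - \<tau>'\<bar> \<le> T / 2" | "\<bar>\<tau> - (\<tau>' + T)\<bar> \<le> T / 2"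
      using \<tau> T unfolding atLeastAtMost_iff by argo
    then show ?thesis
    proof cases
      case 1 then show ?thesis using ij \<tau> T by (intro exI[of _ i] exI[of _ j] exI[of _ \<tau>] exI[of _ \<tau>']) auto
    next
      case 2
      then show ?thesis
        using ij \<tau> T i' wrap[OF i'(2,1) \<tau>(1), of P] wrap[OF i'(2,1) \<tau>(1), of Q] perP perQ
        by (intro exI[of _ i'] exI[of _ j] exI[of _ "\<tau> + T"] exI[of _ \<tau>']) auto
    next
      case 3
      then show ?thesis
        using ij \<tau> T j' wrap[OF j'(2,1) \<tau>(2), of P] wrap[OF j'(2,1) \<tau>(2), of Q] perP perQ
        by (intro exI[of _ i] exI[of _ j'] exI[of _ \<tau>] exI[of _ "\<tau>' + T"]) auto
    qed
  qed
  have uv: "?u (i, \<tau>) = c P i \<tau>" "?v (i, \<tau>) = c Q i \<tau>" if "\<tau> \<in> {0..T}" for i \<tau>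
    using that by (auto simp: c_def ext_def)
  show ?thesis
    unfolding track_closure_def
  proof (rule ambient_isotopic_linear_homotopy[OF e])
    fix t x y assume t: "t \<in> {0..1::real}" and x: "x \<in> {..<p} \<times> {0..T}" and y: "y \<in> {..<p} \<times> {0..T}"
    obtain i \<tau> j \<tau>' where xy: "x = (i, \<tau>)" "y = (j, \<tau>')" by (cases x, cases y)
    have b: "i < p" "j < p" "\<tau> \<in> {0..T}" "\<tau>' \<in> {0..T}" using x y xy by auto
    obtain i1 j1 \<tau>1 \<tau>1' where l: "i1 < p" "j1 < p" "\<tau>1 \<in> {0..2 * T}" "\<tau>1' \<in> {0..2 * T}" "\<bar>\<tau>1 - \<tau>1'\<bar> \<le> T / 2"
      "c P i1 \<tau>1 = c P i \<tau>" "c Q i1 \<tau>1 = c Q i \<tau>" "c P j1 \<tau>1' = c P j \<tau>'" "c Q j1 \<tau>1' = c Q j \<tau>'"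
      using lift[OF b] by blast
    show "e * norm ((?v x - ?u x) - (?v y - ?u y)) \<le> norm ((?u x + t *\<^sub>R (?v x - ?u x)) - (?u y + t *\<^sub>R (?v y - ?u y)))"
      using core[OF t l(1-5)] unfolding xy uv[OF b(3)] uv[OF b(4)] F_def D_def l(6-9) .
  qed
qed

section \<open>Homotopy of braids\<close>

text \<open>A geometric braid, parametrized by time in \<open>{0..dur a}\<close>: the string starting in position \<open>i\<close>
  is at radius \<open>fst (strand a i \<tau>)\<close> and height \<open>snd (strand a i \<tau>)\<close>; position \<open>i\<close> is radius \<open>i + 1\<close>.\<close>
datatype track = Track (dur: real) (strand: "nat \<Rightarrow> real \<Rightarrow> real \<times> real") (perm: "nat \<Rightarrow> nat")

text \<open>Radius at least 1 keeps the strings off the axis, where a difference of angles gives no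
  distance. Disjointness is demanded at equal times, since different times within a turn are
  different angles.\<close>

definition braid :: "nat \<Rightarrow> track \<Rightarrow> bool" where
  "braid p a \<longleftrightarrow> 0 \<le> dur a \<and> perm a permutes {..<p} \<and>
     (\<forall>i<p. (\<exists>K. K-lipschitz_on {0..dur a} (strand a i)) \<and>
        strand a i 0 = (real i + 1, 0) \<and> strand a i (dur a) = (real (perm a i) + 1, 0) \<and>
        (\<forall>\<tau>\<in>{0..dur a}. 1 \<le> fst (strand a i \<tau>) \<and> (\<forall>j<p. i \<noteq> j \<longrightarrow> strand a i \<tau> \<noteq> strand a j \<tau>)))"

definition closure_of_track :: "nat \<Rightarrow> track \<Rightarrow> R3 set" where
  "closure_of_track p a = track_closure p (dur a) (strand a)"

text \<open>One straight-line deformation through braids; \<open>sim\<close> allows finitely many.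
  Time is never rescaled, so duration and permutation are invariants of \<open>sim\<close>.\<close>

definition lin :: "nat \<Rightarrow> track \<Rightarrow> track \<Rightarrow> bool" where
  "lin p a b \<longleftrightarrow> braid p a \<and> braid p b \<and> dur a = dur b \<and> perm a = perm b \<and>
     (\<forall>t\<in>{0..1}. \<forall>\<tau>\<in>{0..dur a}. \<forall>i<p. \<forall>j<p. i \<noteq> j \<longrightarrow>
        (1 - t) *\<^sub>R strand a i \<tau> + t *\<^sub>R strand b i \<tau> \<noteq> (1 - t) *\<^sub>R strand a j \<tau> + t *\<^sub>R strand b j \<tau>)"

abbreviation sim :: "nat \<Rightarrow> track \<Rightarrow> track \<Rightarrow> bool" where
  "sim p \<equiv> (lin p)\<^sup>*\<^sup>*"

definition cat :: "track \<Rightarrow> track \<Rightarrow> track" where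
  "cat a b = Track (dur a + dur b)
     (\<lambda>i \<tau>. if \<tau> \<le> dur a then strand a i \<tau> else strand b (perm a i) (\<tau> - dur a)) (perm b \<circ> perm a)"

lemma dur_cat [simp]: "dur (cat a b) = dur a + dur b"
  and perm_cat [simp]: "perm (cat a b) = perm b \<circ> perm a"
  by (simp_all add: cat_def)

lemma strand_cat: "strand (cat a b) i \<tau> = (if \<tau> \<le> dur a then strand a i \<tau> else strand b (perm a i) (\<tau> - dur a))"
  by (simp add: cat_def)

text \<open>Durations add instead of being rescaled, so associativity is an equality;
  \<open>dur b \<ge> 0\<close> makes the two nested case distinctions agree.\<close>

lemma cat_assoc: "dur b \<ge> 0 \<Longrightarrow> cat (cat a b) c = cat a (cat b c)"
  by (auto simp: cat_def fun_eq_iff algebra_simps)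

lemma perm_lt: "braid p a \<Longrightarrow> i < p \<Longrightarrow> perm a i < p"
  using permutes_in_image[of "perm a" "{..<p}" i] by (simp add: braid_def)

lemma perm_neq: "braid p a \<Longrightarrow> i \<noteq> j \<Longrightarrow> perm a i \<noteq> perm a j"
  unfolding braid_def using permutes_inj injD by metis

lemma lipschitz_cat:
  assumes "\<exists>K. K-lipschitz_on {0..dur a} (strand a i)"
    and "\<exists>K. K-lipschitz_on {0..dur b} (strand b (perm a i))"
    and "strand a i (dur a) = strand b (perm a i) 0"
  shows "\<exists>K. K-lipschitz_on {0..dur (cat a b)} (strand (cat a b) i)"
proof -
  obtain K1 K2 where K: "K1-lipschitz_on {0..dur a} (strand a i)" "K2-lipschitz_on {0..dur b} (strand b (perm a i))"
    using assms by blast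
  have "K2-lipschitz_on {dur a..dur a + dur b} (\<lambda>x. strand b (perm a i) (x - dur a))"
    using lipschitz_on_shift[OF K(2), of "dur a"] by simp
  then have "(max K1 K2)-lipschitz_on {0..dur a + dur b}
      (\<lambda>x. if x \<le> dur a then strand a i x else strand b (perm a i) (x - dur a))"
    using K(1) assms(3) by (intro lipschitz_on_concat_max) auto
  then show ?thesis by (auto simp: cat_def)
qed

lemma braid_cat:
  assumes a: "braid p a" and b: "braid p b"
  shows "braid p (cat a b)"
  unfolding braid_def
proof (intro conjI allI impI ballI)
  show "0 \<le> dur (cat a b)" using a b by (simp add: braid_def)
  show "perm (cat a b) permutes {..<p}" using a b by (simp add: braid_def permutes_compose)
  fix i assume i: "i < p"
  have i': "perm a i < p" using perm_lt[OF a i] .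
  show "\<exists>K. K-lipschitz_on {0..dur (cat a b)} (strand (cat a b) i)"
    using a b i i' by (intro lipschitz_cat) (auto simp: braid_def)
  show "strand (cat a b) i 0 = (real i + 1, 0)"
    using a i by (simp add: strand_cat braid_def)
  show "strand (cat a b) i (dur (cat a b)) = (real (perm (cat a b) i) + 1, 0)"
    using a b i i' by (cases "dur b = 0") (auto simp: strand_cat braid_def)
  fix \<tau> assume \<tau>: "\<tau> \<in> {0..dur (cat a b)}"
  show "1 \<le> fst (strand (cat a b) i \<tau>)"
    using a b i i' \<tau> by (auto simp: strand_cat braid_def)
  fix j assume j: "j < p" "i \<noteq> j"
  show "strand (cat a b) i \<tau> \<noteq> strand (cat a b) j \<tau>"
    using a b i i' j \<tau> perm_lt[OF a j(1)] perm_neq[OF a j(2)] by (auto simp: strand_cat braid_def)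
qed

text \<open>Tracks are total functions; this identifies those that differ only outside the positions
  below \<open>p\<close> and the times in \<open>{0..dur a}\<close>.\<close>

lemma lin_refl:
  assumes "braid p a" and "dur b = dur a" "perm b = perm a"
    and eq: "\<And>i \<tau>. i < p \<Longrightarrow> \<tau> \<in> {0..dur a} \<Longrightarrow> strand b i \<tau> = strand a i \<tau>"
  shows "lin p a b"
proof -
  have "braid p b"
    unfolding braid_def
  proof (intro conjI allI impI ballI)
    fix i assume i: "i < p"
    obtain K where "K-lipschitz_on {0..dur a} (strand a i)"
      using assms(1) i by (auto simp: braid_def)
    then have "K-lipschitz_on {0..dur b} (strand b i)"
      using lipschitz_on_transform[of K "{0..dur a}" "strand a i" "strand b i"] eq[OF i] assms(2) by simp
    then show "\<exists>K. K-lipschitz_on {0..dur b} (strand b i)" by blast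
  qed (use assms in \<open>auto simp: braid_def\<close>)
  then show ?thesis
    using assms by (auto simp: lin_def braid_def algebra_simps)
qed

lemma lin_sym:
  assumes "lin p a b"
  shows "lin p b a"
  unfolding lin_def
proof (intro conjI ballI allI impI)
  fix t \<tau> i j assume *: "t \<in> {0..1::real}" "\<tau> \<in> {0..dur b}" "i < p" "j < p" "i \<noteq> j"
  have "1 - t \<in> {0..1}" "\<tau> \<in> {0..dur a}" using * assms by (auto simp: lin_def)
  then have "(1 - (1 - t)) *\<^sub>R strand a i \<tau> + (1 - t) *\<^sub>R strand b i \<tau> \<noteq> (1 - (1 - t)) *\<^sub>R strand a j \<tau> + (1 - t) *\<^sub>R strand b j \<tau>"
    using assms * unfolding lin_def by blast
  then show "(1 - t) *\<^sub>R strand b i \<tau> + t *\<^sub>R strand a i \<tau> \<noteq> (1 - t) *\<^sub>R strand b j \<tau> + t *\<^sub>R strand a j \<tau>"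
    by (simp add: add.commute)
qed (use assms in \<open>auto simp: lin_def\<close>)

lemma sim_sym: "sim p a b \<Longrightarrow> sim p b a"
  by (induction rule: rtranclp_induct) (auto intro: lin_sym converse_rtranclp_into_rtranclp)

lemma braid_lin: "lin p a b \<Longrightarrow> braid p b" by (simp add: lin_def)

lemma braid_sim: "sim p a b \<Longrightarrow> braid p a \<Longrightarrow> braid p b"
  by (induction rule: rtranclp_induct) (auto dest: braid_lin)

lemma sim_same:
  assumes "sim p a b"
  shows "dur b = dur a" "perm b = perm a"
  using assms by (induction rule: rtranclp_induct) (auto simp: lin_def)

lemma lin_cat1:
  assumes ab: "lin p a b" and c: "braid p c"
  shows "lin p (cat a c) (cat b c)"
  unfolding lin_def
proof (intro conjI ballI allI impI)
  have br: "braid p a" "braid p b" and same: "dur a = dur b" "perm a = perm b"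
    using ab by (auto simp: lin_def)
  show "braid p (cat a c)" "braid p (cat b c)" using br c braid_cat by blast+
  show "dur (cat a c) = dur (cat b c)" "perm (cat a c) = perm (cat b c)" using same by auto
  fix t \<tau> i j assume *: "t \<in> {0..1::real}" "\<tau> \<in> {0..dur (cat a c)}" "i < p" "j < p" "i \<noteq> j"
  let ?ac = "strand (cat a c)" and ?bc = "strand (cat b c)"
  show "(1 - t) *\<^sub>R ?ac i \<tau> + t *\<^sub>R ?bc i \<tau> \<noteq> (1 - t) *\<^sub>R ?ac j \<tau> + t *\<^sub>R ?bc j \<tau>"
  proof (cases "\<tau> \<le> dur a")
    case True
    then show ?thesis using ab * same by (simp add: strand_cat lin_def)
  next
    case False
    have "strand c (perm a i) (\<tau> - dur a) \<noteq> strand c (perm a j) (\<tau> - dur a)"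
      using c * False perm_lt[OF br(1)] perm_neq[OF br(1)] by (auto simp: braid_def)
    then show ?thesis using False same by (simp add: strand_cat flip: scaleR_left.add)
  qed
qed

lemma lin_cat2:
  assumes ab: "lin p a b" and c: "braid p c"
  shows "lin p (cat c a) (cat c b)"
  unfolding lin_def
proof (intro conjI ballI allI impI)
  have br: "braid p a" "braid p b" and same: "dur a = dur b" "perm a = perm b"
    using ab by (auto simp: lin_def)
  show "braid p (cat c a)" "braid p (cat c b)" using br c braid_cat by blast+
  show "dur (cat c a) = dur (cat c b)" "perm (cat c a) = perm (cat c b)" using same by auto
  fix t \<tau> i j assume *: "t \<in> {0..1::real}" "\<tau> \<in> {0..dur (cat c a)}" "i < p" "j < p" "i \<noteq> j"
  let ?ac = "strand (cat c a)" and ?bc = "strand (cat c b)"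
  show "(1 - t) *\<^sub>R ?ac i \<tau> + t *\<^sub>R ?bc i \<tau> \<noteq> (1 - t) *\<^sub>R ?ac j \<tau> + t *\<^sub>R ?bc j \<tau>"
  proof (cases "\<tau> \<le> dur c")
    case True
    then have "strand c i \<tau> \<noteq> strand c j \<tau>" using c * by (auto simp: braid_def)
    then show ?thesis using True by (simp add: strand_cat flip: scaleR_left.add)
  next
    case False
    then show ?thesis
      using ab * perm_lt[OF c] perm_neq[OF c *(5)] by (simp add: strand_cat lin_def)
  qed
qed

lemma sim_cat:
  assumes "sim p a a'" "sim p b b'" "braid p a" "braid p b"
  shows "sim p (cat a b) (cat a' b')"
proof -
  have "sim p (cat a b) (cat a' b)"
    using assms(1) by (induction rule: rtranclp_induct)
      (auto intro: rtranclp.rtrancl_into_rtrancl lin_cat1[OF _ assms(4)])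
  moreover have "sim p (cat a' b) (cat a' b')"
    using assms(2) by (induction rule: rtranclp_induct)
      (auto intro: rtranclp.rtrancl_into_rtrancl lin_cat2[OF _ braid_sim[OF assms(1,3)]])
  ultimately show ?thesis by simp
qed

lemma lin_closure:
  assumes "lin p a b" "dur a > 0"
  shows "ambient_isotopic (closure_of_track p a) (closure_of_track p b)"
proof -
  have d: "dur b = dur a" using assms(1) by (simp add: lin_def)
  have "perm a ` {..<p} = {..<p}"
    using assms(1) permutes_image by (auto simp: lin_def braid_def)
  then show ?thesis
    unfolding closure_of_track_def d
    using assms perm_lt[of p a] by (intro track_closure_linear_homotopy[where \<sigma> = "perm a"]) (auto simp: lin_def braid_def)
qed

lemma sim_closure:
  assumes "sim p a b" "dur a > 0"
  shows "ambient_isotopic (closure_of_track p a) (closure_of_track p b)"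
  using assms
proof (induction rule: rtranclp_induct)
  case (step b c)
  then have "dur b > 0" using sim_same by metis
  then show ?case using step ambient_isotopic_trans lin_closure by blast
qed (rule ambient_isotopic_refl)

section \<open>Letters: straight motions with prescribed heights\<close>

definition tent :: "real \<Rightarrow> real" where
  "tent s = 1 - \<bar>2 * s - 1\<bar>"

lemma tent_simps [simp]: "tent 0 = 0" "tent 1 = 0"
  by (simp_all add: tent_def)

lemma tent_pos: "0 < s \<Longrightarrow> s < 1 \<Longrightarrow> 0 < tent s"
  by (auto simp: tent_def)

lemma tent_nonneg: "0 \<le> s \<Longrightarrow> s \<le> 1 \<Longrightarrow> 0 \<le> tent s"
  by (auto simp: tent_def)

text \<open>Generalizes a crossing to arbitrary permutations and real heights, keeping its straight
  lines and its height profile \<open>tent\<close>. In this larger class crossings can be split and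
  recombined.\<close>

definition letter :: "real \<Rightarrow> (nat \<Rightarrow> nat) \<Rightarrow> (nat \<Rightarrow> real) \<Rightarrow> track" where
  "letter d \<pi> h = Track d
     (\<lambda>i \<tau>. (1 + real i + (\<tau> / d) * (real (\<pi> i) - real i), h i * tent (\<tau> / d))) \<pi>"

lemma dur_letter [simp]: "dur (letter d \<pi> h) = d"
  and perm_letter [simp]: "perm (letter d \<pi> h) = \<pi>"
  by (simp_all add: letter_def)

lemma strand_letter: "strand (letter d \<pi> h) i \<tau> = (1 + real i + (\<tau> / d) * (real (\<pi> i) - real i), h i * tent (\<tau> / d))"
  by (simp add: letter_def)

lemma lipschitz_tent:
  assumes "d > 0"
  shows "(2 / d)-lipschitz_on {0..d} (\<lambda>\<tau>. tent (\<tau> / d))"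
proof (rule lipschitz_onI)
  fix x y
  have "(2 * (x / d) - 1) - (2 * (y / d) - 1) = 2 / d * (x - y)"
    by (simp add: right_diff_distrib diff_divide_distrib)
  moreover have "\<bar>tent (x / d) - tent (y / d)\<bar> \<le> \<bar>(2 * (x / d) - 1) - (2 * (y / d) - 1)\<bar>"
    unfolding tent_def by linarith
  ultimately have "\<bar>tent (x / d) - tent (y / d)\<bar> \<le> \<bar>2 / d * (x - y)\<bar>"
    by simp
  then show "dist (tent (x / d)) (tent (y / d)) \<le> 2 / d * dist x y"
    using assms by (simp only: dist_real_def abs_mult) simp
qed (use assms in simp)

lemma lipschitz_letter:
  assumes "d > 0"
  shows "\<exists>K. K-lipschitz_on {0..d} (strand (letter d \<pi> h) i)"
proof -
  let ?K1 = "\<bar>real (\<pi> i) - real i\<bar> / d" and ?K2 = "\<bar>h i\<bar> * (2 / d)"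
  have 1: "?K1-lipschitz_on {0..d} (\<lambda>\<tau>. 1 + real i + (\<tau> / d) * (real (\<pi> i) - real i))"
  proof (rule lipschitz_onI)
    fix x y
    have "(1 + real i + (x / d) * (real (\<pi> i) - real i)) - (1 + real i + (y / d) * (real (\<pi> i) - real i))
       = (real (\<pi> i) - real i) / d * (x - y)"
      by (simp add: algebra_simps diff_divide_distrib)
    then show "dist (1 + real i + (x / d) * (real (\<pi> i) - real i)) (1 + real i + (y / d) * (real (\<pi> i) - real i)) \<le> ?K1 * dist x y"
      unfolding dist_real_def using assms by (simp only: abs_mult abs_divide abs_of_pos)
  qed (use assms in simp)
  have 2: "?K2-lipschitz_on {0..d} (\<lambda>\<tau>. h i * tent (\<tau> / d))"
    by (rule lipschitz_on_cmult_real[OF lipschitz_tent[OF assms]])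
  show ?thesis
    using lipschitz_on_Pair[OF 1 2] unfolding letter_def by auto
qed

text \<open>The gap between the two lines changes linearly from \<open>j - i\<close> to
  \<open>\<pi> j - \<pi> i\<close>, so it vanishes only if these have opposite signs, and then
  strictly between the ends. Only inverted pairs meet.\<close>

lemma letter_meet:
  assumes s: "s \<in> {0..1}" and ij: "i < j"
    and eq: "1 + real i + s * (real (\<pi> i) - real i) = 1 + real j + s * (real (\<pi> j) - real j)" and ne: "\<pi> i \<noteq> \<pi> j"
  shows "\<pi> j < \<pi> i" "0 < s" "s < 1"
proof -
  have *: "(1 - s) * (real j - real i) = s * (real (\<pi> i) - real (\<pi> j))"
    using eq by (simp add: algebra_simps)
  have "s \<noteq> 0" using * ij by auto
  then show s0: "0 < s" using s by simp
  have "s \<noteq> 1" using * ne by auto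
  then show "s < 1" using s by simp
  then have "0 < s * (real (\<pi> i) - real (\<pi> j))" using * ij by (metis diff_gt_0_iff_gt of_nat_less_iff mult_pos_pos)
  then show "\<pi> j < \<pi> i" using s0 by (simp add: zero_less_mult_iff)
qed

text \<open>Distinct heights are demanded of inverted pairs only: a crossing gives height 0 to every
  string outside its window.\<close>

definition good :: "nat \<Rightarrow> (nat \<Rightarrow> nat) \<Rightarrow> (nat \<Rightarrow> real) \<Rightarrow> bool" where
  "good p \<pi> h \<longleftrightarrow> \<pi> permutes {..<p} \<and> (\<forall>i j. i < j \<and> j < p \<and> \<pi> j < \<pi> i \<longrightarrow> h i \<noteq> h j)"

lemma good_inj: "\<pi> permutes {..<p} \<Longrightarrow> inj_on h {..<p} \<Longrightarrow> good p \<pi> h"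
  by (auto simp: good_def inj_on_def)

lemma letter_comb_neq:
  assumes \<pi>: "\<pi> permutes {..<p}" and d: "d > 0" and \<tau>: "\<tau> \<in> {0..d}" and t: "t \<in> {0..1}"
    and h: "\<And>i j. i < j \<Longrightarrow> j < p \<Longrightarrow> \<pi> j < \<pi> i \<Longrightarrow> (1 - t) * h i + t * h' i \<noteq> (1 - t) * h j + t * h' j"
    and ij: "i < j" "j < p"
  shows "(1 - t) *\<^sub>R strand (letter d \<pi> h) i \<tau> + t *\<^sub>R strand (letter d \<pi> h') i \<tau>
     \<noteq> (1 - t) *\<^sub>R strand (letter d \<pi> h) j \<tau> + t *\<^sub>R strand (letter d \<pi> h') j \<tau>"
proof
  assume eq: "(1 - t) *\<^sub>R strand (letter d \<pi> h) i \<tau> + t *\<^sub>R strand (letter d \<pi> h') i \<tau>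
     = (1 - t) *\<^sub>R strand (letter d \<pi> h) j \<tau> + t *\<^sub>R strand (letter d \<pi> h') j \<tau>"
  have s: "\<tau> / d \<in> {0..1}" using \<tau> d by auto
  have ne: "\<pi> i \<noteq> \<pi> j" using permutes_inj[OF \<pi>] ij by (auto simp: inj_def)
  have comb: "(1 - t) * x + t * x = x" for x :: real by (simp add: algebra_simps)
  have "1 + real i + (\<tau> / d) * (real (\<pi> i) - real i) = 1 + real j + (\<tau> / d) * (real (\<pi> j) - real j)"
    using eq by (simp only: strand_letter fst_add fst_scaleR prod_eq_iff fst_conv real_scaleR_def comb)
  note m = letter_meet[OF s ij(1) this ne]
  have "(1 - t) * (h i * tent (\<tau> / d)) + t * (h' i * tent (\<tau> / d)) = (1 - t) * (h j * tent (\<tau> / d)) + t * (h' j * tent (\<tau> / d))"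
    using eq by (simp only: strand_letter snd_add snd_scaleR prod_eq_iff snd_conv real_scaleR_def)
  then have "((1 - t) * h i + t * h' i) * tent (\<tau> / d) = ((1 - t) * h j + t * h' j) * tent (\<tau> / d)"
    by (simp add: algebra_simps)
  then show False using h[OF ij m(1)] tent_pos[OF m(2,3)] by simp
qed

lemma braid_letter:
  assumes g: "good p \<pi> h" and d: "d > 0"
  shows "braid p (letter d \<pi> h)"
  unfolding braid_def dur_letter perm_letter
proof (intro conjI allI impI ballI)
  show \<pi>: "\<pi> permutes {..<p}" using g by (simp add: good_def)
  fix i assume i: "i < p"
  show "\<exists>K. K-lipschitz_on {0..d} (strand (letter d \<pi> h) i)" using lipschitz_letter[OF d] .
  show "strand (letter d \<pi> h) i 0 = (real i + 1, 0)"
    "strand (letter d \<pi> h) i d = (real (\<pi> i) + 1, 0)"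
    using d by (auto simp: strand_letter)
  fix \<tau> assume \<tau>: "\<tau> \<in> {0..d}"
  have "0 \<le> (1 - \<tau> / d) * real i + (\<tau> / d) * real (\<pi> i)"
    using \<tau> d by (intro add_nonneg_nonneg mult_nonneg_nonneg) auto
  then show "1 \<le> fst (strand (letter d \<pi> h) i \<tau>)" by (simp add: strand_letter algebra_simps)
  have *: "strand (letter d \<pi> h) i \<tau> \<noteq> strand (letter d \<pi> h) j \<tau>" if "i < j" "j < p" for i j
    using letter_comb_neq[OF \<pi> d \<tau>, where t = 0 and h = h and h' = h and i = i and j = j] that g by (auto simp: good_def)
  fix j assume "j < p" "i \<noteq> j"
  then show "strand (letter d \<pi> h) i \<tau> \<noteq> strand (letter d \<pi> h) j \<tau>"
    using *[of i j] *[of j i] i by (metis linorder_neqE_nat)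
qed (use d in auto)

text \<open>A pair that meets has the same strict order of heights in both letters, hence in every
  convex combination. So the order of heights on inverted pairs determines the letter up to
  homotopy.\<close>

lemma lin_letter_heights:
  assumes g: "good p \<pi> h" "good p \<pi> h'" and d: "d > 0"
    and h: "\<And>i j. i < j \<Longrightarrow> j < p \<Longrightarrow> \<pi> j < \<pi> i \<Longrightarrow> h i < h j \<longleftrightarrow> h' i < h' j"
  shows "lin p (letter d \<pi> h) (letter d \<pi> h')"
  unfolding lin_def dur_letter perm_letter
proof (intro conjI ballI allI impI refl braid_letter[OF g(1) d] braid_letter[OF g(2) d])
  have \<pi>: "\<pi> permutes {..<p}" using g by (simp add: good_def)
  fix t \<tau> assume t: "t \<in> {0..1::real}" and \<tau>: "\<tau> \<in> {0..d}"
  have comb: "(1 - t) * a + t * b < (1 - t) * a' + t * b'" if "a < a'" "b < b'" for a a' b b'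
  proof (cases "t = 0")
    case False
    then show ?thesis using that t
      by (intro add_le_less_mono mult_left_mono mult_strict_left_mono) auto
  qed (use that in simp)
  have ne: "(1 - t) * h i + t * h' i \<noteq> (1 - t) * h j + t * h' j" if ij: "i < j" "j < p" "\<pi> j < \<pi> i" for i j
  proof (cases "h i < h j")
    case True
    then show ?thesis using h[OF ij] comb[of "h i" "h j" "h' i" "h' j"] by simp
  next
    case False
    moreover have "h i \<noteq> h j" "h' i \<noteq> h' j" using g ij by (auto simp: good_def)
    ultimately show ?thesis using h[OF ij] comb[of "h j" "h i" "h' j" "h' i"] by simp
  qed
  note * = letter_comb_neq[where h = h and h' = h', OF \<pi> d \<tau> t ne]
  fix i j :: nat assume "i < p" "j < p" "i \<noteq> j"
  then show "(1 - t) *\<^sub>R strand (letter d \<pi> h) i \<tau> + t *\<^sub>R strand (letter d \<pi> h') i \<tau>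
     \<noteq> (1 - t) *\<^sub>R strand (letter d \<pi> h) j \<tau> + t *\<^sub>R strand (letter d \<pi> h') j \<tau>"
    using *[of i j] *[of j i] by (cases "i < j") (auto simp: not_less le_less)
qed

text \<open>Each string owns a factor \<open>h i\<close> and all share one profile \<open>g\<close>,
  so strings with distinct factors are disjoint while \<open>g\<close> is positive. Intermediate
  zeros of \<open>g\<close> are allowed, as they occur at the joints of concatenations.\<close>

definition level :: "nat \<Rightarrow> (nat \<Rightarrow> real) \<Rightarrow> track \<Rightarrow> bool" where
  "level p h a \<longleftrightarrow> braid p a \<and> (\<exists>g. (\<exists>K. K-lipschitz_on {0..dur a} g) \<and> g 0 = 0 \<and> g (dur a) = 0 \<and>
     (\<forall>\<tau>\<in>{0..dur a}. 0 \<le> g \<tau> \<and> (\<forall>i<p. snd (strand a i \<tau>) = h i * g \<tau>)))"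

lemma level_letter:
  assumes "good p \<pi> h" "d > 0"
  shows "level p h (letter d \<pi> h)"
  unfolding level_def
proof (intro conjI exI[of _ "\<lambda>\<tau>. tent (\<tau> / d)"] exI[of _ "2 / d"] ballI allI impI)
  fix \<tau> assume "\<tau> \<in> {0..dur (letter d \<pi> h)}"
  then show "0 \<le> tent (\<tau> / d)" using assms(2) by (intro tent_nonneg) auto
qed (use assms braid_letter lipschitz_tent in \<open>simp_all add: strand_letter\<close>)

text \<open>After \<open>a\<close> the string with factor \<open>h i\<close> sits in position
  \<open>perm a i\<close>, so the factors seen from the new positions are
  \<open>h \<circ> inv (perm a)\<close>.\<close>

lemma level_cat:
  assumes a: "level p h a" and b: "level p (h \<circ> inv (perm a)) b"
  shows "level p h (cat a b)"
proof -
  have br: "braid p a" "braid p b" using a b by (auto simp: level_def)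
  obtain g1 K1 where g1: "K1-lipschitz_on {0..dur a} g1" "g1 0 = 0" "g1 (dur a) = 0"
     "\<forall>\<tau>\<in>{0..dur a}. 0 \<le> g1 \<tau> \<and> (\<forall>i<p. snd (strand a i \<tau>) = h i * g1 \<tau>)"
    using a unfolding level_def by blast
  obtain g2 K2 where g2: "K2-lipschitz_on {0..dur b} g2" "g2 0 = 0" "g2 (dur b) = 0"
     "\<forall>\<tau>\<in>{0..dur b}. 0 \<le> g2 \<tau> \<and> (\<forall>i<p. snd (strand b i \<tau>) = (h \<circ> inv (perm a)) i * g2 \<tau>)"
    using b unfolding level_def by blast
  define g where "g \<tau> = (if \<tau> \<le> dur a then g1 \<tau> else g2 (\<tau> - dur a))" for \<tau>
  have d: "dur a \<ge> 0" "dur b \<ge> 0" using br by (auto simp: braid_def)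
  have iv: "inv (perm a) (perm a i) = i" for i
    using br(1) permutes_inverses(2) unfolding braid_def by metis
  have "(max K1 K2)-lipschitz_on {0..dur (cat a b)} g"
    unfolding g_def dur_cat using g1 g2 lipschitz_on_shift[OF g2(1), of "dur a"]
    by (intro lipschitz_on_concat_max) auto
  moreover have "g 0 = 0" "g (dur (cat a b)) = 0"
    using d g1 g2 by (auto simp: g_def)
  moreover have "0 \<le> g \<tau>" "i < p \<Longrightarrow> snd (strand (cat a b) i \<tau>) = h i * g \<tau>" if "\<tau> \<in> {0..dur (cat a b)}" for i \<tau>
    using that g1(4) g2(4) perm_lt[OF br(1)] by (auto simp: g_def strand_cat iv)
  ultimately show ?thesis
    unfolding level_def using braid_cat[OF br] by blast
qed

text \<open>Lift the strings away from height \<open>0\<close> also at the intermediate times, move them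
  horizontally, and lower them again.\<close>
lemma sim_level:
  assumes a: "level p h a" and b: "level p h b" and same: "dur a = dur b" "perm a = perm b"
    and inj: "inj_on h {..<p}"
  shows "sim p a b"
proof -
  define T where "T = dur a"
  \<comment> \<open>The added \<open>\<tau> * (T - \<tau>)\<close> is positive strictly inside the
    interval and zero at its ends, so it separates the heights at interior zeros of \<open>g\<close>
    without moving the ends.\<close>
  define lifted where "lifted x g = Track T (\<lambda>i \<tau>. (fst (strand x i \<tau>), h i * (g \<tau> + \<tau> * (T - \<tau>)))) (perm x)" for x g
  have main: "lin p x (lifted x g)"
    if x: "braid p x" "dur x = T" and g: "\<exists>K. K-lipschitz_on {0..T} g" "g 0 = 0" "g T = 0"
      "\<And>\<tau> i. \<tau> \<in> {0..T} \<Longrightarrow> i < p \<Longrightarrow> snd (strand x i \<tau>) = h i * g \<tau>" "\<And>\<tau>. \<tau> \<in> {0..T} \<Longrightarrow> 0 \<le> g \<tau>" for x g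
  proof -
    have key: "fst (strand x i \<tau>) \<noteq> fst (strand x j \<tau>) \<or> h i * (g \<tau> + t * (\<tau> * (T - \<tau>))) \<noteq> h j * (g \<tau> + t * (\<tau> * (T - \<tau>)))"
      if "i < p" "j < p" "i \<noteq> j" "\<tau> \<in> {0..T}" "t \<in> {0..1}" for i j \<tau> t
    proof (rule ccontr)
      assume neg: "\<not> ?thesis"
      have "h i \<noteq> h j" using inj that by (auto simp: inj_on_def)
      then have "g \<tau> + t * (\<tau> * (T - \<tau>)) = 0" using neg by simp
      moreover have "0 \<le> t * (\<tau> * (T - \<tau>))" using that by simp
      ultimately have "g \<tau> = 0" using g(5)[OF that(4)] by linarith
      then have "strand x i \<tau> = strand x j \<tau>"
        using neg g(4)[OF that(4)] that by (simp add: prod_eq_iff)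
      then show False using x that by (auto simp: braid_def)
    qed
    have br: "braid p (lifted x g)"
      unfolding braid_def
    proof (intro conjI allI impI ballI)
      fix i assume i: "i < p"
      obtain K where "K-lipschitz_on {0..T} (strand x i)" using x i by (auto simp: braid_def)
      then have 1: "K-lipschitz_on {0..T} (\<lambda>\<tau>. fst (strand x i \<tau>))"
        by (auto simp: lipschitz_on_def intro: order_trans[OF dist_fst_le])
      obtain L where L: "L-lipschitz_on {0..T} g" using g(1) by blast
      have T0: "T \<ge> 0" using x by (simp add: braid_def)
      have "T-lipschitz_on {0..T} (\<lambda>\<tau>. \<tau> * (T - \<tau>))"
      proof (rule lipschitz_onI[OF _ T0])
        fix u v assume uv: "u \<in> {0..T}" "v \<in> {0..T}"
        have "\<bar>u * (T - u) - v * (T - v)\<bar> = \<bar>T - u - v\<bar> * \<bar>u - v\<bar>"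
          by (simp only: abs_mult[symmetric]) (simp add: algebra_simps)
        also have "\<dots> \<le> T * \<bar>u - v\<bar>" using uv by (intro mult_right_mono) auto
        finally show "dist (u * (T - u)) (v * (T - v)) \<le> T * dist u v" by (simp add: dist_real_def)
      qed
      from lipschitz_on_cmult_real[OF lipschitz_on_add[OF L this]]
      have 2: "(\<bar>h i\<bar> * (L + T))-lipschitz_on {0..T} (\<lambda>\<tau>. h i * (g \<tau> + \<tau> * (T - \<tau>)))" .
      show "\<exists>K. K-lipschitz_on {0..dur (lifted x g)} (strand (lifted x g) i)"
        using lipschitz_on_Pair[OF 1 2] by (auto simp: lifted_def)
      show "strand (lifted x g) i 0 = (real i + 1, 0)"
        "strand (lifted x g) i (dur (lifted x g)) = (real (perm (lifted x g) i) + 1, 0)"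
        using x i g(2,3) by (auto simp: lifted_def braid_def)
      fix \<tau> assume \<tau>: "\<tau> \<in> {0..dur (lifted x g)}"
      show "1 \<le> fst (strand (lifted x g) i \<tau>)"
        using x i \<tau> by (auto simp: lifted_def braid_def)
      fix j assume "j < p" "i \<noteq> j"
      then show "strand (lifted x g) i \<tau> \<noteq> strand (lifted x g) j \<tau>"
        using key[of i j \<tau> 1] i \<tau> by (auto simp: lifted_def)
    qed (use x in \<open>auto simp: lifted_def braid_def\<close>)
    show ?thesis
      unfolding lin_def
    proof (intro conjI ballI allI impI x br)
      fix t \<tau> i j assume *: "t \<in> {0..1::real}" "\<tau> \<in> {0..dur x}" "i < p" "j < p" "i \<noteq> j"
      have comb: "(1 - t) *\<^sub>R strand x k \<tau> + t *\<^sub>R strand (lifted x g) k \<tau>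
         = (fst (strand x k \<tau>), h k * (g \<tau> + t * (\<tau> * (T - \<tau>))))" if "k < p" for k
        using g(4)[of \<tau> k] that * x(2) by (simp add: lifted_def prod_eq_iff algebra_simps)
      show "(1 - t) *\<^sub>R strand x i \<tau> + t *\<^sub>R strand (lifted x g) i \<tau> \<noteq> (1 - t) *\<^sub>R strand x j \<tau> + t *\<^sub>R strand (lifted x g) j \<tau>"
        using key[of i j \<tau> t] * x(2) by (simp add: comb)
    qed (use x in \<open>auto simp: lifted_def\<close>)
  qed
  have bra: "braid p a" "braid p b" using a b by (auto simp: level_def)
  obtain g where g: "\<exists>K. K-lipschitz_on {0..T} g" "g 0 = 0" "g T = 0"
     "\<And>\<tau> i. \<tau> \<in> {0..T} \<Longrightarrow> i < p \<Longrightarrow> snd (strand a i \<tau>) = h i * g \<tau>" "\<And>\<tau>. \<tau> \<in> {0..T} \<Longrightarrow> 0 \<le> g \<tau>"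
    using a unfolding level_def T_def by blast
  obtain g' where g': "\<exists>K. K-lipschitz_on {0..T} g'" "g' 0 = 0" "g' T = 0"
     "\<And>\<tau> i. \<tau> \<in> {0..T} \<Longrightarrow> i < p \<Longrightarrow> snd (strand b i \<tau>) = h i * g' \<tau>" "\<And>\<tau>. \<tau> \<in> {0..T} \<Longrightarrow> 0 \<le> g' \<tau>"
    using b unfolding level_def T_def same(1) by blast
  have 1: "lin p a (lifted a g)" using main[OF bra(1) _ g] by (simp add: T_def)
  have 2: "lin p b (lifted b g')" using main[OF bra(2) _ g'] by (simp add: T_def same)
  have "lin p (lifted a g) (lifted b g')"
    unfolding lin_def
  proof (intro conjI ballI allI impI)
    fix t \<tau> i j assume *: "t \<in> {0..1::real}" "\<tau> \<in> {0..dur (lifted a g)}" "i < p" "j < p" "i \<noteq> j"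
    have \<tau>: "\<tau> \<in> {0..T}" using * by (simp add: lifted_def)
    let ?P = "strand (lifted a g)" and ?Q = "strand (lifted b g')"
    show "(1 - t) *\<^sub>R ?P i \<tau> + t *\<^sub>R ?Q i \<tau> \<noteq> (1 - t) *\<^sub>R ?P j \<tau> + t *\<^sub>R ?Q j \<tau>"
    proof
      assume eq: "(1 - t) *\<^sub>R ?P i \<tau> + t *\<^sub>R ?Q i \<tau> = (1 - t) *\<^sub>R ?P j \<tau> + t *\<^sub>R ?Q j \<tau>"
      define G where "G = (1 - t) * g \<tau> + t * g' \<tau> + \<tau> * (T - \<tau>)"
      have "snd ((1 - t) *\<^sub>R ?P k \<tau> + t *\<^sub>R ?Q k \<tau>) = h k * G" for k
        by (simp add: lifted_def G_def algebra_simps)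
      then have "h i * G = h j * G" using eq by metis
      moreover have "h i \<noteq> h j" using inj * by (auto simp: inj_on_def)
      ultimately have "G = 0" by simp
      moreover have "0 \<le> (1 - t) * g \<tau>" "0 \<le> t * g' \<tau>" "0 \<le> \<tau> * (T - \<tau>)"
        using *(1) \<tau> g(5) g'(5) by auto
      ultimately have "\<tau> * (T - \<tau>) = 0" unfolding G_def by linarith
      \<comment> \<open>At the ends both tracks have the same prescribed radii, so a coincidence
        there would identify two positions.\<close>
      then have "\<tau> = 0 \<or> \<tau> = T" by auto
      moreover have "fst (strand a k 0) = real k + 1" "fst (strand b k 0) = real k + 1"
        "fst (strand a k T) = real (perm a k) + 1" "fst (strand b k T) = real (perm a k) + 1" if "k < p" for k
        using bra that same by (auto simp: braid_def T_def)
      moreover have "(1 - t) * fst (strand a i \<tau>) + t * fst (strand b i \<tau>) = (1 - t) * fst (strand a j \<tau>) + t * fst (strand b j \<tau>)"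
        using arg_cong[OF eq, of fst] by (simp add: lifted_def)
      ultimately have "real i = real j \<or> real (perm a i) = real (perm a j)"
        using * by (auto simp: algebra_simps)
      then show False using perm_neq[OF bra(1) *(5)] *(5) by simp
    qed
  qed (use 1 2 same in \<open>auto simp: lin_def lifted_def\<close>)
  then show ?thesis
    using 1 lin_sym[OF 2] by (meson converse_rtranclp_into_rtranclp r_into_rtranclp)
qed

text \<open>Both sides are level with the same factors, duration and permutation. Repeated splitting
  is how a letter becomes a word.\<close>

lemma sim_letter_split:
  assumes "\<pi> permutes {..<p}" "\<rho> permutes {..<p}" "inj_on h {..<p}" "d > 0" "e > 0"
  shows "sim p (letter (d + e) (\<rho> \<circ> \<pi>) h) (cat (letter d \<pi> h) (letter e \<rho> (h \<circ> inv \<pi>)))"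
proof (rule sim_level[where h = h])
  have "inj_on (h \<circ> inv \<pi>) {..<p}"
    using assms(1,3) permutes_inv[OF assms(1)]
    by (intro comp_inj_on) (auto simp: permutes_image permutes_inj_on)
  then show "level p h (cat (letter d \<pi> h) (letter e \<rho> (h \<circ> inv \<pi>)))"
    using assms by (intro level_cat) (auto intro!: level_letter good_inj)
qed (use assms in \<open>auto intro!: level_letter good_inj permutes_compose\<close>)

section \<open>Permutations generated by reversals of consecutive positions\<close>

abbreviation swap :: "'a \<Rightarrow> 'a \<Rightarrow> 'a \<Rightarrow> 'a" where
  "swap \<equiv> Transposition.transpose"

definition flip :: "nat \<Rightarrow> nat \<Rightarrow> nat \<Rightarrow> nat" where
  "flip n j x = (if j \<le> x \<and> x < j + n then 2 * j + n - 1 - x else x)"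

lemma flip_flip [simp]: "flip n j (flip n j x) = x"
  by (auto simp: flip_def)

lemma flip_comp_flip [simp]: "flip n j \<circ> flip n j = id"
  by (simp add: fun_eq_iff)

lemma permutes_flip: "j + n \<le> p \<Longrightarrow> flip n j permutes {..<p}"
  by (rule bij_imp_permutes[OF bij_betw_byWitness[where f' = "flip n j"]]) (auto simp: flip_def)

lemma permutation_flip: "permutation (flip n j)"
  using permutes_flip[of j n "j + n"] permutation_permutes by blast

text \<open>Peeling off the outermost pair leaves a transposition times a reversal of length
  \<open>n - 2\<close>, so a reversal is a product of \<open>n div 2\<close> transpositions.\<close>

lemma evenperm_flip: "evenperm (flip n j) \<longleftrightarrow> even (n div 2)"
proof (induction n arbitrary: j rule: nat_less_induct)
  case (1 n)
  show ?case
  proof (cases "n < 2")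
    case True
    then have "flip n j = id" by (auto simp: flip_def fun_eq_iff)
    then show ?thesis using True by simp
  next
    case False
    then obtain m where m: "n = m + 2" by (metis add.commute le_Suc_ex not_less)
    have "flip n j = swap j (j + m + 1) \<circ> flip m (j + 1)"
      unfolding m by (auto simp: flip_def fun_eq_iff Transposition.transpose_def)
    then have "evenperm (flip n j) \<longleftrightarrow> \<not> evenperm (flip m (j + 1))"
      by (simp add: evenperm_comp permutation_swap_id permutation_flip evenperm_swap)
    then show ?thesis using 1 m by simp
  qed
qed

primrec run :: "nat \<Rightarrow> nat list \<Rightarrow> nat \<Rightarrow> nat" where
  "run n [] = id"
| "run n (j # js) = run n js \<circ> flip n j"

lemma run_append: "run n (xs @ ys) = run n ys \<circ> run n xs"
  by (induction xs) (auto simp: fun_eq_iff)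

lemma run_rev: "run n (rev js) \<circ> run n js = id" "run n js \<circ> run n (rev js) = id"
proof -
  have *: "run n (rev js) (run n js x) = x" for js x
    by (induction js arbitrary: x) (auto simp: run_append)
  show "run n (rev js) \<circ> run n js = id" "run n js \<circ> run n (rev js) = id"
    using * *[of "rev js"] by (auto simp: fun_eq_iff)
qed

text \<open>The length is prescribed exactly because it will become a duration.\<close>

definition flip_words :: "nat \<Rightarrow> nat \<Rightarrow> nat \<Rightarrow> (nat \<Rightarrow> nat) set" where
  "flip_words n p l = {run n js | js. length js = l \<and> (\<forall>j\<in>set js. j + n \<le> p)}"

text \<open>\<open>2 * n\<close> positions contain two windows of length \<open>n\<close> sharing
  one point. With \<open>n\<close> even, a reversal changes the parity of every position in its
  window, which links even and odd positions.\<close>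

locale flips =
  fixes n p :: nat
  assumes n: "even n" "n \<ge> 2" and p: "p \<ge> 2 * n"
begin

text \<open>Products of evenly many reversals form a group that is normalized by every reversal,
  although a single reversal need not belong to it. Even lengths also allow padding to a common
  length later on.\<close>

definition E :: "(nat \<Rightarrow> nat) set" where
  "E = {run n js | js. even (length js) \<and> (\<forall>j\<in>set js. j + n \<le> p)}"

lemma id_E: "id \<in> E"
  unfolding E_def by (auto intro: exI[of _ "[]"])

lemma comp_E: assumes "f \<in> E" "g \<in> E" shows "f \<circ> g \<in> E"
proof -
  obtain xs ys where "f = run n xs" "even (length xs)" "\<forall>j\<in>set xs. j + n \<le> p"
     "g = run n ys" "even (length ys)" "\<forall>j\<in>set ys. j + n \<le> p"
    using assms unfolding E_def by auto
  then show ?thesis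
    unfolding E_def by (auto intro!: exI[of _ "ys @ xs"] simp: run_append)
qed

lemma inv_E: assumes "f \<in> E" "f \<circ> g = id" shows "g \<in> E"
proof -
  obtain xs where xs: "f = run n xs" "even (length xs)" "\<forall>j\<in>set xs. j + n \<le> p"
    using assms unfolding E_def by auto
  have "g = (run n (rev xs) \<circ> f) \<circ> g" using run_rev(1)[of n xs] xs by simp
  also have "\<dots> = run n (rev xs)" using assms(2) by (simp only: comp_assoc comp_id)
  finally show ?thesis
    unfolding E_def using xs by (auto intro!: exI[of _ "rev xs"])
qed

lemma conj_E: assumes "f \<in> E" "j + n \<le> p" shows "flip n j \<circ> f \<circ> flip n j \<in> E"
proof -
  obtain xs where "f = run n xs" "even (length xs)" "\<forall>j\<in>set xs. j + n \<le> p"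
    using assms unfolding E_def by auto
  then show ?thesis
    unfolding E_def using assms(2)
    by (auto intro!: exI[of _ "j # xs @ [j]"] simp: run_append comp_assoc)
qed

text \<open>An equivalence relation on transpositions, invariant under conjugation by reversals.  It has only one
  class (\<open>rel_all\<close>), so every product of two transpositions lies in \<open>E\<close>.\<close>
abbreviation rel :: "nat \<Rightarrow> nat \<Rightarrow> nat \<Rightarrow> nat \<Rightarrow> bool" where
  "rel a b c d \<equiv> swap a b \<circ> swap c d \<in> E"

lemma rel_sym: "rel a b c d \<Longrightarrow> rel c d a b"
  by (erule inv_E) (simp add: fun_eq_iff)

lemma rel_trans: "rel a b c d \<Longrightarrow> rel c d e f \<Longrightarrow> rel a b e f"
proof -
  assume "rel a b c d" "rel c d e f"
  from comp_E[OF this] have "swap a b \<circ> (swap c d \<circ> swap c d) \<circ> swap e f \<in> E"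
    by (simp only: comp_assoc)
  then show ?thesis by (simp only: transpose_comp_involutory comp_id)
qed

text \<open>The commutator of two permutations whose supports share exactly one point is a 3-cycle.\<close>
lemma rel_commutator:
  assumes "j + 2 * n \<le> Suc p"
  shows "rel j (j + n - 1) (j + n - 1) (j + 2 * n - 2)"
proof -
  obtain q where q: "n = Suc q" "q \<ge> 1" using n(2) by (cases n) auto
  let ?b = "j + q" and ?c = "j + 2 * q"
  have vals: "flip n j j = ?b" "flip n j ?b = j" "flip n j ?c = ?c" "flip n ?b j = j" "flip n ?b ?b = ?c" "flip n ?b ?c = ?b"
    using q by (auto simp: flip_def)
  have "(swap j ?b \<circ> swap ?b ?c) x = flip n ?b (flip n j (flip n ?b (flip n j x)))" for x
  proof -
    consider "x = j" | "x = ?b" | "x = ?c" | "j < x" "x < ?b" | "x < j \<or> ?b < x" "x \<noteq> ?c"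
      by linarith
    then show ?thesis
    proof cases
      case 4
      then have "flip n ?b (flip n j x) = flip n j x" using q by (auto simp: flip_def)
      moreover have "flip n ?b x = x" using 4 by (auto simp: flip_def)
      ultimately show ?thesis using 4 by (simp add: Transposition.transpose_def)
    next
      case 5
      then have "flip n j x = x" "flip n j (flip n ?b x) = flip n ?b x" using q by (auto simp: flip_def)
      then show ?thesis using 5 q by (auto simp: Transposition.transpose_def)
    qed (simp_all add: vals, use q in \<open>auto simp: Transposition.transpose_def\<close>)
  qed
  then have "swap j ?b \<circ> swap ?b ?c = run n [j, ?b, j, ?b]"
    by (auto simp: fun_eq_iff)
  moreover have "run n [j, ?b, j, ?b] \<in> E"
    unfolding E_def using assms q by (intro CollectI exI[of _ "[j, ?b, j, ?b]"]) auto
  moreover have "j + n - 1 = ?b" "j + 2 * n - 2 = ?c" using q by auto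
  ultimately show ?thesis by simp
qed

definition K :: "nat \<Rightarrow> nat \<Rightarrow> bool" where
  "K a b \<longleftrightarrow> rel a b 0 (n - 1)"

lemma K_commute: "K a b \<longleftrightarrow> K b a"
  by (simp add: K_def transpose_commute)

text \<open>Conjugation by \<open>swap a b\<close> carries \<open>swap b c\<close> to
  \<open>swap a c\<close>, so the equivalence of (a b) and (b c) extends to the third side of the
  triangle.\<close>

lemma K_trans:
  assumes "K a b" "K b c" "a \<noteq> b" "b \<noteq> c" "a \<noteq> c"
  shows "K a c"
proof -
  have "rel a b b c" using assms rel_sym rel_trans unfolding K_def by blast
  moreover have "swap a c \<circ> swap a b = swap a b \<circ> swap b c"
    using assms by (auto simp: fun_eq_iff Transposition.transpose_def)
  ultimately have "rel a c a b" by simp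
  then show ?thesis using assms rel_trans unfolding K_def by blast
qed

lemma K_base: "K 0 (n - 1)" "K (n - 1) (2 * n - 2)" "K 0 (2 * n - 2)"
proof -
  show 1: "K 0 (n - 1)" by (simp add: K_def id_E)
  show 2: "K (n - 1) (2 * n - 2)"
    using rel_sym[OF rel_commutator[of 0]] p unfolding K_def by simp
  show "K 0 (2 * n - 2)"
    by (rule K_trans[OF 1 2]) (use n in auto)
qed

lemma flip_transpose: "flip n j \<circ> swap a b \<circ> flip n j = swap (flip n j a) (flip n j b)"
proof
  fix x show "(flip n j \<circ> swap a b \<circ> flip n j) x = swap (flip n j a) (flip n j b) x"
    by (auto simp: Transposition.transpose_def)
qed

text \<open>For each window, one of the base transpositions on 0, \<open>n - 1\<close>,
  \<open>2 * n - 2\<close> is unchanged under conjugation by the reversal. Conjugating an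
  equivalence with that transposition keeps its right side and moves its left side.\<close>

lemma K_flip:
  assumes "K a b" and j: "j + n \<le> p"
  shows "K (flip n j a) (flip n j b)"
proof -
  have "\<exists>c d. K c d \<and> swap (flip n j c) (flip n j d) = swap c d"
  proof -
    consider "j = 0" | "0 < j" "j < n - 1" | "j = n - 1" | "n - 1 < j" by linarith
    then show ?thesis
    proof cases
      case 1
      then show ?thesis using K_base(1) n(2) 
        by (intro exI[of _ 0] exI[of _ "n - 1"]) (auto simp: flip_def transpose_commute)
    next
      case 2
      then show ?thesis using K_base(3)
        by (intro exI[of _ 0] exI[of _ "2 * n - 2"]) (auto simp: flip_def)
    next
      case 3
      have "flip n j (n - 1) = 2 * n - 2" "flip n j (2 * n - 2) = n - 1" using 3 n(2) by (auto simp: flip_def)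
      then show ?thesis using K_base(2)
        by (intro exI[of _ "n - 1"] exI[of _ "2 * n - 2"]) (auto simp: transpose_commute)
    next
      case 4
      then show ?thesis using K_base(1)
        by (intro exI[of _ 0] exI[of _ "n - 1"]) (auto simp: flip_def)
    qed
  qed
  then obtain c d where cd: "K c d" "swap (flip n j c) (flip n j d) = swap c d" by blast
  have "rel a b c d" using assms(1) cd(1) rel_sym rel_trans unfolding K_def by blast
  from conj_E[OF this j] have "(flip n j \<circ> swap a b \<circ> flip n j) \<circ> (flip n j \<circ> swap c d \<circ> flip n j) \<in> E"
    by (simp only: comp_assoc flip_comp_flip) (simp add: fun_eq_iff comp_def)
  then have "rel (flip n j a) (flip n j b) c d"
    by (simp only: flip_transpose cd(2))
  then show ?thesis using cd(1) rel_trans unfolding K_def by blast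
qed

text \<open>The set \<open>B\<close> contains 0 and is closed under reversals, so the task is to
  reach every position by reversals.\<close>

lemma K_zero:
  assumes "0 < x" "x < p"
  shows "K 0 x"
proof -
  define B where "B x \<longleftrightarrow> x = 0 \<or> K 0 x" for x
  have Bflip: "B (flip n j x)" if "B x" "j + n \<le> p" for j x
  proof (cases "x = 0")
    case True
    then show ?thesis using K_base(1) by (auto simp: B_def flip_def)
  next
    case False
    then have "K (flip n j 0) (flip n j x)" using that K_flip by (auto simp: B_def)
    then show ?thesis
    proof (cases "j = 0")
      case True
      then have q: "flip n j 0 = n - 1" using n by (simp add: flip_def)
      show ?thesis
        using \<open>K (flip n j 0) (flip n j x)\<close> K_base(1) K_trans[OF K_base(1), of "flip n j x"] n(2)
        unfolding q B_def by (cases "flip n j x = n - 1"; cases "flip n j x = 0") auto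
    qed (auto simp: flip_def B_def)
  qed
  \<comment> \<open>The window at \<open>j\<close> reverses \<open>n - 1\<close> to
    \<open>2 * j\<close>, which reaches the even positions.\<close>
  have ev: "B (2 * j)" if "j \<le> n - 1" for j
  proof (cases "j = 0")
    case False
    have "B (flip n j (n - 1))" using Bflip[of "n - 1" j] K_base(1) that p by (auto simp: B_def)
    moreover have "flip n j (n - 1) = 2 * j" using that False n by (auto simp: flip_def)
    ultimately show ?thesis by simp
  qed (simp add: B_def)
  \<comment> \<open>Odd positions below \<open>n\<close> are mirror images of even ones in the
    window at 0, since \<open>n - 1\<close> is odd.\<close>
  have low: "B x" if "x < n" for x
  proof (cases "even x")
    case True
    then obtain j where "x = 2 * j" by (elim evenE)
    then show ?thesis using ev[of j] that by auto
  next
    case False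
    then have "even (n - 1 - x)" using n that by auto
    then obtain j where "n - 1 - x = 2 * j" by (elim evenE)
    then have "B (n - 1 - x)" using ev[of j] by auto
    then have "B (flip n 0 (n - 1 - x))" using Bflip[of "n - 1 - x" 0] p by simp
    then show ?thesis using that by (simp add: flip_def)
  qed
  have "B x" if "x < p" for x
    using that
  proof (induction x rule: less_induct)
    case (less x)
    show ?case
    proof (cases "x < n")
      case False
      \<comment> \<open>A later position is the last one of a window whose first position is already
        in \<open>B\<close>.\<close>
      then have "B (flip n (x - (n - 1)) (x - (n - 1)))"
        using less n by (intro Bflip less.IH) auto
      moreover have "flip n (x - (n - 1)) (x - (n - 1)) = x" using False n by (auto simp: flip_def)
      ultimately show ?thesis by simp
    qed (rule low)
  qed
  then show ?thesis using assms by (auto simp: B_def)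
qed

lemma K_all: "a < p \<Longrightarrow> b < p \<Longrightarrow> a \<noteq> b \<Longrightarrow> K a b"
  using K_zero[of a] K_zero[of b] K_commute K_trans[of a 0 b] by (metis gr0I)

lemma rel_all: "a < p \<Longrightarrow> b < p \<Longrightarrow> a \<noteq> b \<Longrightarrow> c < p \<Longrightarrow> d < p \<Longrightarrow> c \<noteq> d \<Longrightarrow> rel a b c d"
  using K_all[of a b] K_all[of c d] rel_sym rel_trans unfolding K_def by blast

lemma even_in_E:
  assumes "\<pi> permutes {..<p}" "evenperm \<pi>"
  shows "\<pi> \<in> E"
proof -
  \<comment> \<open>The induction also needs a claim for odd \<pi>: any transposition completes it
    to an element of \<open>E\<close>. By \<open>rel_all\<close>, transpositions can then be
    consumed two at a time.\<close>
  have "(evenperm \<pi> \<longrightarrow> \<pi> \<in> E) \<and> (\<not> evenperm \<pi> \<longrightarrow> (\<forall>c d. c < p \<and> d < p \<and> c \<noteq> d \<longrightarrow> swap c d \<circ> \<pi> \<in> E))"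
    using assms(1) finite_lessThan
  proof (induction \<pi> rule: permutes_induct)
    case id
    then show ?case using id_E evenperm_id by blast
  next
    case (swap a b \<pi>)
    show ?case
    proof (cases "a = b")
      case True
      then show ?thesis using swap by simp
    next
      case False
      have ab: "a < p" "b < p" using swap by auto
      have ev: "evenperm (swap a b \<circ> \<pi>) \<longleftrightarrow> \<not> evenperm \<pi>"
        using False swap permutation_permutes finite_lessThan
        by (subst evenperm_comp) (auto simp: permutation_swap_id evenperm_swap)
      show ?thesis
      proof (cases "evenperm \<pi>")
        case True
        then have "\<pi> \<in> E" using swap by blast
        then have "swap c d \<circ> swap a b \<circ> \<pi> \<in> E" if "c < p" "d < p" "c \<noteq> d" for c d
          using rel_all[of c d a b] that ab False comp_E by blast
        then show ?thesis using ev True unfolding comp_assoc by blast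
      next
        case odd: False
        then show ?thesis using swap ev ab False by blast
      qed
    qed
  qed
  then show ?thesis using assms(2) by blast
qed

text \<open>There are finitely many even permutations, so one bound serves them all; longer words
  arise by inserting the cancelling pair 0, 0.\<close>

lemma flip_words_even:
  obtains l0 where "\<And>l \<pi>. even l \<Longrightarrow> l \<ge> l0 \<Longrightarrow> \<pi> permutes {..<p} \<Longrightarrow> evenperm \<pi> \<Longrightarrow> \<pi> \<in> flip_words n p l"
proof -
  let ?S = "{\<pi>. \<pi> permutes {..<p} \<and> evenperm \<pi>}"
  have "\<exists>l. even l \<and> \<pi> \<in> flip_words n p l" if "\<pi> \<in> ?S" for \<pi>
  proof -
    have "\<pi> \<in> E" using even_in_E that by blast
    then obtain js where "\<pi> = run n js" "even (length js)" "\<forall>j\<in>set js. j + n \<le> p"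
      unfolding E_def by blast
    then show ?thesis unfolding flip_words_def by (intro exI[of _ "length js"]) auto
  qed
  then obtain len where len: "\<And>\<pi>. \<pi> \<in> ?S \<Longrightarrow> even (len \<pi>) \<and> \<pi> \<in> flip_words n p (len \<pi>)" by metis
  have fin: "finite ?S" by (rule finite_subset[OF _ finite_permutations[of "{..<p}"]]) auto
  have pad: "\<pi> \<in> flip_words n p (l + 2 * k)" if "\<pi> \<in> flip_words n p l" for \<pi> l k
  proof (induction k)
    case (Suc k)
    then obtain js where js: "\<pi> = run n js" "length js = l + 2 * k" "\<forall>j\<in>set js. j + n \<le> p"
      unfolding flip_words_def by blast
    then have "\<pi> = run n (0 # 0 # js)" by (simp add: comp_assoc)
    then show ?case unfolding flip_words_def using js p by (intro CollectI exI[of _ "0 # 0 # js"]) auto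
  qed (use that in simp)
  show ?thesis
  proof (rule that[of "Max (insert 0 (len ` ?S))"])
    fix l \<pi> assume l: "even l" "l \<ge> Max (insert 0 (len ` ?S))" and \<pi>: "\<pi> permutes {..<p}" "evenperm \<pi>"
    have "len \<pi> \<le> l" using l(2) \<pi> fin by auto
    moreover have "even (len \<pi>)" "\<pi> \<in> flip_words n p (len \<pi>)" using len \<pi> by auto
    ultimately obtain k where "l = len \<pi> + 2 * k" using l(1) by (metis le_Suc_ex dvd_def even_add)
    then show "\<pi> \<in> flip_words n p l" using pad \<open>\<pi> \<in> flip_words n p (len \<pi>)\<close> by blast
  qed
qed

end

section \<open>Words of crossings\<close>

definition unit_track :: track where
  "unit_track = Track 0 (\<lambda>i \<tau>. (real i + 1, 0)) id"

definition cats :: "track list \<Rightarrow> track" where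
  "cats ws = foldr cat ws unit_track"

lemma cats_simps [simp]: "cats [] = unit_track" "cats (a # ws) = cat a (cats ws)"
  by (simp_all add: cats_def)

lemma unit_track_simps [simp]: "dur unit_track = 0" "perm unit_track = id" "strand unit_track i \<tau> = (real i + 1, 0)"
  by (simp_all add: unit_track_def)

lemma braid_unit: "braid p unit_track"
proof -
  have "\<exists>K. K-lipschitz_on {0..0} (strand unit_track i)" for i
    by (auto intro!: exI[of _ 0])
  then show ?thesis by (simp add: braid_def permutes_id)
qed

lemma braid_cats: "(\<And>a. a \<in> set ws \<Longrightarrow> braid p a) \<Longrightarrow> braid p (cats ws)"
  by (induction ws) (auto intro: braid_unit braid_cat)

lemma dur_cats: "dur (cats ws) = sum_list (map dur ws)"
  by (induction ws) auto

lemma lin_unit_left: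
  assumes "braid p a"
  shows "lin p (cat unit_track a) a"
proof (rule lin_sym, rule lin_refl[OF assms])
  fix i \<tau> assume "i < p" "\<tau> \<in> {0..dur a}"
  then show "strand (cat unit_track a) i \<tau> = strand a i \<tau>"
    using assms by (cases "\<tau> = 0") (auto simp: strand_cat braid_def)
qed simp_all

lemma lin_unit_right: "braid p a \<Longrightarrow> lin p (cat a unit_track) a"
  by (rule lin_sym, rule lin_refl) (auto simp: strand_cat)

lemma sim_cats_append:
  assumes "\<And>a. a \<in> set xs \<Longrightarrow> braid p a" "\<And>a. a \<in> set ys \<Longrightarrow> braid p a"
  shows "sim p (cat (cats xs) (cats ys)) (cats (xs @ ys))"
  using assms
proof (induction xs)
  case Nil
  then show ?case using lin_unit_left braid_cats[of ys] by auto
next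
  case (Cons a xs)
  have "sim p (cat a (cat (cats xs) (cats ys))) (cat a (cats (xs @ ys)))"
    using Cons braid_cats[of xs] braid_cats[of ys] by (intro sim_cat) (auto intro: braid_cat)
  moreover have "0 \<le> dur (cats xs)" using braid_cats[of xs p] Cons by (simp add: braid_def)
  ultimately show ?case by (simp add: cat_assoc)
qed

section \<open>Crossings as letters, and closures as unions of arcs\<close>

definition height :: "crossing \<Rightarrow> nat \<Rightarrow> real" where
  "height c x = (case c of (j, lev) \<Rightarrow>
     if j \<le> x \<and> x < j + length lev then real (length lev + 1 - lev ! (x - j)) else 0)"

definition cross_track :: "real \<Rightarrow> crossing \<Rightarrow> track" where
  "cross_track d c = letter d (cross_target c) (height c)"

lemma cross_target_flip: "cross_target (j, lev) = flip (length lev) j"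
  by (auto simp: cross_target_def flip_def fun_eq_iff)

lemma flip_inverted: "i < k \<Longrightarrow> flip n j k < flip n j i \<Longrightarrow> j \<le> i \<and> k < j + n"
  by (auto simp: flip_def split: if_splits)

lemma good_crossing:
  assumes "ncrossing n p c"
  shows "good p (cross_target c) (height c)"
proof -
  obtain j lev where c: "c = (j, lev)" by (cases c)
  have lev: "length lev = n" "distinct lev" "set lev = {1..n}" "j + n \<le> p"
    using assms by (auto simp: c ncrossing_def)
  have "height c i \<noteq> height c k" if "i < k" "flip n j k < flip n j i" for i k
  proof -
    have w: "j \<le> i" "k < j + n" using flip_inverted[OF that] by auto
    then have "lev ! (i - j) \<noteq> lev ! (k - j)"
      using lev that(1) by (auto simp: nth_eq_iff_index_eq)
    moreover have "lev ! (i - j) \<in> {1..n}" "lev ! (k - j) \<in> {1..n}"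
      using w that(1) lev nth_mem[of "i - j" lev] nth_mem[of "k - j" lev] by auto
    ultimately show ?thesis using w that(1) lev by (auto simp: height_def c)
  qed
  then show ?thesis
    using lev permutes_flip[of j n p] by (auto simp: good_def c cross_target_flip)
qed

lemma braid_cross_track: "ncrossing n p c \<Longrightarrow> d > 0 \<Longrightarrow> braid p (cross_track d c)"
  unfolding cross_track_def by (intro braid_letter good_crossing)

lemma dur_cross_track [simp]: "dur (cross_track d c) = d"
  by (simp add: cross_track_def)

text \<open>The part of a closure of total duration \<open>T\<close> that is swept while
  \<open>a\<close> runs, starting at time \<open>t\<close>.\<close>

definition arcs :: "nat \<Rightarrow> real \<Rightarrow> real \<Rightarrow> track \<Rightarrow> R3 set" where
  "arcs p T t a = (\<lambda>(i, \<tau>). cyl (2 * pi * (t + \<tau>) / T) (strand a i \<tau>)) ` ({..<p} \<times> {0..dur a})"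

lemma closure_arcs: "closure_of_track p a = arcs p (dur a) 0 a"
  by (simp add: closure_of_track_def track_closure_def arcs_def)

text \<open>\<open>perm a\<close> is a bijection, so each string of \<open>b\<close> continues
  exactly one string of \<open>a\<close>, and the point at the joint belongs to both arcs. Only the
  ends have to match, which also covers tracks whose joints are not at height 0.\<close>

lemma arcs_join:
  assumes a: "perm a permutes {..<p}" "0 \<le> dur a" "0 \<le> dur b"
    and join: "\<And>i. i < p \<Longrightarrow> strand a i (dur a) = strand b (perm a i) 0"
  shows "arcs p T t (cat a b) = arcs p T t a \<union> arcs p T (t + dur a) b"
proof (intro equalityI subsetI)
  fix y assume "y \<in> arcs p T t (cat a b)"
  then obtain i \<tau> where i: "i < p" "\<tau> \<in> {0..dur a + dur b}" "y = cyl (2 * pi * (t + \<tau>) / T) (strand (cat a b) i \<tau>)"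
    by (auto simp: arcs_def)
  show "y \<in> arcs p T t a \<union> arcs p T (t + dur a) b"
  proof (cases "\<tau> \<le> dur a")
    case True
    then have "y \<in> arcs p T t a"
      unfolding arcs_def using i by (intro image_eqI[of _ _ "(i, \<tau>)"]) (auto simp: strand_cat)
    then show ?thesis ..
  next
    case False
    then have "y \<in> arcs p T (t + dur a) b"
      unfolding arcs_def using i permutes_in_image[OF a(1), of i]
      by (intro image_eqI[of _ _ "(perm a i, \<tau> - dur a)"]) (auto simp: strand_cat)
    then show ?thesis ..
  qed
next
  fix y assume "y \<in> arcs p T t a \<union> arcs p T (t + dur a) b"
  then show "y \<in> arcs p T t (cat a b)"
  proof
    assume "y \<in> arcs p T t a"
    then obtain i \<tau> where "i < p" "\<tau> \<in> {0..dur a}" "y = cyl (2 * pi * (t + \<tau>) / T) (strand a i \<tau>)"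
      by (auto simp: arcs_def)
    then show ?thesis
      unfolding arcs_def using a(3)
      by (intro image_eqI[of _ _ "(i, \<tau>)"]) (auto simp: strand_cat)
  next
    assume "y \<in> arcs p T (t + dur a) b"
    then obtain k \<tau> where k: "k < p" "\<tau> \<in> {0..dur b}" "y = cyl (2 * pi * (t + dur a + \<tau>) / T) (strand b k \<tau>)"
      by (auto simp: arcs_def)
    have "perm a ` {..<p} = {..<p}" using a(1) by (rule permutes_image)
    then obtain i where i: "i < p" "perm a i = k" using k(1) by (metis imageE lessThan_iff)
    have "strand (cat a b) i (dur a + \<tau>) = strand b k \<tau>"
      using k i join by (cases "\<tau> = 0") (auto simp: strand_cat)
    then show ?thesis
      unfolding arcs_def using k i a(2)
      by (intro image_eqI[of _ _ "(i, dur a + \<tau>)"]) (auto simp: add.assoc)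
  qed
qed

lemma arcs_cat:
  assumes "braid p a" "braid p b"
  shows "arcs p T t (cat a b) = arcs p T t a \<union> arcs p T (t + dur a) b"
  by (rule arcs_join) (use assms perm_lt[OF assms(1)] in \<open>auto simp: braid_def\<close>)

lemma arcs_cats:
  assumes "\<And>a. a \<in> set ws \<Longrightarrow> braid p a \<and> dur a = d"
  shows "arcs p T t (cats ws) = (\<Union>k<length ws. arcs p T (t + real k * d) (ws ! k)) \<union> arcs p T (t + real (length ws) * d) unit_track"
  using assms
proof (induction ws arbitrary: t)
  case (Cons a ws)
  have "arcs p T t (cats (a # ws)) = arcs p T t a \<union> arcs p T (t + d) (cats ws)"
    using arcs_cat[of p a "cats ws"] braid_cats[of ws p] Cons.prems by auto
  also have "arcs p T (t + d) (cats ws) = (\<Union>k<length ws. arcs p T (t + d + real k * d) (ws ! k)) \<union> arcs p T (t + d + real (length ws) * d) unit_track"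
    using Cons by auto
  finally show ?case
    by (simp add: lessThan_Suc_eq_insert_0 image_image algebra_simps Un_assoc)
qed simp

text \<open>The duration \<open>d\<close> of a crossing cancels in the angle: time
  \<open>(k + s) * d\<close> out of \<open>N * d\<close> is the angle
  \<open>2 * pi * (k + s) / N\<close> of the given closure.\<close>

lemma braid_closure_track:
  assumes w: "w \<noteq> []" "nbraid n p w" and d: "d > 0"
  shows "braid_closure p w = closure_of_track p (cats (map (cross_track d) w))"
proof -
  let ?N = "length w" and ?ws = "map (cross_track d) w"
  let ?T = "real ?N * d"
  have cr: "ncrossing n p c" if "c \<in> set w" for c using w that by (simp add: nbraid_def)
  have br: "braid p a \<and> dur a = d" if "a \<in> set ?ws" for a
  proof -
    have "a \<in> cross_track d ` set w" using that by simp
    then obtain c where "c \<in> set w" "a = cross_track d c" by (rule imageE)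
    then show ?thesis using braid_cross_track[OF cr d] by simp
  qed
  have T: "dur (cats ?ws) = ?T" by (simp add: dur_cats comp_def sum_list_triv)
  have sector: "arcs p ?T (real k * d) (?ws ! k) = (\<Union>q<p. braid_point w k q ` {0..1})" if k: "k < ?N" for k
  proof -
    have pt: "braid_point w k q s = cyl (2 * pi * (real k * d + s * d) / ?T) (strand (?ws ! k) q (s * d))" for q s
    proof -
      have "2 * pi * (real k * d + s * d) / ?T = 2 * pi * (real k + s) / real ?N"
      proof -
        have "2 * pi * (real k * d + s * d) / ?T = (2 * pi * (real k + s) * d) / (real ?N * d)"
          by (simp add: algebra_simps)
        then show ?thesis using d by simp
      qed
      moreover have "strand (?ws ! k) q (s * d) = (piece_x (w ! k) q s + 1, piece_z (w ! k) q s)"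
        using d k by (cases "w ! k") (simp add: cross_track_def strand_letter piece_x_def piece_z_def height_def tent_def)
      ultimately show ?thesis by (simp add: braid_point_def cyl_def Let_def)
    qed
    have "{0..dur (?ws ! k)} = (\<lambda>s. s * d) ` {0..1}"
    proof (intro equalityI subsetI)
      fix \<tau> assume "\<tau> \<in> {0..dur (?ws ! k)}"
      then show "\<tau> \<in> (\<lambda>s. s * d) ` {0..1}" using d k by (intro image_eqI[of _ _ "\<tau> / d"]) auto
    qed (use d k in \<open>auto simp: mult_left_le_one_le\<close>)
    then show ?thesis unfolding arcs_def pt by force
  qed
  \<comment> \<open>The empty tail of \<open>cats\<close> contributes only end points of the last
    crossing.\<close>
  have "arcs p ?T (0 + real ?N * d) unit_track \<subseteq> arcs p ?T (real (?N - 1) * d) (?ws ! (?N - 1))"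
  proof
    fix y assume "y \<in> arcs p ?T (0 + real ?N * d) unit_track"
    then obtain i where i: "i < p" "y = cyl (2 * pi * (real ?N * d) / ?T) (real i + 1, 0)"
      by (auto simp: arcs_def)
    let ?a = "?ws ! (?N - 1)"
    have "?a \<in> set ?ws" using w by simp
    then have a: "braid p ?a" "dur ?a = d" using br by auto
    have "perm ?a ` {..<p} = {..<p}" using a permutes_image by (auto simp: braid_def)
    then obtain k where k: "k < p" "perm ?a k = i" using i by (metis imageE lessThan_iff)
    have "real ?N * d = real (?N - 1) * d + d" using w by (cases w) (auto simp: algebra_simps)
    moreover have "strand ?a k d = (real i + 1, 0)" using a k by (auto simp: braid_def)
    ultimately show "y \<in> arcs p ?T (real (?N - 1) * d) ?a"
      unfolding arcs_def using k i d a by (intro image_eqI[of _ _ "(k, d)"]) auto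
  qed
  moreover have "arcs p ?T (real (?N - 1) * d) (?ws ! (?N - 1)) \<subseteq> (\<Union>k<?N. arcs p ?T (0 + real k * d) (?ws ! k))"
    using w by fastforce
  moreover have "arcs p ?T 0 (cats ?ws) = (\<Union>k<?N. arcs p ?T (0 + real k * d) (?ws ! k)) \<union> arcs p ?T (0 + real ?N * d) unit_track"
    using arcs_cats[of ?ws p d ?T 0] br by simp
  ultimately have "closure_of_track p (cats ?ws) = (\<Union>k<?N. arcs p ?T (real k * d) (?ws ! k))"
    unfolding closure_arcs T by auto
  then show ?thesis using w(1) sector by (simp add: braid_closure_def)
qed

section \<open>Tracks realized by words of n-crossings of equal duration\<close>

definition word_track :: "nat \<Rightarrow> nat \<Rightarrow> real \<Rightarrow> track \<Rightarrow> bool" where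
  "word_track n p d a \<longleftrightarrow> (\<exists>w. nbraid n p w \<and> sim p a (cats (map (cross_track d) w)))"

lemma word_track_sim: "sim p a b \<Longrightarrow> word_track n p d b \<Longrightarrow> word_track n p d a"
  unfolding word_track_def by (meson rtranclp_trans)

lemma word_track_cat:
  assumes "word_track n p d a" "word_track n p d b" "braid p a" "braid p b" "d > 0"
  shows "word_track n p d (cat a b)"
proof -
  obtain x y where x: "nbraid n p x" "sim p a (cats (map (cross_track d) x))"
    and y: "nbraid n p y" "sim p b (cats (map (cross_track d) y))"
    using assms by (auto simp: word_track_def)
  have "sim p (cat a b) (cat (cats (map (cross_track d) x)) (cats (map (cross_track d) y)))"
    by (rule sim_cat[OF x(2) y(2) assms(3,4)])
  also have "sim p (cat (cats (map (cross_track d) x)) (cats (map (cross_track d) y)))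
      (cats (map (cross_track d) x @ map (cross_track d) y))"
    using x(1) y(1) assms(5) by (intro sim_cats_append) (auto simp: nbraid_def intro: braid_cross_track)
  finally have "sim p (cat a b) (cats (map (cross_track d) (x @ y)))" by simp
  moreover have "nbraid n p (x @ y)" using x y by (auto simp: nbraid_def)
  ultimately show ?thesis unfolding word_track_def by blast
qed

lemma word_track_cats:
  assumes "\<And>a. a \<in> set ws \<Longrightarrow> word_track n p d a \<and> braid p a" "d > 0"
  shows "word_track n p d (cats ws)"
  using assms(1)
proof (induction ws)
  case Nil
  show ?case unfolding word_track_def by (auto intro: exI[of _ "[]"] simp: nbraid_def)
next
  case (Cons a ws)
  then show ?case using assms(2) braid_cats[of ws p] by (auto intro!: word_track_cat)
qed

text \<open>A reversal inverts exactly the pairs inside its window, so only the order of heights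
  there counts, and ranking them gives levels. \<open>r\<close> counts the strings of the window
  that are at least as high, so the top one gets level 1.\<close>

lemma word_track_flip:
  assumes h: "inj_on h {..<p}" and j: "j + n \<le> p" and d: "d > 0"
  shows "word_track n p d (letter d (flip n j) h)"
proof -
  define r where "r i = card {k. k < n \<and> h (j + i) \<le> h (j + k)}" for i
  define lev where "lev = map r [0..<n]"
  have mono: "r k < r i" if ik: "i < n" "k < n" "h (j + i) < h (j + k)" for i k
  proof -
    let ?A = "\<lambda>i. {m. m < n \<and> h (j + i) \<le> h (j + m)}"
    have "?A k \<subseteq> ?A i" using ik(3) by auto
    moreover have "i \<in> ?A i" "i \<notin> ?A k" using ik by auto
    ultimately have "?A k \<subset> ?A i" by blast
    then show ?thesis unfolding r_def by (intro psubset_card_mono) auto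
  qed
  have hne: "h (j + i) \<noteq> h (j + k)" if "i < n" "k < n" "i \<noteq> k" for i k
    using inj_onD[OF h, of "j + i" "j + k"] that j by auto
  have inj: "inj_on r {..<n}"
  proof (rule inj_onI, rule ccontr)
    fix i k assume "i \<in> {..<n}" "k \<in> {..<n}" "r i = r k" "i \<noteq> k"
    then show False
      using mono[of i k] mono[of k i] hne[of i k] by (metis lessThan_iff linorder_neqE order_less_irrefl)
  qed
  have r_range: "r i \<in> {1..n}" if "i < n" for i
  proof -
    have "{k. k < n \<and> h (j + i) \<le> h (j + k)} \<subseteq> {..<n}" by auto
    then have "r i \<le> n" unfolding r_def using card_mono[of "{..<n}"] by simp
    moreover have "i \<in> {k. k < n \<and> h (j + i) \<le> h (j + k)}" using that by auto
    then have "r i \<noteq> 0" unfolding r_def by (subst card_0_eq) auto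
    ultimately show ?thesis by simp
  qed
  then have "r ` {..<n} = {1..n}"
    using inj by (intro card_subset_eq) (auto simp: card_image)
  then have c: "ncrossing n p (j, lev)"
    using inj j by (auto simp: ncrossing_def lev_def distinct_map lessThan_atLeast0)
  have hh: "height (j, lev) x = real (n + 1 - r (x - j))" if "j \<le> x" "x < j + n" for x
    using that by (simp add: height_def lev_def)
  have "lin p (letter d (flip n j) h) (letter d (flip n j) (height (j, lev)))"
  proof (rule lin_letter_heights)
    show "good p (flip n j) h" using h j by (intro good_inj permutes_flip)
    show "good p (flip n j) (height (j, lev))" using good_crossing[OF c] by (simp add: cross_target_flip lev_def)
    fix i k assume ik: "i < k" "k < p" "flip n j k < flip n j i"
    then have w: "j \<le> i" "k < j + n" using flip_inverted by blast+
    obtain x y where xy: "i = j + x" "k = j + y" "x < n" "y < n" "x \<noteq> y"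
      using w ik(1) by (metis add_left_cancel le_add_diff_inverse less_imp_le nat_add_left_cancel_less order_le_less_trans order_less_irrefl order_trans)
    have "h i < h k \<longleftrightarrow> r y < r x"
      using mono[of x y] mono[of y x] hne[of x y] xy by (metis linorder_neqE order_less_asym)
    also have "\<dots> \<longleftrightarrow> n + 1 - r x < n + 1 - r y"
      using r_range[OF xy(3)] r_range[OF xy(4)] by auto
    finally show "h i < h k \<longleftrightarrow> height (j, lev) i < height (j, lev) k"
      using hh[of i] hh[of k] xy by simp
  qed (rule d)
  then have "sim p (letter d (flip n j) h) (cross_track d (j, lev))"
    by (simp add: cross_track_def cross_target_flip lev_def r_into_rtranclp)
  also have "lin p (cross_track d (j, lev)) (cats (map (cross_track d) [(j, lev)]))"
    using lin_sym[OF lin_unit_right] braid_cross_track[OF c d] by simp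
  finally have "sim p (letter d (flip n j) h) (cats (map (cross_track d) [(j, lev)]))" .
  moreover have "nbraid n p [(j, lev)]" using c by (simp add: nbraid_def)
  ultimately show ?thesis
    unfolding word_track_def by blast
qed

lemma inj_comp_inv:
  assumes "\<pi> permutes {..<p}" "inj_on h {..<p}"
  shows "inj_on (h \<circ> inv \<pi>) {..<p}"
  using assms permutes_inv[OF assms(1)]
  by (intro comp_inj_on) (auto simp: permutes_image permutes_inj_on)

lemma permutes_run: "\<forall>j\<in>set js. j + n \<le> p \<Longrightarrow> run n js permutes {..<p}"
  by (induction js) (auto simp: permutes_id intro!: permutes_compose permutes_flip)

text \<open>The first reversal is split off with duration \<open>d\<close>; the rest continues with
  the heights transported to the new positions.\<close>

lemma word_track_run:
  assumes "js \<noteq> []" "\<forall>j\<in>set js. j + n \<le> p" "inj_on h {..<p}" "d > 0"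
  shows "word_track n p d (letter (real (length js) * d) (run n js) h)"
  using assms
proof (induction js arbitrary: h rule: list_nonempty_induct)
  case (single j)
  then show ?case using word_track_flip by simp
next
  case (cons j js)
  let ?h = "h \<circ> inv (flip n j)" and ?e = "real (length js) * d"
  have f: "flip n j permutes {..<p}" "run n js permutes {..<p}"
    using cons permutes_flip permutes_run by auto
  have h: "inj_on ?h {..<p}" using inj_comp_inv[OF f(1)] cons by blast
  have e: "?e > 0" using cons by simp
  have W: "word_track n p d (cat (letter d (flip n j) h) (letter ?e (run n js) ?h))"
    using cons h word_track_flip e f
    by (intro word_track_cat) (auto intro!: braid_letter good_inj)
  have "sim p (letter (d + ?e) (run n js \<circ> flip n j) h) (cat (letter d (flip n j) h) (letter ?e (run n js) ?h))"
    using cons f e by (intro sim_letter_split) auto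
  moreover have "d + ?e = real (length (j # js)) * d" by (simp add: algebra_simps)
  ultimately have "sim p (letter (real (length (j # js)) * d) (run n (j # js)) h)
      (cat (letter d (flip n j) h) (letter ?e (run n js) ?h))"
    by (simp only: run.simps)
  then show ?case using W by (rule word_track_sim)
qed

lemma word_track_flip_words:
  assumes "\<pi> \<in> flip_words n p l" "l > 0" "inj_on h {..<p}" "d > 0"
  shows "word_track n p d (letter (real l * d) \<pi> h)"
proof -
  obtain js where "\<pi> = run n js" "length js = l" "\<forall>j\<in>set js. j + n \<le> p"
    using assms(1) by (auto simp: flip_words_def)
  then show ?thesis using word_track_run[of js n p h d] assms by auto
qed

definition letters :: "((nat \<Rightarrow> nat) \<times> (nat \<Rightarrow> real)) list \<Rightarrow> track" where
  "letters ws = cats (map (\<lambda>(\<pi>, h). letter 1 \<pi> h) ws)"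

lemma braid_letters:
  assumes "\<And>\<pi> h. (\<pi>, h) \<in> set ws \<Longrightarrow> \<pi> permutes {..<p} \<and> inj_on h {..<p}"
  shows "braid p (letters ws)"
proof -
  have "braid p (letter 1 \<pi> h)" if "(\<pi>, h) \<in> set ws" for \<pi> h
    using assms[OF that] by (auto intro!: braid_letter good_inj)
  then show ?thesis unfolding letters_def by (intro braid_cats) auto
qed

text \<open>For words of permutations this is the sign of the whole product, read off letter by
  letter.\<close>

definition oddness :: "((nat \<Rightarrow> nat) \<times> (nat \<Rightarrow> real)) list \<Rightarrow> bool" where
  "oddness ws \<longleftrightarrow> odd (length (filter (\<lambda>(\<pi>, h). \<not> evenperm \<pi>) ws))"

lemma sim_letter_split':
  assumes "\<pi> permutes {..<p}" "\<rho> permutes {..<p}" "inj_on h {..<p}" "d > 0" "e > 0" "c = d + e" "\<sigma> = \<rho> \<circ> \<pi>"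
  shows "\<exists>h'. inj_on h' {..<p} \<and> sim p (letter c \<sigma> h) (cat (letter d \<pi> h) (letter e \<rho> h'))"
  using sim_letter_split[OF assms(1-5)] inj_comp_inv[OF assms(1,3)] assms(6,7) by blast

text \<open>Consecutive odd letters cannot be treated separately when all \<open>n\<close>-crossings are even.  An adjacent
  transposition \<open>(0 1)\<close> is split off at the end of a letter and \<open>(2 3)\<close> at the beginning of the next one;
  as these are disjoint, both can be performed at the same heights, giving an even letter.\<close>
lemma letters_normal_form:
  assumes even: "\<And>k \<pi> h. k > 0 \<Longrightarrow> \<pi> permutes {..<p} \<Longrightarrow> evenperm \<pi> \<Longrightarrow> inj_on h {..<p} \<Longrightarrow>
      word_track n p d (letter (real k / 4) \<pi> h)"
    and p: "p \<ge> 4" and d: "d > 0"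
    and ws: "ws \<noteq> []" "\<And>\<pi> h. (\<pi>, h) \<in> set ws \<Longrightarrow> \<pi> permutes {..<p} \<and> inj_on h {..<p}"
  shows "\<exists>x h. word_track n p d x \<and> braid p x \<and> inj_on h {..<p} \<and>
     sim p (letters ws) (cat x (letter (1/4) (if oddness ws then swap 0 1 else id) h))"
  using ws
proof (induction ws rule: rev_nonempty_induct)
  define S where "S e = (if e then swap 0 1 else id :: nat \<Rightarrow> nat)" for e
  define S' where "S' e = (if e then swap 2 3 else id :: nat \<Rightarrow> nat)" for e
  have S: "S e permutes {..<p}" "S' e permutes {..<p}" for e
    using p by (auto simp: S_def S'_def permutes_id intro!: permutes_swap_id)
  have SS: "S e \<circ> S e = id" "S' e \<circ> S' e = id" for e by (auto simp: S_def S'_def)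
  have perm: "permutation \<pi>" if "\<pi> permutes {..<p}" for \<pi> using that permutation_permutes by blast
  have evS: "evenperm (S e) \<longleftrightarrow> \<not> e" "evenperm (S' e) \<longleftrightarrow> \<not> e" for e
    by (auto simp: S_def S'_def evenperm_swap)
  have sing: "sim p (letters [(\<pi>, h)]) (letter 1 \<pi> h)" if "\<pi> permutes {..<p}" "inj_on h {..<p}" for \<pi> h
    unfolding letters_def using that by (auto intro!: r_into_rtranclp lin_unit_right braid_letter good_inj)
  {
    case (single c)
    obtain \<pi> h where c: "c = (\<pi>, h)" by (cases c)
    have \<pi>: "\<pi> permutes {..<p}" and h: "inj_on h {..<p}" using single c by auto
    define e where "e = oddness [c]"
    have e: "e \<longleftrightarrow> \<not> evenperm \<pi>" by (simp add: e_def oddness_def c)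
    let ?\<rho> = "S e \<circ> \<pi>"
    have \<rho>: "?\<rho> permutes {..<p}" using \<pi> S by (intro permutes_compose)
    have "\<pi> = S e \<circ> ?\<rho>" by (simp only: comp_assoc[symmetric] SS id_comp)
    then obtain h' where h': "inj_on h' {..<p}" "sim p (letter 1 \<pi> h) (cat (letter (3/4) ?\<rho> h) (letter (1/4) (S e) h'))"
      using sim_letter_split'[OF \<rho> S(1) h, of "3/4" "1/4" 1 \<pi> e] by auto
    have "evenperm ?\<rho>" using e evS perm[OF \<pi>] perm[OF S(1)] by (simp add: evenperm_comp)
    then have "word_track n p d (letter (3/4) ?\<rho> h)" using even[of 3 ?\<rho> h] \<rho> h by simp
    moreover have "braid p (letter (3/4) ?\<rho> h)" using \<rho> h by (intro braid_letter good_inj) auto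
    moreover have "sim p (letters [c]) (cat (letter (3/4) ?\<rho> h) (letter (1/4) (S e) h'))"
      using sing[OF \<pi> h] h'(2) c by simp
    ultimately show ?case using h'(1) unfolding S_def e_def by blast
  next
    case (snoc c ws)
    obtain \<pi> h where c: "c = (\<pi>, h)" by (cases c)
    have \<pi>: "\<pi> permutes {..<p}" and h: "inj_on h {..<p}" using snoc c by auto
    define e e' where "e = oddness ws" and "e' = oddness (ws @ [c])"
    have e': "e' \<longleftrightarrow> (e \<longleftrightarrow> evenperm \<pi>)" by (auto simp: e_def e'_def oddness_def c)
    obtain x h0 where x: "word_track n p d x" "braid p x" "inj_on h0 {..<p}"
        "sim p (letters ws) (cat x (letter (1/4) (S e) h0))"
      using snoc unfolding S_def e_def by auto
    \<comment> \<open>\<open>e\<close> is the parity left over by \<open>ws\<close>, compensated by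
      splitting \<open>S' e\<close> off the front of \<open>\<pi>\<close>; \<open>e'\<close> is the
      parity passed on, split off as \<open>S e'\<close> at the end. The middle part is then even.
      The durations are 1/4 + 1/2 + 1/4.\<close>
    let ?\<rho> = "S e' \<circ> \<pi> \<circ> S' e"
    have \<rho>: "?\<rho> permutes {..<p}" using \<pi> S by (intro permutes_compose)
    have ev\<rho>: "evenperm ?\<rho>"
      unfolding evenperm_comp[OF permutation_compose[OF perm[OF S(1)] perm[OF \<pi>]] perm[OF S(2)]]
        evenperm_comp[OF perm[OF S(1)] perm[OF \<pi>]] evS using e' by blast
    have eq: "\<pi> = (S e' \<circ> ?\<rho>) \<circ> S' e"
      using SS(1)[of e'] SS(2)[of e] by (auto simp: fun_eq_iff)
    obtain h1 where h1: "inj_on h1 {..<p}" "sim p (letter 1 \<pi> h) (cat (letter (1/4) (S' e) h) (letter (3/4) (S e' \<circ> ?\<rho>) h1))"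
      using sim_letter_split'[OF S(2) permutes_compose[OF \<rho> S(1)] h, where d = "1/4" and e = "3/4" and c = 1 and \<sigma> = \<pi>] eq
      by fastforce
    obtain h2 where h2: "inj_on h2 {..<p}" "sim p (letter (3/4) (S e' \<circ> ?\<rho>) h1) (cat (letter (1/2) ?\<rho> h1) (letter (1/4) (S e') h2))"
      using sim_letter_split'[OF \<rho> S(1) h1(1), where d = "1/2" and e = "1/4" and c = "3/4" and \<sigma> = "S e' \<circ> ?\<rho>"] by auto
    let ?A = "letter (1/4) (S e) h0" and ?B = "letter (1/4) (S' e) h"
      and ?M = "letter (1/2) ?\<rho> h1" and ?Z = "letter (1/4) (S e') h2"
    have br: "braid p ?A" "braid p ?B" "braid p ?M" "braid p ?Z"
      using S \<rho> h h1 h2 x by (auto intro!: braid_letter good_inj)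
    \<comment> \<open>One height function for both quarters: at most the positions 0, 1 cross in
      \<open>?A\<close> and at most 2, 3 in \<open>?B\<close>, so \<open>h0\<close> is kept on 0, 1
      and its values at 2, 3 are exchanged if \<open>h\<close> orders them differently.\<close>
    define g where "g = (if (h 2 < h 3) = (h0 2 < h0 3) then h0 else h0 \<circ> swap 2 3)"
    have sw: "swap 2 3 permutes {..<p}" using p by (auto intro!: permutes_swap_id)
    have g: "inj_on g {..<p}"
      using x(3) inj_comp_inv[OF sw x(3)] by (auto simp: g_def)
    have h3: "inj_on (g \<circ> inv (S e)) {..<p}" using inj_comp_inv[OF S(1) g] .
    have AB: "sim p (cat ?A ?B) (letter (1/2) (S' e \<circ> S e) g)"
    proof -
      have ne: "h 2 \<noteq> h 3" "h0 2 \<noteq> h0 3"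
        using inj_onD[OF h, of 2 3] inj_onD[OF x(3), of 2 3] p by auto
      have invS: "inv (S e) = S e" using SS(1)[of e] by (intro inv_unique_comp)
      have "lin p ?A (letter (1/4) (S e) g)"
      proof (rule lin_letter_heights)
        fix i j assume "i < j" "j < p" "S e j < S e i"
        then have "i = 0 \<and> j = 1" by (auto simp: S_def Transposition.transpose_def split: if_splits)
        then show "h0 i < h0 j \<longleftrightarrow> g i < g j" by (auto simp: g_def)
      qed (use S x g in \<open>auto intro!: good_inj\<close>)
      moreover have "lin p ?B (letter (1/4) (S' e) (g \<circ> inv (S e)))"
      proof (rule lin_letter_heights)
        fix i j assume ij: "i < j" "j < p" "S' e j < S' e i"
        then have "i = 2 \<and> j = 3" by (auto simp: S'_def Transposition.transpose_def split: if_splits)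
        moreover have "(g \<circ> inv (S e)) 2 = g 2" "(g \<circ> inv (S e)) 3 = g 3"
          unfolding invS by (auto simp: S_def Transposition.transpose_def)
        ultimately show "h i < h j \<longleftrightarrow> (g \<circ> inv (S e)) i < (g \<circ> inv (S e)) j"
          using ne by (auto simp: g_def)
      qed (use S h h3 in \<open>auto intro!: good_inj\<close>)
      ultimately have "sim p (cat ?A ?B) (cat (letter (1/4) (S e) g) (letter (1/4) (S' e) (g \<circ> inv (S e))))"
        using br by (intro sim_cat) auto
      moreover have "sim p (cat (letter (1/4) (S e) g) (letter (1/4) (S' e) (g \<circ> inv (S e)))) (letter (1/2) (S' e \<circ> S e) g)"
        using sim_sym[OF sim_letter_split[OF S(1) S(2) g, of "1/4" "1/4" e e]] by simp
      ultimately show ?thesis by (rule rtranclp_trans)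
    qed
    have evSS: "evenperm (S' e \<circ> S e)" using evS perm[OF S(1)] perm[OF S(2)] by (simp add: evenperm_comp)
    have "word_track n p d (letter (1/2) (S' e \<circ> S e) g)"
      using even[of 2 "S' e \<circ> S e" g] permutes_compose[OF S(1) S(2)] evSS g by simp
    then have "word_track n p d (cat ?A ?B)" using word_track_sim[OF AB] by blast
    moreover have "word_track n p d ?M" using even[of 2 ?\<rho> h1] \<rho> ev\<rho> h1 by simp
    ultimately have W: "word_track n p d (cat x (cat (cat ?A ?B) ?M))"
      using word_track_cat[OF x(1) word_track_cat] x(2) br d by (simp add: braid_cat)
    have "sim p (letters (ws @ [c])) (cat (letters ws) (letters [c]))"
      unfolding letters_def map_append
      using snoc.prems c by (intro sim_sym[OF sim_cats_append]) (auto intro!: braid_letter good_inj)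
    moreover have "sim p (cat (letters ws) (letters [c])) (cat (cat x ?A) (cat ?B (cat ?M ?Z)))"
    proof (rule sim_cat[OF x(4)])
      have 1: "sim p (letters [c]) (letter 1 \<pi> h)" using sing[OF \<pi> h] c by simp
      have 2: "sim p (cat ?B (letter (3/4) (S e' \<circ> ?\<rho>) h1)) (cat ?B (cat ?M ?Z))"
        using h2(2) br permutes_compose[OF \<rho> S(1)] h1 by (intro sim_cat) (auto intro!: braid_letter good_inj)
      show "sim p (letters [c]) (cat ?B (cat ?M ?Z))"
        by (rule rtranclp_trans[OF rtranclp_trans[OF 1 h1(2)] 2])
      show "braid p (letters ws)" "braid p (letters [c])"
        by (rule braid_letters, rule snoc.prems, simp)+
    qed
    moreover have "cat (cat x ?A) (cat ?B (cat ?M ?Z)) = cat (cat x (cat (cat ?A ?B) ?M)) ?Z"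
      by (simp add: cat_assoc)
    ultimately have "sim p (letters (ws @ [c])) (cat (cat x (cat (cat ?A ?B) ?M)) ?Z)"
      by (metis rtranclp_trans)
    then show ?case
      using W h2(1) x br unfolding S_def e'_def by (blast intro: braid_cat)
  }
qed

section \<open>Unlinks and pushes along the axis\<close>

lemma norm_R3_ge:
  fixes x y z :: real
  shows "norm (x, y) \<le> norm (x, y, z)" "\<bar>x\<bar> \<le> norm (x, y, z)" "\<bar>z\<bar> \<le> norm (x, y, z)"
proof -
  show 1: "norm (x, y) \<le> norm (x, y, z)"
    by (simp add: norm_Pair)
  show "\<bar>x\<bar> \<le> norm (x, y, z)"
    using norm_fst_le[of x "(y, z)"] by simp
  show "\<bar>z\<bar> \<le> norm (x, y, z)"
    using norm_snd_le[of "(y, z)" x] norm_snd_le[of z y] by simp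
qed

lemma norm_R3_zero [simp]: "norm (x::real, y::real, 0::real) = norm (x, y)"
  by (simp add: norm_Pair)

text \<open>Applied to an isotopy that moves all of space, this yields surjectivity of its final
  map.\<close>

lemma ambient_isotopic_UNIV:
  assumes "ambient_isotopic UNIV B"
  shows "B = UNIV"
proof -
  obtain H :: "real \<Rightarrow> R3 \<Rightarrow> R3" and G
    where H: "homeomorphism ({0..1} \<times> UNIV) ({0..1} \<times> UNIV) (\<lambda>(t, x). (t, H t x)) G" "H 1 ` UNIV = B"
    using assms unfolding ambient_isotopic_def by blast
  have "y \<in> B" for y
  proof -
    have "(1, y) \<in> (\<lambda>(t, x). (t, H t x)) ` ({0..1} \<times> UNIV)"
      using homeomorphism_image1[OF H(1)] by auto
    then show ?thesis using H(2) by auto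
  qed
  then show ?thesis by blast
qed

text \<open>Four motions: circle i is raised to height i, shrunk to radius 1, shifted by
  \<open>3 * i\<close>, and lowered again. During each of them, something the motion leaves alone
  separates different circles: the radius, the height, the height, and the first coordinate.\<close>

lemma concentric_unlink: "ambient_isotopic (braid_closure p []) (std_unlink p)"
proof -
  let ?X = "{..<p} \<times> (UNIV :: real set)"
  define f0 where "f0 = (\<lambda>(i, \<theta>). cyl \<theta> (real i + 1, 0))"
  define f1 where "f1 = (\<lambda>(i, \<theta>). cyl \<theta> (real i + 1, real i))"
  define f2 where "f2 = (\<lambda>(i, \<theta>). cyl \<theta> (1, real i))"
  define f3 where "f3 = (\<lambda>(i, \<theta>). (3 * real i + cos \<theta>, sin \<theta>, real i))"
  define f4 where "f4 = (\<lambda>(i, \<theta>). (3 * real i + cos \<theta>, sin \<theta>, 0 :: real))"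
  have 1: "ambient_isotopic (f0 ` ?X) (f1 ` ?X)"
  proof (rule ambient_isotopic_linear_homotopy[of 1])
    fix t x y assume "t \<in> {0..1::real}" "x \<in> ?X" "y \<in> ?X"
    obtain i \<theta> j \<theta>' where xy: "x = (i, \<theta>)" "y = (j, \<theta>')" by (cases x, cases y)
    have "norm ((f1 x - f0 x) - (f1 y - f0 y)) = \<bar>real i - real j\<bar>"
      by (simp add: f0_def f1_def xy cyl_def norm_Pair)
    also have "\<dots> = \<bar>norm (cyl \<theta> (real i + 1, 0)) - norm (cyl \<theta>' (real j + 1, 0))\<bar>"
      unfolding norm_cyl by simp
    also have "\<dots> \<le> norm (cyl \<theta> (real i + 1, 0) - cyl \<theta>' (real j + 1, 0))"
      by (rule norm_triangle_ineq3)
    also have "\<dots> = norm ((real i + 1) * cos \<theta> - (real j + 1) * cos \<theta>', (real i + 1) * sin \<theta> - (real j + 1) * sin \<theta>')"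
      by (simp add: cyl_def)
    also have "\<dots> \<le> norm ((real i + 1) * cos \<theta> - (real j + 1) * cos \<theta>', (real i + 1) * sin \<theta> - (real j + 1) * sin \<theta>', t * (real i - real j))"
      by (rule norm_R3_ge)
    also have "((real i + 1) * cos \<theta> - (real j + 1) * cos \<theta>', (real i + 1) * sin \<theta> - (real j + 1) * sin \<theta>', t * (real i - real j))
       = (f0 x + t *\<^sub>R (f1 x - f0 x)) - (f0 y + t *\<^sub>R (f1 y - f0 y))"
      by (simp add: f0_def f1_def xy cyl_def algebra_simps)
    finally show "1 * norm ((f1 x - f0 x) - (f1 y - f0 y)) \<le> norm ((f0 x + t *\<^sub>R (f1 x - f0 x)) - (f0 y + t *\<^sub>R (f1 y - f0 y)))"
      by simp
  qed simp
  have 2: "ambient_isotopic (f1 ` ?X) (f2 ` ?X)"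
  proof (cases "p = 0")
    case True
    then show ?thesis by (simp add: ambient_isotopic_refl)
  next
    case False
    then have p: "real p \<ge> 1" by simp
    show ?thesis
    proof (rule ambient_isotopic_linear_homotopy[of "1 / (2 * real p)"])
      fix t x y assume t: "t \<in> {0..1::real}" and x: "x \<in> ?X" and y: "y \<in> ?X"
      obtain i \<theta> j \<theta>' where xy: "x = (i, \<theta>)" "y = (j, \<theta>')" by (cases x, cases y)
      have ij: "real i \<le> real p" "real j \<le> real p" using x y xy by auto
      let ?e = "norm (cyl \<theta> (1, 0) - cyl \<theta>' (1, 0))"
      have D: "(f2 x - f1 x) - (f2 y - f1 y) = cyl \<theta>' (real j, 0) - cyl \<theta> (real i, 0)"
        by (simp add: f1_def f2_def xy cyl_def algebra_simps)
      have F: "(f1 x + t *\<^sub>R (f2 x - f1 x)) - (f1 y + t *\<^sub>R (f2 y - f1 y))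
         = cyl \<theta> (1 + (1 - t) * real i, real i) - cyl \<theta>' (1 + (1 - t) * real j, real j)" (is "?F = _")
        by (simp add: f1_def f2_def xy cyl_def algebra_simps)
      have "norm (cyl \<theta>' (real j, 0) - cyl \<theta> (real i, 0)) \<le> 2 * real p * norm ?F"
      proof (cases "i = j")
        case True
        have "cyl \<theta>' (real j, 0) - cyl \<theta> (real i, 0) = (- real i) *\<^sub>R (cyl \<theta> (1, 0) - cyl \<theta>' (1, 0))"
          by (simp add: cyl_def algebra_simps True)
        then have "norm (cyl \<theta>' (real j, 0) - cyl \<theta> (real i, 0)) = real i * ?e" by simp
        moreover have "real i * ?e \<le> 2 * real p * ?e" using ij by (intro mult_right_mono) auto
        moreover have "?F = (1 + (1 - t) * real i) *\<^sub>R (cyl \<theta> (1, 0) - cyl \<theta>' (1, 0))"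
          unfolding F by (simp add: cyl_def algebra_simps True)
        then have "norm ?F = (1 + (1 - t) * real i) * ?e" using t by simp
        moreover have "1 * ?e \<le> (1 + (1 - t) * real i) * ?e" using t by (intro mult_right_mono) auto
        ultimately have "2 * real p * ?e \<le> 2 * real p * norm ?F" "real i * ?e \<le> 2 * real p * ?e"
          "norm (cyl \<theta>' (real j, 0) - cyl \<theta> (real i, 0)) = real i * ?e"
          using p by (auto intro!: mult_left_mono)
        then show ?thesis by linarith
      next
        case False
        have "norm (cyl \<theta>' (real j, 0) - cyl \<theta> (real i, 0)) \<le> real j + real i"
          using norm_triangle_ineq4[of "cyl \<theta>' (real j, 0)" "cyl \<theta> (real i, 0)"] unfolding norm_cyl by simp
        also have "\<dots> \<le> 2 * real p * 1" using ij by simp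
        also have "1 \<le> \<bar>real i - real j\<bar>" using False by linarith
        then have "2 * real p * 1 \<le> 2 * real p * norm ?F"
          using p norm_R3_ge(3)[of "real i - real j"] unfolding F cyl_def
          by (intro mult_left_mono) (auto intro: order_trans)
        finally show ?thesis .
      qed
      then show "1 / (2 * real p) * norm ((f2 x - f1 x) - (f2 y - f1 y)) \<le> norm ?F"
        unfolding D using p by (simp add: field_simps)
    qed (use p in simp)
  qed
  have 3: "ambient_isotopic (f2 ` ?X) (f3 ` ?X)"
  proof (rule ambient_isotopic_linear_homotopy[of "1/3"])
    fix t and x y :: "nat \<times> real" assume t: "t \<in> {0..1::real}"
    obtain i \<theta> j \<theta>' where xy: "x = (i, \<theta>)" "y = (j, \<theta>')" by (cases x, cases y)
    let ?F = "(f2 x + t *\<^sub>R (f3 x - f2 x)) - (f2 y + t *\<^sub>R (f3 y - f2 y))"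
    have "\<bar>snd (snd ?F)\<bar> \<le> norm ?F"
      using norm_R3_ge(3)[of "snd (snd ?F)" "fst ?F" "fst (snd ?F)"] by (simp only: prod.collapse)
    moreover have "snd (snd ?F) = real i - real j" by (simp add: f2_def f3_def xy cyl_def)
    moreover have "norm ((f3 x - f2 x) - (f3 y - f2 y)) = \<bar>3 * real i - 3 * real j\<bar>"
      by (simp add: f2_def f3_def xy cyl_def norm_Pair)
    moreover have "\<bar>3 * real i - 3 * real j\<bar> = 3 * \<bar>real i - real j\<bar>"
      using abs_mult[of 3 "real i - real j"] by (simp add: right_diff_distrib)
    ultimately show "1 / 3 * norm ((f3 x - f2 x) - (f3 y - f2 y)) \<le> norm ?F" by simp
  qed simp
  have 4: "ambient_isotopic (f3 ` ?X) (f4 ` ?X)"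
  proof (rule ambient_isotopic_linear_homotopy[of 1])
    fix t and x y :: "nat \<times> real" assume t: "t \<in> {0..1::real}"
    obtain i \<theta> j \<theta>' where xy: "x = (i, \<theta>)" "y = (j, \<theta>')" by (cases x, cases y)
    let ?F = "(f3 x + t *\<^sub>R (f4 x - f3 x)) - (f3 y + t *\<^sub>R (f4 y - f3 y))"
    have "\<bar>fst ?F\<bar> \<le> norm ?F"
      using norm_R3_ge(2)[of "fst ?F" "fst (snd ?F)" "snd (snd ?F)"] by (simp only: prod.collapse)
    moreover have "fst ?F = 3 * (real i - real j) + (cos \<theta> - cos \<theta>')" by (simp add: f4_def f3_def xy)
    \<comment> \<open>Centres are 3 apart per index and the cosines change the difference by at most
      2, which leaves at least \<open>\<bar>real i - real j\<bar>\<close>.\<close>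
    moreover have "\<bar>real i - real j\<bar> \<le> \<bar>3 * (real i - real j) + (cos \<theta> - cos \<theta>')\<bar>"
    proof (cases "i = j")
      case False
      then have "1 \<le> \<bar>real i - real j\<bar>" by linarith
      moreover have "- 2 \<le> cos \<theta> - cos \<theta>'" "cos \<theta> - cos \<theta>' \<le> 2"
        using cos_le_one[of \<theta>] cos_ge_minus_one[of \<theta>] cos_le_one[of \<theta>'] cos_ge_minus_one[of \<theta>'] by linarith+
      moreover have "\<bar>a\<bar> \<le> \<bar>3 * a + b\<bar>" if "1 \<le> \<bar>a\<bar>" "- 2 \<le> b" "b \<le> 2" for a b :: real
        using that by (cases "0 \<le> a"; cases "0 \<le> 3 * a + b") simp_all
      ultimately show ?thesis by blast
    qed simp
    moreover have "norm ((f4 x - f3 x) - (f4 y - f3 y)) = \<bar>real i - real j\<bar>"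
      by (simp add: f4_def f3_def xy norm_Pair)
    ultimately show "1 * norm ((f4 x - f3 x) - (f4 y - f3 y)) \<le> norm ?F" by simp
  qed simp
  have "ambient_isotopic (f0 ` ?X) (f4 ` ?X)"
    using 1 2 3 4 ambient_isotopic_trans by blast
  moreover have "braid_closure p [] = f0 ` ?X"
    unfolding braid_closure_def f0_def cyl_def image_def
    by (auto simp: add.commute)
  moreover have "std_unlink p = f4 ` ?X"
    unfolding std_unlink_def f4_def image_def by auto
  ultimately show ?thesis by simp
qed

text \<open>Shifts each horizontal plane by \<open>v z\<close>, damped by a bump that is 1 on the
  axis, 0 from radius 2 on, and has slope 1/2. A bound \<open>r < 2\<close> on \<open>v\<close>
  makes the displacement a contraction in each plane.\<close>

definition push :: "(real \<Rightarrow> real \<times> real) \<Rightarrow> R3 \<Rightarrow> R3" where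
  "push v = (\<lambda>(x, y, z). let b = max 0 (1 - norm (x, y) / 2) in (x + b * fst (v z), y + b * snd (v z), z))"

text \<open>At equal heights the displacement has constant \<open>r / 2 < 1\<close> and is absorbed;
  a height difference adds at most \<open>L\<close> times itself. Hence the planar difference is at
  most \<open>(1 + L) / (1 - r / 2)\<close> times the current distance \<open>N\<close>. Time 1 and
  \<open>N = 0\<close> give injectivity.\<close>

lemma push_estimate:
  assumes L: "L-lipschitz_on UNIV v" and r: "\<And>z. norm (v z) \<le> r" "r < 2"
  shows "\<exists>c>0. \<forall>t\<in>{0..1}. \<forall>q q'. c * norm ((push v q - q) - (push v q' - q')) \<le>
      norm ((q + t *\<^sub>R (push v q - q)) - (q' + t *\<^sub>R (push v q' - q')))"
    and "inj (push v)"
proof -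
  have L0: "L \<ge> 0" using L lipschitz_on_nonneg by blast
  have r0: "r \<ge> 0" using r(1)[of 0] norm_ge_zero order_trans by blast
  define M where "M = (r / 2) * ((1 + L) / (1 - r / 2)) + L"
  have M0: "M \<ge> 0" using L0 r0 r(2) by (auto simp: M_def)
  have est: "norm ((push v q - q) - (push v q' - q')) \<le> M * N \<and>
      norm (fst q - fst q', fst (snd q) - fst (snd q')) \<le> (1 + L) / (1 - r / 2) * N \<and> \<bar>snd (snd q) - snd (snd q')\<bar> \<le> N"
    if t: "t \<in> {0..1}" and N: "N = norm ((q + t *\<^sub>R (push v q - q)) - (q' + t *\<^sub>R (push v q' - q')))" for t q q' N
  proof -
    obtain x y z x' y' z' where q: "q = (x, y, z)" "q' = (x', y', z')" by (metis prod.exhaust)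
    define b b' where "b = max 0 (1 - norm (x, y) / 2)" and "b' = max 0 (1 - norm (x', y') / 2)"
    define dp where "dp = (x - x', y - y')"
    define D where "D = b *\<^sub>R v z - b' *\<^sub>R v z'"
    have b: "0 \<le> b'" "b' \<le> 1" by (auto simp: b'_def)
    have "\<bar>norm (x, y) - norm (x', y')\<bar> \<le> norm dp"
      using norm_triangle_ineq3[of "(x, y)" "(x', y')"] by (simp add: dp_def)
    then have bb: "\<bar>b - b'\<bar> \<le> norm dp / 2" unfolding b_def b'_def by linarith
    have eq: "(push v q - q) - (push v q' - q') = (fst D, snd D, 0)"
      by (simp add: push_def q D_def b_def b'_def Let_def)
    have "D = (b - b') *\<^sub>R v z + b' *\<^sub>R (v z - v z')" by (simp add: D_def algebra_simps)
    then have "norm D \<le> \<bar>b - b'\<bar> * norm (v z) + b' * norm (v z - v z')"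
      using norm_triangle_ineq[of "(b - b') *\<^sub>R v z" "b' *\<^sub>R (v z - v z')"] b by simp
    also have "\<dots> \<le> (norm dp / 2) * r + 1 * (L * \<bar>z - z'\<bar>)"
      using bb b r(1)[of z] lipschitz_onD[OF L, of z z'] by (intro add_mono mult_mono) (auto simp: dist_norm)
    finally have D: "norm D \<le> (r / 2) * norm dp + L * \<bar>z - z'\<bar>" by (simp add: mult.commute)
    have F: "(q + t *\<^sub>R (push v q - q)) - (q' + t *\<^sub>R (push v q' - q')) = (fst (dp + t *\<^sub>R D), snd (dp + t *\<^sub>R D), z - z')"
      by (simp add: push_def q D_def b_def b'_def Let_def dp_def algebra_simps)
    have z: "\<bar>z - z'\<bar> \<le> N" unfolding N F by (rule norm_R3_ge)
    have "norm (dp + t *\<^sub>R D) \<le> N"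
      unfolding N F using norm_R3_ge(1)[of "fst (dp + t *\<^sub>R D)" "snd (dp + t *\<^sub>R D)" "z - z'"]
      by (simp only: prod.collapse)
    moreover have "norm dp \<le> norm (dp + t *\<^sub>R D) + norm (t *\<^sub>R D)"
      using norm_triangle_ineq4[of "dp + t *\<^sub>R D" "t *\<^sub>R D"] by simp
    moreover have "norm (t *\<^sub>R D) \<le> 1 * norm D"
      unfolding norm_scaleR using t by (intro mult_right_mono) auto
    ultimately have "norm dp \<le> N + (r / 2) * norm dp + L * \<bar>z - z'\<bar>" using D by linarith
    moreover have Lz: "L * \<bar>z - z'\<bar> \<le> L * N" using z L0 by (intro mult_left_mono)
    ultimately have "norm dp * (1 - r / 2) \<le> (1 + L) * N" by (simp add: algebra_simps)
    then have dp: "norm dp \<le> (1 + L) / (1 - r / 2) * N"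
      using r(2) by (simp add: field_simps)
    have "norm D \<le> (r / 2) * ((1 + L) / (1 - r / 2) * N) + L * N"
    proof -
      have "(r / 2) * norm dp \<le> (r / 2) * ((1 + L) / (1 - r / 2) * N)"
        using r0 by (intro mult_left_mono dp) simp
      then show ?thesis using D Lz by linarith
    qed
    then have "norm D \<le> M * N" by (simp only: M_def distrib_right mult.assoc)
    then show ?thesis using dp z unfolding eq by (simp add: q dp_def)
  qed
  show "\<exists>c>0. \<forall>t\<in>{0..1}. \<forall>q q'. c * norm ((push v q - q) - (push v q' - q')) \<le>
      norm ((q + t *\<^sub>R (push v q - q)) - (q' + t *\<^sub>R (push v q' - q')))"
  proof (intro exI[of _ "1 / (M + 1)"] conjI ballI allI)
    fix t q q' assume t: "t \<in> {0..1::real}"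
    let ?N = "norm ((q + t *\<^sub>R (push v q - q)) - (q' + t *\<^sub>R (push v q' - q')))"
    have "norm ((push v q - q) - (push v q' - q')) \<le> M * ?N" using est[OF t refl] by blast
    also have "\<dots> \<le> (M + 1) * ?N" by (intro mult_right_mono) auto
    finally have le: "norm ((push v q - q) - (push v q' - q')) \<le> (M + 1) * ?N" .
    have "1 / (M + 1) * X \<le> Y" if "X \<le> (M + 1) * Y" for X Y :: real
      using that M0 by (simp add: field_simps)
    from this[OF le] show "1 / (M + 1) * norm ((push v q - q) - (push v q' - q')) \<le> ?N" .
  qed (use M0 in simp)
  show "inj (push v)"
  proof (rule injI)
    fix q q' assume eq: "push v q = push v q'"
    then have "norm ((q + 1 *\<^sub>R (push v q - q)) - (q' + 1 *\<^sub>R (push v q' - q'))) = 0" by simp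
    then have N: "0 = norm ((q + 1 *\<^sub>R (push v q - q)) - (q' + 1 *\<^sub>R (push v q' - q')))" ..
    have "norm (fst q - fst q', fst (snd q) - fst (snd q')) \<le> 0" "\<bar>snd (snd q) - snd (snd q')\<bar> \<le> 0"
      using est[OF _ N] unfolding mult_zero_right by (blast intro: atLeastAtMost_iff[THEN iffD2] zero_le_one order_refl)+
    then have "fst q = fst q'" "fst (snd q) = fst (snd q')" "snd (snd q) = snd (snd q')"
      using norm_fst_le[of "fst q - fst q'" "fst (snd q) - fst (snd q')"]
        norm_snd_le[of "fst (snd q) - fst (snd q')" "fst q - fst q'"]
      unfolding real_norm_def by linarith+
    then show "q = q'" by (intro prod_eqI)
  qed
qed

lemma push_isotopic:
  assumes "L-lipschitz_on UNIV v" "\<And>z. norm (v z) \<le> r" "r < 2"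
  shows "ambient_isotopic S (push v ` S)" "surj (push v)"
proof -
  obtain c where c: "c > 0" "\<forall>t\<in>{0..1}. \<forall>q q'. c * norm ((push v q - q) - (push v q' - q')) \<le>
      norm ((q + t *\<^sub>R (push v q - q)) - (q' + t *\<^sub>R (push v q' - q')))"
    using push_estimate(1)[OF assms] by blast
  have *: "ambient_isotopic ((\<lambda>q. q) ` S) (push v ` S)" for S
    by (rule ambient_isotopic_linear_homotopy[OF c(1)]) (use c(2) in blast)
  from *[of S] show "ambient_isotopic S (push v ` S)" by simp
  from *[of UNIV] show "surj (push v)" using ambient_isotopic_UNIV by simp
qed

text \<open>A push carries the axis to a strand with monotone height; undoing one push and applying another
  one moves only that strand.\<close>
lemma replace_monotone_strand:
  assumes \<gamma>: "L-lipschitz_on UNIV \<gamma>" "\<And>z. norm (\<gamma> z) \<le> r" "r < 2"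
    and \<sigma>: "M-lipschitz_on UNIV \<sigma>" "\<And>z. norm (\<sigma> z) \<le> r"
    and rest: "\<And>x y z. (x, y, z) \<in> B \<Longrightarrow> norm (x, y) \<ge> 2 \<or> \<gamma> z = \<sigma> z"
  shows "ambient_isotopic ((\<lambda>z. (fst (\<gamma> z), snd (\<gamma> z), z)) ` Z \<union> B) ((\<lambda>z. (fst (\<sigma> z), snd (\<sigma> z), z)) ` Z \<union> B)"
proof -
  let ?A = "\<lambda>v. (\<lambda>z. (fst (v z), snd (v z), z)) ` Z \<union> B"
  note p\<gamma> = push_isotopic[OF \<gamma>] and p\<sigma> = push_isotopic[OF \<sigma> \<gamma>(3)]
  define S where "S = push \<gamma> -` ?A \<gamma>"
  have core: "push v (0, 0, z) = (fst (v z), snd (v z), z)" for v z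
    by (simp add: push_def norm_Pair)
  \<comment> \<open>Both pushes are the identity outside radius 2. Inside, the image under
    \<open>push \<gamma>\<close> stays inside, so if it lies in \<open>B\<close> then
    \<open>rest\<close> makes the two displacements agree at that height.\<close>
  have same: "push \<sigma> q = push \<gamma> q" if "push \<gamma> q \<in> B" for q
  proof -
    obtain x y z where q: "q = (x, y, z)" by (metis prod.exhaust)
    define b where "b = max 0 (1 - norm (x, y) / 2)"
    have pq: "push v q = (x + b * fst (v z), y + b * snd (v z), z)" for v
      by (simp add: push_def q b_def Let_def)
    show ?thesis
    proof (cases "norm (x, y) < 2")
      case True
      have "norm (x + b * fst (\<gamma> z), y + b * snd (\<gamma> z)) = norm ((x, y) + b *\<^sub>R \<gamma> z)"
        by (simp add: prod_eq_iff plus_prod_def scaleR_prod_def)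
      also have "\<dots> \<le> norm (x, y) + b * r"
        using norm_triangle_ineq[of "(x, y)" "b *\<^sub>R \<gamma> z"] mult_left_mono[OF \<gamma>(2)[of z], of b] by (simp add: b_def)
      also have "b * r < b * 2" using True \<gamma>(3) by (intro mult_strict_left_mono) (auto simp: b_def)
      finally have "norm (x + b * fst (\<gamma> z), y + b * snd (\<gamma> z)) < 2" using True by (simp add: b_def)
      then have "\<gamma> z = \<sigma> z" using rest that unfolding pq by force
      then show ?thesis by (simp add: pq)
    next
      case False
      then have "b = 0" by (simp add: b_def)
      then show ?thesis by (simp add: pq)
    qed
  qed
  have "push \<gamma> ` S = ?A \<gamma>" unfolding S_def using p\<gamma>(2) by (rule surj_image_vimage_eq)
  then have 1: "ambient_isotopic S (?A \<gamma>)" using p\<gamma>(1)[of S] by simp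
  have "push \<sigma> ` S = ?A \<sigma>"
  proof (intro equalityI subsetI)
    fix y assume "y \<in> push \<sigma> ` S"
    then obtain q where q: "y = push \<sigma> q" "push \<gamma> q \<in> ?A \<gamma>" by (auto simp: S_def)
    from q(2) show "y \<in> ?A \<sigma>"
    proof
      assume "push \<gamma> q \<in> (\<lambda>z. (fst (\<gamma> z), snd (\<gamma> z), z)) ` Z"
      then obtain z where z: "z \<in> Z" "push \<gamma> q = push \<gamma> (0, 0, z)" unfolding core by blast
      then have "q = (0, 0, z)" using push_estimate(2)[OF \<gamma>] by (simp add: inj_eq)
      then show ?thesis using z(1) q(1) core by auto
    qed (use same q in auto)
  next
    fix y assume "y \<in> ?A \<sigma>"
    then show "y \<in> push \<sigma> ` S"
    proof
      assume "y \<in> (\<lambda>z. (fst (\<sigma> z), snd (\<sigma> z), z)) ` Z"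
      then obtain z where "z \<in> Z" "y = push \<sigma> (0, 0, z)" unfolding core by blast
      then show ?thesis by (intro image_eqI[of _ _ "(0, 0, z)"]) (auto simp: S_def core)
    next
      assume y: "y \<in> B"
      obtain q where "y = push \<gamma> q" using p\<gamma>(2) by (metis surjD)
      then show ?thesis using y same[of q] by (intro image_eqI[of _ _ q]) (auto simp: S_def)
    qed
  qed
  then have 2: "ambient_isotopic S (?A \<sigma>)" using p\<sigma>(1)[of S] by simp
  show ?thesis using ambient_isotopic_trans[OF ambient_isotopic_sym[OF 1] 2] .
qed

section \<open>Stabilization\<close>

text \<open>For deformations that move the ends of the two pieces: here the ends only have to match
  cyclically, whereas \<open>lin\<close> fixes them at integer radii and height 0.\<close>

lemma cat_homotopy:
  assumes dur: "dur a' = dur a" "dur b' = dur b" "0 \<le> dur a" "0 < dur b"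
    and perm: "perm a' = perm a" "perm b' = perm b" "perm a permutes {..<p}" "perm b permutes {..<p}"
    and lip: "\<And>i. i < p \<Longrightarrow> \<exists>K. K-lipschitz_on {0..dur a} (strand a i)"
      "\<And>i. i < p \<Longrightarrow> \<exists>K. K-lipschitz_on {0..dur a} (strand a' i)"
      "\<And>i. i < p \<Longrightarrow> \<exists>K. K-lipschitz_on {0..dur b} (strand b i)"
      "\<And>i. i < p \<Longrightarrow> \<exists>K. K-lipschitz_on {0..dur b} (strand b' i)"
    and join: "\<And>i. i < p \<Longrightarrow> strand a i (dur a) = strand b (perm a i) 0"
      "\<And>i. i < p \<Longrightarrow> strand a' i (dur a) = strand b' (perm a i) 0"
      "\<And>i. i < p \<Longrightarrow> strand b i (dur b) = strand a (perm b i) 0"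
      "\<And>i. i < p \<Longrightarrow> strand b' i (dur b) = strand a' (perm b i) 0"
    and pos: "\<And>i \<tau>. i < p \<Longrightarrow> \<tau> \<in> {0..dur a} \<Longrightarrow> 1 \<le> fst (strand a i \<tau>) \<and> 1 \<le> fst (strand a' i \<tau>)"
      "\<And>i \<tau>. i < p \<Longrightarrow> \<tau> \<in> {0..dur b} \<Longrightarrow> 1 \<le> fst (strand b i \<tau>) \<and> 1 \<le> fst (strand b' i \<tau>)"
    and inj: "\<And>t \<tau> i j. t \<in> {0..1} \<Longrightarrow> \<tau> \<in> {0..dur a} \<Longrightarrow> i < p \<Longrightarrow> j < p \<Longrightarrow> i \<noteq> j \<Longrightarrow>
       (1 - t) *\<^sub>R strand a i \<tau> + t *\<^sub>R strand a' i \<tau> \<noteq> (1 - t) *\<^sub>R strand a j \<tau> + t *\<^sub>R strand a' j \<tau>"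
      "\<And>t \<tau> i j. t \<in> {0..1} \<Longrightarrow> \<tau> \<in> {0..dur b} \<Longrightarrow> i < p \<Longrightarrow> j < p \<Longrightarrow> i \<noteq> j \<Longrightarrow>
       (1 - t) *\<^sub>R strand b i \<tau> + t *\<^sub>R strand b' i \<tau> \<noteq> (1 - t) *\<^sub>R strand b j \<tau> + t *\<^sub>R strand b' j \<tau>"
  shows "ambient_isotopic (closure_of_track p (cat a b)) (closure_of_track p (cat a' b'))"
proof -
  have lt: "perm a i < p" "perm b i < p" if "i < p" for i
    using permutes_in_image[OF perm(3), of i] permutes_in_image[OF perm(4), of i] that by auto
  have ne: "perm a i \<noteq> perm a j" if "i \<noteq> j" for i j
    using permutes_inj[OF perm(3)] that by (auto simp: inj_def)
  have pp: "(perm b \<circ> perm a) ` {..<p} = {..<p}"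
    using permutes_image[OF permutes_compose[OF perm(3,4)]] .
  have d: "dur (cat a' b') = dur (cat a b)" using dur by simp
  show ?thesis
    unfolding closure_of_track_def d
  proof (rule track_closure_linear_homotopy[OF _ pp])
    show "dur (cat a b) > 0" using dur by simp
    show "\<exists>K. K-lipschitz_on {0..dur (cat a b)} (strand (cat a b) i)"
      "\<exists>K. K-lipschitz_on {0..dur (cat a b)} (strand (cat a' b') i)" if "i < p" for i
      using lipschitz_cat[of a i b] lipschitz_cat[of a' i b'] lip join lt(1) that dur perm d by auto
    show "strand (cat a b) i (dur (cat a b)) = strand (cat a b) ((perm b \<circ> perm a) i) 0"
      "strand (cat a' b') i (dur (cat a b)) = strand (cat a' b') ((perm b \<circ> perm a) i) 0" if "i < p" for i
      using join(3,4) lt that dur perm by (auto simp: strand_cat)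
    show "1 \<le> fst (strand (cat a b) i \<tau>)" "1 \<le> fst (strand (cat a' b') i \<tau>)"
      if "i < p" "\<tau> \<in> {0..dur (cat a b)}" for i \<tau>
      using pos lt that dur perm by (auto simp: strand_cat)
    fix t \<tau> i j assume *: "t \<in> {0..1::real}" "\<tau> \<in> {0..dur (cat a b)}" "i < p" "j < p" "i \<noteq> j"
    show "(1 - t) *\<^sub>R strand (cat a b) i \<tau> + t *\<^sub>R strand (cat a' b') i \<tau>
       \<noteq> (1 - t) *\<^sub>R strand (cat a b) j \<tau> + t *\<^sub>R strand (cat a' b') j \<tau>"
    proof (cases "\<tau> \<le> dur a")
      case True
      then show ?thesis using inj(1)[of t \<tau> i j] * dur by (simp add: strand_cat)
    next
      case False
      then show ?thesis
        using inj(2)[of t "\<tau> - dur a" "perm a i" "perm a j"] * dur perm lt(1) ne by (simp add: strand_cat)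
    qed
  qed
qed

section \<open>Lipschitz calculus without explicit constants\<close>

definition lip :: "real set \<Rightarrow> (real \<Rightarrow> 'a::metric_space) \<Rightarrow> bool" where
  "lip S f \<longleftrightarrow> (\<exists>K. K-lipschitz_on S f)"

lemma lip_const: "lip S (\<lambda>x. c)"
  unfolding lip_def using lipschitz_on_constant by blast

lemma lip_affine: "lip S (\<lambda>x. a * x + b :: real)"
proof -
  have "\<bar>a\<bar>-lipschitz_on S (\<lambda>x. a * x + b)"
    by (rule lipschitz_onI) (auto simp: dist_real_def right_diff_distrib[symmetric] abs_mult)
  then show ?thesis unfolding lip_def by blast
qed

lemma lip_Pair: "lip S f \<Longrightarrow> lip S g \<Longrightarrow> lip S (\<lambda>x. (f x, g x))"
  unfolding lip_def using lipschitz_on_Pair by blast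

lemma lip_minmax:
  fixes f g :: "real \<Rightarrow> real"
  assumes "lip S f" "lip S g"
  shows "lip S (\<lambda>x. max (f x) (g x))" "lip S (\<lambda>x. min (f x) (g x))"
proof -
  obtain K M where K: "K-lipschitz_on S f" "M-lipschitz_on S g" using assms unfolding lip_def by blast
  have nn: "K \<ge> 0" "M \<ge> 0" using K lipschitz_on_nonneg by blast+
  have *: "\<bar>f x - f y\<bar> \<le> (K + M) * dist x y" "\<bar>g x - g y\<bar> \<le> (K + M) * dist x y" if "x \<in> S" "y \<in> S" for x y
    using lipschitz_onD[OF K(1) that] lipschitz_onD[OF K(2) that] nn
      mult_nonneg_nonneg[OF nn(1), of "dist x y"] mult_nonneg_nonneg[OF nn(2), of "dist x y"]
    by (simp_all add: dist_real_def distrib_right)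
  have "(K + M)-lipschitz_on S (\<lambda>x. max (f x) (g x))" "(K + M)-lipschitz_on S (\<lambda>x. min (f x) (g x))"
  proof (safe intro!: lipschitz_onI)
    fix x y assume xy: "x \<in> S" "y \<in> S"
    have "\<bar>max (f x) (g x) - max (f y) (g y)\<bar> \<le> max \<bar>f x - f y\<bar> \<bar>g x - g y\<bar>"
      "\<bar>min (f x) (g x) - min (f y) (g y)\<bar> \<le> max \<bar>f x - f y\<bar> \<bar>g x - g y\<bar>" by linarith+
    then show "dist (max (f x) (g x)) (max (f y) (g y)) \<le> (K + M) * dist x y"
      "dist (min (f x) (g x)) (min (f y) (g y)) \<le> (K + M) * dist x y"
      using *[OF xy] unfolding dist_real_def by (auto intro: order_trans max.boundedI)
  qed (use nn in auto)
  then show "lip S (\<lambda>x. max (f x) (g x))" "lip S (\<lambda>x. min (f x) (g x))" unfolding lip_def by blast+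
qed

lemma lip_concat:
  assumes "lip {a..b} f" "lip {b..c} g" "f b = g b"
  shows "lip {a..c} (\<lambda>x. if x \<le> b then f x else g x)"
  using assms lipschitz_on_concat_max unfolding lip_def by blast

text \<open>Horizontal projection of a curve given in cylindrical coordinates, reparametrized by
  \<open>g\<close>; this supplies the displacement fields for \<open>push\<close>.\<close>

lemma lip_planar:
  fixes A :: "real \<Rightarrow> real \<times> real"
  assumes A: "lip {a..b} A" and g: "lip UNIV g" "\<And>z. g z \<in> {a..b}"
  shows "lip UNIV (\<lambda>z. (fst (A (g z)) * cos (2 * pi * g z / T), fst (A (g z)) * sin (2 * pi * g z / T)))"
proof -
  let ?c = "\<lambda>\<tau>. cyl (2 * pi * \<tau> / T) (A \<tau>)"
  obtain K where K: "K-lipschitz_on {a..b} ?c"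
    using A lipschitz_on_cyl unfolding lip_def by blast
  obtain M where M: "M-lipschitz_on UNIV g" using g(1) unfolding lip_def by blast
  have "(K * M)-lipschitz_on UNIV (\<lambda>z. ?c (g z))"
    using g(2) by (intro lipschitz_on_compose2[OF M] lipschitz_on_mono[OF K]) auto
  then have "(K * M)-lipschitz_on UNIV (\<lambda>z. (fst (?c (g z)), fst (snd (?c (g z)))))"
    unfolding lipschitz_on_def
  proof (elim conjE, intro conjI ballI)
    fix x y
    assume "\<forall>x\<in>UNIV. \<forall>y\<in>UNIV. dist (?c (g x)) (?c (g y)) \<le> K * M * dist x y"
    then have "dist (?c (g x)) (?c (g y)) \<le> K * M * dist x y" by blast
    then show "dist (fst (?c (g x)), fst (snd (?c (g x)))) (fst (?c (g y)), fst (snd (?c (g y)))) \<le> K * M * dist x y"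
      using norm_R3_ge(1)[of "fst (?c (g x)) - fst (?c (g y))" "fst (snd (?c (g x))) - fst (snd (?c (g y)))" "snd (snd (?c (g x))) - snd (snd (?c (g y)))"]
      by (simp add: dist_norm cyl_def)
  qed
  then show ?thesis unfolding lip_def cyl_def by auto
qed

text \<open>Adds an innermost string; the other positions increase by one.\<close>
definition lift :: "track \<Rightarrow> track" where
  "lift u = Track (dur u) (\<lambda>i \<tau>. case i of 0 \<Rightarrow> (1, 0) | Suc k \<Rightarrow> strand u k \<tau> + (1, 0))
     (\<lambda>i. case i of 0 \<Rightarrow> 0 | Suc k \<Rightarrow> Suc (perm u k))"

lemma permutes_lift:
  assumes "\<pi> permutes {..<p}"
  shows "(\<lambda>i. case i of 0 \<Rightarrow> 0 | Suc k \<Rightarrow> Suc (\<pi> k)) permutes {..<Suc p}"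
proof -
  have "bij_betw (\<lambda>i. case i of 0 \<Rightarrow> 0 | Suc k \<Rightarrow> Suc (\<pi> k)) {..<Suc p} {..<Suc p}"
    using permutes_inverses[OF assms] permutes_in_image[OF assms] permutes_in_image[OF permutes_inv[OF assms]]
    by (intro bij_betw_byWitness[where f' = "\<lambda>i. case i of 0 \<Rightarrow> 0 | Suc k \<Rightarrow> Suc (inv \<pi> k)"])
      (auto split: nat.splits)
  then show ?thesis
    using permutes_not_in[OF assms] by (intro bij_imp_permutes) (auto split: nat.splits)
qed

lemma braid_lift:
  assumes u: "braid p u"
  shows "braid (Suc p) (lift u)"
  unfolding braid_def
proof (intro conjI allI impI ballI)
  show "0 \<le> dur (lift u)" "perm (lift u) permutes {..<Suc p}"
    using u permutes_lift by (auto simp: braid_def lift_def)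
  fix i assume i: "i < Suc p"
  show "\<exists>K. K-lipschitz_on {0..dur (lift u)} (strand (lift u) i)"
  proof (cases i)
    case 0
    then show ?thesis by (auto simp: lift_def intro: lipschitz_on_constant)
  next
    case (Suc k)
    then obtain K where "K-lipschitz_on {0..dur u} (strand u k)" using u i by (auto simp: braid_def)
    then have "(K + 0)-lipschitz_on {0..dur u} (\<lambda>\<tau>. strand u k \<tau> + (1, 0))"
      by (intro lipschitz_on_add lipschitz_on_constant)
    then show ?thesis using Suc by (auto simp: lift_def)
  qed
  show "strand (lift u) i 0 = (real i + 1, 0)"
    "strand (lift u) i (dur (lift u)) = (real (perm (lift u) i) + 1, 0)"
    using u i by (auto simp: braid_def lift_def split: nat.splits)
  fix \<tau> assume \<tau>: "\<tau> \<in> {0..dur (lift u)}"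
  have ge: "1 \<le> fst (strand u k \<tau>)" if "k < p" for k
    using u that \<tau> by (auto simp: braid_def lift_def)
  show "1 \<le> fst (strand (lift u) i \<tau>)"
    using ge i by (cases i) (fastforce simp: lift_def)+
  fix j assume j: "j < Suc p" "i \<noteq> j"
  show "strand (lift u) i \<tau> \<noteq> strand (lift u) j \<tau>"
  proof (cases i)
    case 0
    then obtain k where "j = Suc k" using j by (cases j) auto
    then show ?thesis using ge[of k] j 0 by (auto simp: lift_def prod_eq_iff)
  next
    case (Suc l)
    show ?thesis
    proof (cases j)
      case 0
      then show ?thesis using ge[of l] i Suc by (auto simp: lift_def prod_eq_iff)
    next
      case (Suc k)
      then show ?thesis using u i j \<tau> \<open>i = Suc l\<close> by (auto simp: lift_def braid_def)
    qed
  qed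
qed

section \<open>Geometry of one stabilization\<close>

context
  fixes p :: nat and u :: track and U T :: real
  assumes u: "braid p u" and p: "p \<ge> 1" and dU: "dur u = U" and T: "U + 1 = T"
begin

text \<open>The height of the innermost loop is the time elapsed since it left radius \<open>2\<close> on the curve
  \<open>inward\<close>, until it is back there on the curve \<open>outward\<close>, one turn later.  Between the heights
  \<open>1/8\<close> and \<open>T + 5/8\<close> it is replaced by a short strand at radius \<open>3/2\<close>.\<close>
definition inward :: "real \<Rightarrow> real \<times> real" where
  "inward s = (max 1 (2 - 4 * s), s)"

definition outward :: "real \<Rightarrow> real \<times> real" where
  "outward s = (min 2 (max 1 (4 * s - 1)), min (T + s) ((4 * T + 3) * (1 - s)))"

text \<open>\<open>inward\<close> at 1/8 and \<open>outward\<close> at 5/8 both have radius 3/2,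
  with heights 1/8 and \<open>T + 5/8\<close>; the slope \<open>2 * T + 1\<close> is this height
  difference over the time 1/2.\<close>

definition shortcut :: "real \<Rightarrow> real \<times> real" where
  "shortcut s = (if s \<le> 1/8 then inward s
     else if s \<le> 5/8 then (3/2, 1/8 + (s - 1/8) * (2 * T + 1)) else outward s)"

lemma T1: "T \<ge> 1" using u T dU by (simp add: braid_def)

lemma lip_curves: "lip S inward" "lip S outward" "lip {0..1} shortcut"
proof -
  have a: "lip S (\<lambda>s. c + d * s)" for c d and S :: "real set"
    using lip_affine[of S d c] by (simp add: add.commute)
  have i: "inward = (\<lambda>s. (max 1 (2 + (- 4) * s), 0 + 1 * s))" by (auto simp: inward_def)
  show 1: "lip S inward" for S unfolding i by (intro lip_Pair lip_minmax lip_const a)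
  have o: "outward = (\<lambda>s. (min 2 (max 1 (- 1 + 4 * s)), min (T + 1 * s) ((4 * T + 3) + (- (4 * T + 3)) * s)))"
    by (auto simp: outward_def fun_eq_iff algebra_simps)
  show 2: "lip S outward" for S unfolding o by (intro lip_Pair lip_minmax lip_const a)
  have e: "(\<lambda>s. (3/2 :: real, 1/8 + (s - 1/8) * (2 * T + 1))) = (\<lambda>s. (3/2, (1/8 - (2 * T + 1) / 8) + (2 * T + 1) * s))"
    by (auto simp: fun_eq_iff algebra_simps)
  have 3: "lip S (\<lambda>s. (3/2 :: real, 1/8 + (s - 1/8) * (2 * T + 1)))" for S
    unfolding e by (intro lip_Pair lip_const a)
  have j: "(3/2, 1/8 + (5/8 - 1/8) * (2 * T + 1)) = outward (5/8)"
    using T1 by (simp add: outward_def min_def max_def add_divide_distrib)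
  have "lip {0..1} (\<lambda>s. if s \<le> 1/8 then inward s
     else if s \<le> 5/8 then (3/2, 1/8 + (s - 1/8) * (2 * T + 1)) else outward s)"
    by (rule lip_concat[OF 1 lip_concat[OF 3 2 j]]) (simp add: inward_def)
  then show "lip {0..1} shortcut" by (simp only: shortcut_def[abs_def])
qed

text \<open>The loop starts at height 1, where \<open>inward\<close> ends, and stops at height
  \<open>1 + U = T\<close>, where \<open>outward\<close> starts.\<close>

definition spiral_a where
  "spiral_a = Track U (\<lambda>i \<tau>. case i of 0 \<Rightarrow> (1, 1 + \<tau>) | Suc k \<Rightarrow> strand u k \<tau> + (1, 0)) (perm (lift u))"

definition spiral_b where
  "spiral_b = Track 1 (\<lambda>i s. if i = 0 then outward s else if i = 1 then inward s else (real i + 1, 0)) (swap 0 1)"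

text \<open>All of \<open>u\<close> is moved out by one unit, so that it coincides with the outer
  strings of the spiral.\<close>

definition straight_a where
  "straight_a = Track U (\<lambda>k \<tau>. strand u k \<tau> + (1, 0)) (perm u)"

definition straight_b where
  "straight_b = Track 1 (\<lambda>k s. if k = 0 then shortcut s else (real k + 2, 0)) id"

lemma u_simps:
  assumes "k < p"
  shows "\<exists>K. K-lipschitz_on {0..U} (strand u k)" "\<exists>K. K-lipschitz_on {0..U} (\<lambda>\<tau>. strand u k \<tau> + (1, 0))"
    "strand u k 0 = (real k + 1, 0)" "strand u k U = (real (perm u k) + 1, 0)"
    "\<And>\<tau>. \<tau> \<in> {0..U} \<Longrightarrow> 1 \<le> fst (strand u k \<tau>)" "perm u k < p"
    "\<And>l \<tau>. l < p \<Longrightarrow> \<tau> \<in> {0..U} \<Longrightarrow> k \<noteq> l \<Longrightarrow> strand u k \<tau> \<noteq> strand u l \<tau>"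
proof -
  show 1: "\<exists>K. K-lipschitz_on {0..U} (strand u k)" "strand u k 0 = (real k + 1, 0)"
    "strand u k U = (real (perm u k) + 1, 0)" "\<And>\<tau>. \<tau> \<in> {0..U} \<Longrightarrow> 1 \<le> fst (strand u k \<tau>)"
    "\<And>l \<tau>. l < p \<Longrightarrow> \<tau> \<in> {0..U} \<Longrightarrow> k \<noteq> l \<Longrightarrow> strand u k \<tau> \<noteq> strand u l \<tau>"
    using u assms by (auto simp: braid_def dU)
  then obtain K where "K-lipschitz_on {0..U} (strand u k)" by blast
  then have "(K + 0)-lipschitz_on {0..U} (\<lambda>\<tau>. strand u k \<tau> + (1, 0))"
    by (intro lipschitz_on_add lipschitz_on_constant)
  then show "\<exists>K. K-lipschitz_on {0..U} (\<lambda>\<tau>. strand u k \<tau> + (1, 0))" by blast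
  show "perm u k < p" using perm_lt[OF u assms] .
qed

lemma swap_permutes: "swap 0 1 permutes {..<Suc p}"
  using p by (intro permutes_swap_id) auto

lemma perm_lift_permutes: "perm (lift u) permutes {..<Suc p}"
  using braid_lift[OF u] by (simp add: braid_def)

text \<open>During \<open>u\<close> the inner string is alone inside radius 2 and can be raised
  freely. In the exchange of positions 0 and 1, the heights \<open>- real i\<close> put the outgoing
  string above the incoming one, and it stays above until their radii have separated.\<close>

lemma to_spiral:
  "ambient_isotopic (closure_of_track (Suc p) (cat (lift u) (letter 1 (swap 0 1) (\<lambda>i. - real i))))
     (closure_of_track (Suc p) (cat spiral_a spiral_b))"
proof (rule cat_homotopy)
  let ?h = "\<lambda>i. - real i"
  have lb: "braid (Suc p) (letter 1 (swap 0 1) ?h)"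
    by (intro braid_letter good_inj swap_permutes) (auto simp: inj_on_def)
  note ll = braid_lift[OF u]
  show "dur spiral_a = dur (lift u)" "dur spiral_b = dur (letter 1 (swap 0 1) ?h)" "0 \<le> dur (lift u)"
    "0 < dur (letter 1 (swap 0 1) ?h)" "perm spiral_a = perm (lift u)" "perm spiral_b = perm (letter 1 (swap 0 1) ?h)"
    using u by (auto simp: spiral_a_def spiral_b_def lift_def dU braid_def)
  show "perm (lift u) permutes {..<Suc p}" "perm (letter 1 (swap 0 1) ?h) permutes {..<Suc p}"
    using perm_lift_permutes swap_permutes by auto
  fix i assume i: "i < Suc p"
  have pl: "perm (lift u) i < Suc p" using perm_lt[OF ll i] .
  have ps: "swap 0 1 i < Suc p" using permutes_in_image[OF swap_permutes, of i] i by simp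
  show "\<exists>K. K-lipschitz_on {0..dur (lift u)} (strand (lift u) i)" "\<exists>K. K-lipschitz_on {0..dur (letter 1 (swap 0 1) ?h)} (strand (letter 1 (swap 0 1) ?h) i)"
    using ll lb i by (auto simp: braid_def)
  have "lip {0..U} (\<lambda>\<tau>. (1::real, 1 * \<tau> + 1))" by (intro lip_Pair lip_const lip_affine)
  then show "\<exists>K. K-lipschitz_on {0..dur (lift u)} (strand spiral_a i)"
    using i u_simps(2) by (cases i) (auto simp: spiral_a_def lift_def dU lip_def add.commute)
  show "\<exists>K. K-lipschitz_on {0..dur (letter 1 (swap 0 1) ?h)} (strand spiral_b i)"
  proof -
    consider "i = 0" | "i = 1" | "i \<noteq> 0" "i \<noteq> 1" by blast
    then show ?thesis
      using lip_curves(1,2)[of "{0..1}"] lip_const[of "{0..1}" "(real i + 1, 0 :: real)"]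
      by cases (auto simp: spiral_b_def lip_def)
  qed
  show "strand (lift u) i (dur (lift u)) = strand (letter 1 (swap 0 1) ?h) (perm (lift u) i) 0"
    "strand (letter 1 (swap 0 1) ?h) i (dur (letter 1 (swap 0 1) ?h)) = strand (lift u) (perm (letter 1 (swap 0 1) ?h) i) 0"
    using ll lb i pl ps by (auto simp: braid_def)
  show "strand spiral_a i (dur (lift u)) = strand spiral_b (perm (lift u) i) 0"
    using i u_simps(4) T T1 by (cases i) (auto simp: spiral_a_def spiral_b_def lift_def dU outward_def inward_def min_def max_def)
  show "strand spiral_b i (dur (letter 1 (swap 0 1) ?h)) = strand spiral_a (perm (letter 1 (swap 0 1) ?h) i) 0"
  proof -
    consider "i = 0" | "i = 1" | k where "i = Suc (Suc k)" by (metis One_nat_def nat.exhaust)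
    then show ?thesis
      using i u_simps(3) p T1 by cases (auto simp: spiral_a_def spiral_b_def outward_def inward_def Transposition.transpose_def)
  qed
next
  fix i \<tau> assume i: "i < Suc p" and \<tau>: "\<tau> \<in> {0..dur (lift u)}"
  have "0 \<le> fst (strand u k \<tau>)" if "k < p" for k
    using u_simps(5)[OF that, of \<tau>] \<tau> by (auto simp: lift_def dU)
  then show "1 \<le> fst (strand (lift u) i \<tau>) \<and> 1 \<le> fst (strand spiral_a i \<tau>)"
    using i by (cases i) (auto simp: lift_def spiral_a_def)
next
  fix i \<tau> assume i: "i < Suc p" and \<tau>: "\<tau> \<in> {0..dur (letter 1 (swap 0 1) (\<lambda>i. - real i))}"
  have "braid (Suc p) (letter 1 (swap 0 1) (\<lambda>i. - real i))"
    by (intro braid_letter good_inj swap_permutes) (auto simp: inj_on_def)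
  then show "1 \<le> fst (strand (letter 1 (swap 0 1) (\<lambda>i. - real i)) i \<tau>) \<and> 1 \<le> fst (strand spiral_b i \<tau>)"
    using i \<tau> by (auto simp: braid_def spiral_b_def inward_def outward_def)
next
  fix t \<tau> i j assume t: "t \<in> {0..1::real}" and \<tau>: "\<tau> \<in> {0..dur (lift u)}" and ij: "i < Suc p" "j < Suc p" "i \<noteq> j"
  have \<tau>': "\<tau> \<in> {0..U}" using \<tau> by (simp add: lift_def dU)
  let ?F = "\<lambda>i. (1 - t) *\<^sub>R strand (lift u) i \<tau> + t *\<^sub>R strand spiral_a i \<tau>"
  have F: "?F (Suc k) = strand u k \<tau> + (1, 0)" for k
    by (simp add: lift_def spiral_a_def algebra_simps prod_eq_iff)
  have F0: "fst (?F 0) = 1" by (simp add: lift_def spiral_a_def)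
  have ne: "?F 0 \<noteq> ?F (Suc k)" if "k < p" for k
  proof
    assume eq: "?F 0 = ?F (Suc k)"
    have "fst (?F 0) = fst (?F (Suc k))" by (rule arg_cong[OF eq])
    then have "1 = fst (strand u k \<tau>) + 1" unfolding F0 unfolding F by simp
    then show False using u_simps(5)[OF that \<tau>'] by simp
  qed
  show "?F i \<noteq> ?F j"
  proof (cases i)
    case 0
    then obtain k where "j = Suc k" using ij by (cases j) auto
    then show ?thesis using ne[of k] 0 ij by simp
  next
    case (Suc l)
    show ?thesis
    proof (cases j)
      case 0
      have "l < p" using ij Suc by simp
      from not_sym[OF ne[OF this]] show ?thesis unfolding Suc 0 .
    next
      case k: (Suc k)
      then show ?thesis using u_simps(7)[of l k \<tau>] \<tau>' ij unfolding Suc k F by simp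
    qed
  qed
next
  fix t s i j assume t: "t \<in> {0..1::real}" and s': "s \<in> {0..dur (letter 1 (swap 0 1) (\<lambda>i. - real i))}" and ij: "i < Suc p" "j < Suc p" "i \<noteq> j"
  have s: "s \<in> {0..1}" using s' by simp
  let ?F = "\<lambda>i. (1 - t) *\<^sub>R strand (letter 1 (swap 0 1) (\<lambda>i. - real i)) i s + t *\<^sub>R strand spiral_b i s"
  have F0: "?F 0 = ((1 - t) * (1 + s) + t * fst (outward s), t * snd (outward s))"
    by (simp add: strand_letter spiral_b_def prod_eq_iff)
  have F1: "?F 1 = ((1 - t) * (2 - s) + t * max 1 (2 - 4 * s), t * s - (1 - t) * tent s)"
    by (simp add: strand_letter spiral_b_def inward_def prod_eq_iff algebra_simps)
  have F2: "fst (?F k) = real k + 1" if "k \<ge> 2" for k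
    using that by (simp add: strand_letter spiral_b_def Transposition.transpose_def algebra_simps)
  have le2: "(1 - t) * a + t * b \<le> c" if "a \<le> c" "b \<le> c" for a b c :: real
    using convex_bound_le[of a c b "1 - t" t] that t by simp
  have ge2: "c \<le> (1 - t) * a + t * b" if "c \<le> a" "c \<le> b" for a b c :: real
    using le2[of "- a" "- c" "- b"] that by simp
  have l0: "fst (?F 0) \<le> 2" unfolding F0 fst_conv using s by (intro le2) (auto simp: outward_def)
  have l1: "fst (?F 1) \<le> 2" unfolding F1 fst_conv using s by (intro le2) auto
  have low: "fst (?F k) \<le> 2" if "k < 2" for k
  proof -
    have "k = 0 \<or> k = 1" using that by linarith
    then show ?thesis using l0 l1 by (elim disjE) (simp_all only:)
  qed
  \<comment> \<open>\<open>outward\<close> reaches radius 2 at time 3/4, where its two height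
    branches meet at \<open>T + 3/4\<close>; this fixes the factor \<open>4 * T + 3\<close>. Up to
    then heights separate the two strings (radii if \<open>s\<close> and \<open>t\<close> are both
    0), afterwards radii do.\<close>
  have ne01: "?F 0 \<noteq> ?F 1"
  proof (cases "s \<le> 3/4")
    case True
    have "(4 * T + 3) * s \<le> (4 * T + 3) * (3/4)" using True T1 by (intro mult_left_mono) auto
    then have "T + s \<le> (4 * T + 3) * (1 - s)" using True by (simp add: algebra_simps)
    then have "snd (?F 0) - snd (?F 1) = t * T + (1 - t) * tent s"
      unfolding F0 F1 by (simp add: outward_def algebra_simps)
    moreover have "0 < t * T + (1 - t) * tent s" if "t \<noteq> 0 \<or> s \<noteq> 0"
    proof (cases "t = 0")
      case True
      then show ?thesis using that s \<open>s \<le> 3/4\<close> tent_pos[of s] by simp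
    next
      case False
      then show ?thesis using t s T1 tent_nonneg[of s] by (intro add_pos_nonneg) auto
    qed
    moreover have "fst (?F 0) \<noteq> fst (?F 1)" if "t = 0" "s = 0" unfolding F0 F1 using that by simp
    ultimately show ?thesis by (metis diff_self less_irrefl)
  next
    case False
    have "7/4 \<le> fst (?F 0)" unfolding F0 fst_conv using False by (intro ge2) (auto simp: outward_def)
    moreover have "fst (?F 1) \<le> 5/4" unfolding F1 fst_conv using False by (intro le2) auto
    ultimately have "fst (?F 1) < fst (?F 0)" by linarith
    then show ?thesis by (metis less_irrefl)
  qed
  have main: "?F i \<noteq> ?F j" if "i < j" for i j
  proof (cases "j < 2")
    case True
    then have "i = 0" "j = 1" using that by auto
    then show ?thesis using ne01 by simp
  next
    case False
    then have j: "fst (?F j) = real j + 1" using F2 by simp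
    show ?thesis
    proof (cases "i < 2")
      case True
      then have "fst (?F i) < fst (?F j)" using low[of i] j False by linarith
      then show ?thesis by (metis less_irrefl)
    next
      case False
      then have "fst (?F i) < fst (?F j)" using F2[of i] j that by simp
      then show ?thesis by (metis less_irrefl)
    qed
  qed
  show "?F i \<noteq> ?F j" using main[of i j] main[of j i] ij(3) by (metis linorder_neqE_nat)
qed

text \<open>During \<open>u\<close> all strings shift by the same amount. In the last letter string
  0 stays within radius \<open>2 - t\<close>, inside all others, so its height can change
  freely.\<close>

lemma straight_to_cat:
  "ambient_isotopic (closure_of_track p (cat straight_a straight_b)) (closure_of_track p (cat u (letter 1 id h)))"
proof (rule cat_homotopy)
  have g: "good p id h" by (simp add: good_def permutes_id)
  have lb: "braid p (letter 1 id h)" by (intro braid_letter g) simp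
  show "dur u = dur straight_a" "dur (letter 1 id h) = dur straight_b" "0 \<le> dur straight_a" "0 < dur straight_b"
    "perm u = perm straight_a" "perm (letter 1 id h) = perm straight_b"
    "perm straight_a permutes {..<p}" "perm straight_b permutes {..<p}"
    using u by (auto simp: straight_a_def straight_b_def dU braid_def permutes_id)
  fix i assume i: "i < p"
  show "\<exists>K. K-lipschitz_on {0..dur straight_a} (strand straight_a i)" "\<exists>K. K-lipschitz_on {0..dur straight_a} (strand u i)"
    using u_simps(1,2)[OF i] by (auto simp: straight_a_def)
  show "\<exists>K. K-lipschitz_on {0..dur straight_b} (strand straight_b i)"
    using lip_curves(3) lip_const[of "{0..1}" "(real i + 2, 0 :: real)"]
    by (cases "i = 0") (auto simp: straight_b_def lip_def)
  show "\<exists>K. K-lipschitz_on {0..dur straight_b} (strand (letter 1 id h) i)"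
    using lb i by (auto simp: braid_def straight_b_def)
  have sc: "shortcut 0 = (2, 0)" "shortcut 1 = (2, 0)"
    using T1 by (auto simp: shortcut_def inward_def outward_def)
  show "strand straight_a i (dur straight_a) = strand straight_b (perm straight_a i) 0"
    using u_simps(4)[OF i] sc by (simp add: straight_a_def straight_b_def)
  show "strand u i (dur straight_a) = strand (letter 1 id h) (perm straight_a i) 0"
    using u_simps(4)[OF i] by (simp add: straight_a_def strand_letter)
  show "strand straight_b i (dur straight_b) = strand straight_a (perm straight_b i) 0"
    using u_simps(3)[OF i] sc by (simp add: straight_a_def straight_b_def)
  show "strand (letter 1 id h) i (dur straight_b) = strand u (perm straight_b i) 0"
    using u_simps(3)[OF i] by (simp add: straight_b_def strand_letter)
next
  fix i \<tau> assume "i < p" "\<tau> \<in> {0..dur straight_a}"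
  then show "1 \<le> fst (strand straight_a i \<tau>) \<and> 1 \<le> fst (strand u i \<tau>)"
    using u_simps(5)[of i \<tau>] by (simp add: straight_a_def)
next
  fix i \<tau> assume "i < p" "\<tau> \<in> {0..dur straight_b}"
  then show "1 \<le> fst (strand straight_b i \<tau>) \<and> 1 \<le> fst (strand (letter 1 id h) i \<tau>)"
    by (simp add: straight_b_def strand_letter shortcut_def inward_def outward_def)
next
  fix t \<tau> i j assume t: "t \<in> {0..1::real}" and \<tau>: "\<tau> \<in> {0..dur straight_a}" and ij: "i < p" "j < p" "i \<noteq> j"
  have "(1 - t) *\<^sub>R strand straight_a i \<tau> + t *\<^sub>R strand u i \<tau> = strand u i \<tau> + (1 - t, 0)" for i
    by (simp add: straight_a_def algebra_simps prod_eq_iff)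
  then show "(1 - t) *\<^sub>R strand straight_a i \<tau> + t *\<^sub>R strand u i \<tau> \<noteq> (1 - t) *\<^sub>R strand straight_a j \<tau> + t *\<^sub>R strand u j \<tau>"
    using u_simps(7)[of i j \<tau>] ij \<tau> by (simp add: straight_a_def)
next
  fix t s i j assume t: "t \<in> {0..1::real}" and s: "s \<in> {0..dur straight_b}" and ij: "i < p" "j < p" "i \<noteq> j"
  let ?F = "\<lambda>i. (1 - t) *\<^sub>R strand straight_b i s + t *\<^sub>R strand (letter 1 id h) i s"
  have F: "fst (?F i) = (if i = 0 then (1 - t) * fst (shortcut s) + t else real i + 2 - t)" for i
    by (simp add: straight_b_def strand_letter algebra_simps)
  have "(1 - t) * fst (shortcut s) \<le> (1 - t) * 2"
    using t s by (intro mult_left_mono) (auto simp: shortcut_def inward_def outward_def straight_b_def)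
  then have F0: "fst (?F 0) \<le> 2 - t" unfolding F by simp
  have main: "fst (?F i) < fst (?F j)" if "i < j" for i j
    using F0 F[of i] F[of j] that by (cases "i = 0") auto
  show "?F i \<noteq> ?F j" using main[of i j] main[of j i] ij(3) by (metis less_irrefl linorder_neqE_nat)
qed

section \<open>The two closures as unions of arcs, with the exchanged strand as a graph over
  height\<close>

definition seg :: "(real \<Rightarrow> real \<times> real) \<Rightarrow> real set \<Rightarrow> R3 set" where
  "seg c J = (\<lambda>s. cyl (2 * pi * (U + s) / T) (c s)) ` J"

definition loop :: "R3 set" where
  "loop = (\<lambda>\<tau>. cyl (2 * pi * \<tau> / T) (1, 1 + \<tau>)) ` {0..U}"

definition main_part :: "R3 set" where
  "main_part = (\<lambda>(k, \<tau>). cyl (2 * pi * \<tau> / T) (strand u k \<tau> + (1, 0))) ` ({..<p} \<times> {0..U})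
     \<union> (\<lambda>(k, s). cyl (2 * pi * (U + s) / T) (real k + 2, 0)) ` ({1..<p} \<times> {0..1})"

lemma image_insert_Times: "(\<lambda>(i, x). f i x) ` (insert a A \<times> J) = f a ` J \<union> (\<lambda>(i, x). f i x) ` (A \<times> J)"
  by (auto simp: image_def)

lemma image_Suc_Times: "(\<lambda>(i, x). f i x) ` (Suc ` A \<times> J) = (\<lambda>(i, x). f (Suc i) x) ` (A \<times> J)"
  by (force simp: image_def)

lemma closure_spiral:
  "closure_of_track (Suc p) (cat spiral_a spiral_b) = loop \<union> seg outward {0..1} \<union> seg inward {0..1} \<union> main_part"
proof -
  have d: "dur spiral_a = U" "dur spiral_b = 1" "dur (cat spiral_a spiral_b) = T"
    using T by (auto simp: spiral_a_def spiral_b_def)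
  have c: "closure_of_track (Suc p) (cat spiral_a spiral_b) = arcs (Suc p) T 0 spiral_a \<union> arcs (Suc p) T (0 + dur spiral_a) spiral_b"
    unfolding closure_arcs d(3)
  proof (rule arcs_join)
    show "perm spiral_a permutes {..<Suc p}" using perm_lift_permutes by (simp add: spiral_a_def)
    show "0 \<le> dur spiral_a" "0 \<le> dur spiral_b" using d T1 T by auto
    show "strand spiral_a i (dur spiral_a) = strand spiral_b (perm spiral_a i) 0" if "i < Suc p" for i
      using that u_simps(4) T T1 by (cases i) (auto simp: spiral_a_def spiral_b_def lift_def outward_def inward_def min_def max_def)
  qed
  have s: "{..<Suc p} = insert 0 (Suc ` {..<p})" "{..<Suc p} = insert 0 (insert 1 (Suc ` {1..<p}))"
    using p by (auto simp: image_iff less_Suc_eq_0_disj Bex_def)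
  have a: "arcs (Suc p) T 0 spiral_a = loop \<union> (\<lambda>(k, \<tau>). cyl (2 * pi * \<tau> / T) (strand u k \<tau> + (1, 0))) ` ({..<p} \<times> {0..U})"
    unfolding arcs_def d s(1) loop_def image_insert_Times image_Suc_Times by (simp add: spiral_a_def)
  have b: "arcs (Suc p) T U spiral_b = seg outward {0..1} \<union> seg inward {0..1} \<union>
      (\<lambda>(k, s). cyl (2 * pi * (U + s) / T) (real k + 2, 0)) ` ({1..<p} \<times> {0..1})"
  proof -
    have "(\<lambda>(k, s). cyl (2 * pi * (U + s) / T) (strand spiral_b (Suc k) s)) ` ({1..<p} \<times> {0..1})
        = (\<lambda>(k, s). cyl (2 * pi * (U + s) / T) (real k + 2, 0)) ` ({1..<p} \<times> {0..1})"
      by (rule image_cong) (auto simp: spiral_b_def add.commute)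
    moreover have "strand spiral_b 0 = outward" "strand spiral_b 1 = inward" by (auto simp: spiral_b_def)
    ultimately show ?thesis
      unfolding arcs_def d s(2) seg_def image_insert_Times image_Suc_Times by (simp only: Un_assoc)
  qed
  show ?thesis unfolding c d(1) a b main_part_def add_0 by blast
qed

lemma closure_straight:
  "closure_of_track p (cat straight_a straight_b) = seg shortcut {0..1} \<union> main_part"
proof -
  have d: "dur straight_a = U" "dur straight_b = 1" "dur (cat straight_a straight_b) = T"
    using T by (auto simp: straight_a_def straight_b_def)
  have c: "closure_of_track p (cat straight_a straight_b) = arcs p T 0 straight_a \<union> arcs p T (0 + dur straight_a) straight_b"
    unfolding closure_arcs d(3)
  proof (rule arcs_join)
    show "perm straight_a permutes {..<p}" using u by (simp add: straight_a_def braid_def)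
    show "0 \<le> dur straight_a" "0 \<le> dur straight_b" using d T1 T by auto
    show "strand straight_a i (dur straight_a) = strand straight_b (perm straight_a i) 0" if "i < p" for i
      using u_simps(4)[OF that] by (auto simp: straight_a_def straight_b_def shortcut_def inward_def)
  qed
  have s: "{..<p} = insert 0 {1..<p}" using p by auto
  have a: "arcs p T 0 straight_a = (\<lambda>(k, \<tau>). cyl (2 * pi * \<tau> / T) (strand u k \<tau> + (1, 0))) ` ({..<p} \<times> {0..U})"
    unfolding arcs_def d by (simp add: straight_a_def)
  have b: "arcs p T U straight_b = seg shortcut {0..1} \<union>
      (\<lambda>(k, s). cyl (2 * pi * (U + s) / T) (real k + 2, 0)) ` ({1..<p} \<times> {0..1})"
    unfolding arcs_def d s seg_def image_insert_Times
    by (intro arg_cong2[of _ _ _ _ "(\<union>)"] image_cong) (auto simp: straight_b_def)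
  show ?thesis unfolding c d(1) a b main_part_def add_0 by blast
qed

definition clip :: "real \<Rightarrow> real" where
  "clip z = max (1/8) (min (T + 5/8) z)"

text \<open>Radius of the raised string as a function of its height: along \<open>inward\<close>,
  then 1 along the loop, then along \<open>outward\<close>.\<close>

definition rad :: "real \<Rightarrow> real" where
  "rad z = max 1 (max (2 - 4 * z) (4 * (z - T) - 1))"

text \<open>Inverts the height of \<open>shortcut\<close>: the time at which that curve has height
  \<open>clip z\<close>.\<close>

definition lam :: "real \<Rightarrow> real" where
  "lam z = 1/8 + (clip z - 1/8) / (2 * T + 1)"

text \<open>All three pieces have angle \<open>2 * pi * (U + z) / T\<close> at height
  \<open>z\<close>, modulo full turns, because height is elapsed time and \<open>T = U + 1\<close>.
  Clipping makes the curve constant outside the window of heights, hence Lipschitz on the whole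
  line.\<close>

definition spiral :: "real \<Rightarrow> real \<times> real" where
  "spiral z = (rad (clip z) * cos (2 * pi * (U + clip z) / T), rad (clip z) * sin (2 * pi * (U + clip z) / T))"

definition chord :: "real \<Rightarrow> real \<times> real" where
  "chord z = (3/2 * cos (2 * pi * (U + lam z) / T), 3/2 * sin (2 * pi * (U + lam z) / T))"

lemma clip_bounds: "1/8 \<le> clip z" "clip z \<le> T + 5/8"
  using T1 by (auto simp: clip_def)

lemma clip_id: "1/8 \<le> z \<Longrightarrow> z \<le> T + 5/8 \<Longrightarrow> clip z = z"
  by (auto simp: clip_def)

lemma lam_bounds: "1/8 \<le> lam z" "lam z \<le> 5/8"
proof -
  have "(clip z - 1/8) / (2 * T + 1) \<le> 1/2"
    using clip_bounds(2)[of z] T1 by (simp add: field_simps)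
  moreover have "0 \<le> (clip z - 1/8) / (2 * T + 1)" using clip_bounds(1)[of z] T1 by simp
  ultimately show "1/8 \<le> lam z" "lam z \<le> 5/8" unfolding lam_def by linarith+
qed

lemma lip_clip: "lip UNIV clip"
proof -
  have e: "clip = (\<lambda>z. max (1/8) (min (T + 5/8) (1 * z + 0)))" by (auto simp: clip_def)
  show ?thesis unfolding e by (intro lip_minmax lip_const lip_affine)
qed

lemma lip_comp_affine:
  fixes f :: "real \<Rightarrow> real"
  assumes "lip UNIV f"
  shows "lip UNIV (\<lambda>z. a * f z + b)"
proof -
  obtain K where "K-lipschitz_on UNIV f" using assms unfolding lip_def by blast
  then have "(\<bar>a\<bar> * K + 0)-lipschitz_on UNIV (\<lambda>z. a * f z + b)"
    by (intro lipschitz_on_add lipschitz_on_cmult_real lipschitz_on_constant)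
  then show ?thesis unfolding lip_def by blast
qed

lemma lip_spiral: "lip UNIV spiral"
proof -
  have "lip UNIV (\<lambda>z. 1 * clip z + U)" by (intro lip_comp_affine lip_clip)
  then have g: "lip UNIV (\<lambda>z. U + clip z)" by (simp add: add.commute)
  have e: "(\<lambda>\<tau>. (rad (\<tau> - U), 0 :: real)) = (\<lambda>\<tau>. (max 1 (max (- 4 * \<tau> + (2 + 4 * U)) (4 * \<tau> + (- 4 * U - 4 * T - 1))), 0))"
    by (auto simp: rad_def fun_eq_iff algebra_simps)
  have "lip {U + 1/8..U + (T + 5/8)} (\<lambda>\<tau>. (rad (\<tau> - U), 0 :: real))"
    unfolding e by (intro lip_Pair lip_minmax lip_const lip_affine)
  from lip_planar[OF this g, of T] clip_bounds show ?thesis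
    unfolding spiral_def by simp
qed

lemma lip_chord: "lip UNIV chord"
proof -
  have "lip UNIV (\<lambda>z. (1 / (2 * T + 1)) * clip z + (U + 1/8 - (1/8) / (2 * T + 1)))" by (intro lip_comp_affine lip_clip)
  moreover have "(\<lambda>z. (1 / (2 * T + 1)) * clip z + (U + 1/8 - (1/8) / (2 * T + 1))) = (\<lambda>z. U + lam z)"
    by (simp add: fun_eq_iff lam_def diff_divide_distrib)
  ultimately have g: "lip UNIV (\<lambda>z. U + lam z)" by (simp only:)
  from lip_planar[OF lip_const[of _ "(3/2, 0)"] g, of "U + 1/8" "U + 5/8" T] lam_bounds show ?thesis
    unfolding chord_def by simp
qed

lemma norm_polar: "norm (r * cos a, r * sin a) = \<bar>r :: real\<bar>"
  using norm_cyl[of a "(r, 0)"] by (simp add: cyl_def norm_Pair)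

text \<open>Both radii are 3/2 at either end. At the lower end the angles are equal, at the upper
  end they differ by one full turn.\<close>

lemma spiral_chord_ends:
  assumes "z \<le> 1/8 \<or> T + 5/8 \<le> z"
  shows "spiral z = chord z"
  using assms
proof
  assume "z \<le> 1/8"
  then have c: "clip z = 1/8" using T1 by (auto simp: clip_def)
  have l: "lam z = 1/8" by (simp add: lam_def c)
  have r: "rad (clip z) = 3/2" using T1 by (simp add: rad_def c)
  show ?thesis unfolding spiral_def chord_def r l unfolding c ..
next
  assume "T + 5/8 \<le> z"
  then have c: "clip z = T + 5/8" using T1 by (auto simp: clip_def)
  have l: "lam z = 5/8" using T1 by (simp add: lam_def c field_simps)
  have r: "rad (clip z) = 3/2" using T1 by (simp add: rad_def c)
  have a: "2 * pi * (U + (T + 5/8)) / T = 2 * pi * (U + 5/8) / T + 2 * pi" using T1 by (simp add: field_simps)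
  show ?thesis unfolding spiral_def chord_def r l unfolding c a by simp
qed

lemma seg_spiral:
  "(\<lambda>z. (fst (spiral z), snd (spiral z), z)) ` {1/8..T + 5/8} = loop \<union> seg outward {0..5/8} \<union> seg inward {1/8..1}"
proof -
  let ?g = "\<lambda>z. (fst (spiral z), snd (spiral z), z)"
  have g: "?g z = cyl (2 * pi * (U + z) / T) (rad z, z)" if "z \<in> {1/8..T + 5/8}" for z
    using that clip_id by (simp add: spiral_def cyl_def)
  have "{1/8..T + 5/8} = {1/8..1} \<union> {1..T} \<union> {T..T + 5/8}" using T1 by auto
  then have e0: "?g ` {1/8..T + 5/8} = ?g ` {1/8..1} \<union> ?g ` {1..T} \<union> ?g ` {T..T + 5/8}" by (simp add: image_Un)
  have e1: "?g ` {1/8..1} = seg inward {1/8..1}"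
    unfolding seg_def
  proof (rule image_cong[OF refl])
    fix s :: real assume s: "s \<in> {1/8..1}"
    then have "rad s = max 1 (2 - 4 * s)" using T1 by (auto simp: rad_def max_def)
    then show "?g s = cyl (2 * pi * (U + s) / T) (inward s)" using g[of s] s T1 by (simp add: inward_def)
  qed
  have e2: "?g ` {1..T} = loop"
  proof -
    have "{1..T} = (\<lambda>\<tau>. 1 + \<tau>) ` {0..U}" using T by (simp add: image_add_atLeastAtMost add.commute)
    then have "?g ` {1..T} = (\<lambda>\<tau>. ?g (1 + \<tau>)) ` {0..U}" by (simp only: image_image)
    also have "\<dots> = loop"
      unfolding loop_def
    proof (rule image_cong[OF refl])
      fix \<tau> assume \<tau>: "\<tau> \<in> {0..U}"
      have "rad (1 + \<tau>) = 1" using \<tau> T by (auto simp: rad_def)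
      moreover have "2 * pi * (U + (1 + \<tau>)) / T = 2 * pi * \<tau> / T + 2 * pi"
      proof -
        have "2 * pi * (U + (1 + \<tau>)) = 2 * pi * \<tau> + 2 * pi * T" using T by (simp add: algebra_simps flip: T)
        then show ?thesis using T1 by (simp add: add_divide_distrib)
      qed
      ultimately show "?g (1 + \<tau>) = cyl (2 * pi * \<tau> / T) (1, 1 + \<tau>)"
        using g[of "1 + \<tau>"] \<tau> T by simp
    qed
    finally show ?thesis .
  qed
  have e3: "?g ` {T..T + 5/8} = seg outward {0..5/8}"
  proof -
    have "{T..T + 5/8} = (\<lambda>s. T + s) ` {0..5/8}" by (simp add: image_add_atLeastAtMost)
    then have "?g ` {T..T + 5/8} = (\<lambda>s. ?g (T + s)) ` {0..5/8}" by (simp only: image_image)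
    also have "\<dots> = seg outward {0..5/8}"
      unfolding seg_def
    proof (rule image_cong[OF refl])
      fix s :: real assume s: "s \<in> {0..5/8}"
      have "(4 * T + 3) * s \<le> (4 * T + 3) * (5/8)" using s T1 by (intro mult_left_mono) auto
      then have "T + s \<le> (4 * T + 3) * (1 - s)" using s T1 by (simp add: algebra_simps)
      then have o: "outward s = (rad (T + s), T + s)"
        using s T1 by (auto simp: outward_def rad_def)
      have "2 * pi * (U + (T + s)) / T = 2 * pi * (U + s) / T + 2 * pi" using T1 by (simp add: field_simps)
      then show "?g (T + s) = cyl (2 * pi * (U + s) / T) (outward s)"
        using g[of "T + s"] s T1 by (simp add: o)
    qed
    finally show ?thesis .
  qed
  show ?thesis unfolding e0 e1 e2 e3 by (simp only: Un_ac)
qed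

lemma seg_chord:
  "(\<lambda>z. (fst (chord z), snd (chord z), z)) ` {1/8..T + 5/8} = seg shortcut {1/8..5/8}"
proof -
  let ?z = "\<lambda>s. 1/8 + (s - 1/8) * (2 * T + 1)"
  have "{1/8..T + 5/8} = ?z ` {1/8..5/8}"
  proof (intro equalityI subsetI)
    fix z assume "z \<in> {1/8..T + 5/8}"
    then show "z \<in> ?z ` {1/8..5/8}"
      using T1 by (intro image_eqI[of _ _ "1/8 + (z - 1/8) / (2 * T + 1)"]) (auto simp: field_simps)
  next
    fix z assume "z \<in> ?z ` {1/8..5/8}"
    then obtain s where s: "s \<in> {1/8..5/8}" "z = ?z s" by blast
    have "0 \<le> (s - 1/8) * (2 * T + 1)" "(s - 1/8) * (2 * T + 1) \<le> (1/2) * (2 * T + 1)"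
      using s T1 by (auto intro!: mult_right_mono mult_nonneg_nonneg)
    then show "z \<in> {1/8..T + 5/8}" using s by simp
  qed
  then have "(\<lambda>z. (fst (chord z), snd (chord z), z)) ` {1/8..T + 5/8} = (\<lambda>s. (fst (chord (?z s)), snd (chord (?z s)), ?z s)) ` {1/8..5/8}"
    by (simp only: image_image)
  also have "\<dots> = seg shortcut {1/8..5/8}"
    unfolding seg_def
  proof (rule image_cong[OF refl])
    fix s :: real assume s: "s \<in> {1/8..5/8}"
    have "0 \<le> (s - 1/8) * (2 * T + 1)" "(s - 1/8) * (2 * T + 1) \<le> (1/2) * (2 * T + 1)"
      using s T1 by (auto intro!: mult_right_mono mult_nonneg_nonneg)
    then have "clip (?z s) = ?z s" by (intro clip_id) auto
    then have "lam (?z s) = s" using T1 by (simp add: lam_def)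
    moreover have "shortcut s = (3/2, ?z s)"
    proof (cases "s = 1/8")
      case True
      show ?thesis unfolding True by (simp add: shortcut_def inward_def)
    next
      case False
      then have "\<not> s \<le> 1/8" "s \<le> 5/8" using s by auto
      then show ?thesis unfolding shortcut_def by simp
    qed
    ultimately show "(fst (chord (?z s)), snd (chord (?z s)), ?z s) = cyl (2 * pi * (U + s) / T) (shortcut s)"
      by (simp add: chord_def cyl_def)
  qed
  finally show ?thesis .
qed

lemma spiral_to_straight:
  "ambient_isotopic (closure_of_track (Suc p) (cat spiral_a spiral_b)) (closure_of_track p (cat straight_a straight_b))"
proof -
  define B where "B = seg inward {0..1/8} \<union> seg outward {5/8..1} \<union> main_part"
  have split: "seg c (I \<union> J) = seg c I \<union> seg c J" for c I J by (simp add: seg_def image_Un)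
  have I: "{0..1} = {0..1/8} \<union> {1/8..1::real}" "{0..1} = {0..5/8} \<union> {5/8..1::real}"
    "{0..1} = {0..1/8} \<union> {1/8..5/8} \<union> {5/8..1::real}" by auto
  have "seg inward {0..1} = seg inward {0..1/8} \<union> seg inward {1/8..1}"
    "seg outward {0..1} = seg outward {0..5/8} \<union> seg outward {5/8..1}"
    using split I by metis+
  then have 1: "closure_of_track (Suc p) (cat spiral_a spiral_b) = (\<lambda>z. (fst (spiral z), snd (spiral z), z)) ` {1/8..T + 5/8} \<union> B"
    unfolding closure_spiral seg_spiral B_def by blast
  have "seg shortcut {0..1/8} = seg inward {0..1/8}"
    unfolding seg_def by (rule image_cong) (auto simp: shortcut_def)
  moreover have "seg shortcut {5/8..1} = seg outward {5/8..1}"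
    unfolding seg_def
  proof (rule image_cong[OF refl])
    fix s :: real assume s: "s \<in> {5/8..1}"
    have e: "shortcut (5/8) = outward (5/8)"
      using T1 by (simp add: shortcut_def outward_def min_def max_def add_divide_distrib)
    have "shortcut s = outward s"
    proof (cases "s = 5/8")
      case True
      show ?thesis unfolding True by (rule e)
    next
      case False
      then have "\<not> s \<le> 1/8" "\<not> s \<le> 5/8" using s by auto
      then show ?thesis unfolding shortcut_def by simp
    qed
    then show "cyl (2 * pi * (U + s) / T) (shortcut s) = cyl (2 * pi * (U + s) / T) (outward s)" by simp
  qed
  moreover have "seg shortcut {0..1} = seg shortcut {0..1/8} \<union> seg shortcut {1/8..5/8} \<union> seg shortcut {5/8..1}"
    using split I(3) by metis
  ultimately have 2: "closure_of_track p (cat straight_a straight_b) = (\<lambda>z. (fst (chord z), snd (chord z), z)) ` {1/8..T + 5/8} \<union> B"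
    unfolding closure_straight seg_chord B_def by blast
  obtain L where L: "L-lipschitz_on UNIV spiral" using lip_spiral unfolding lip_def by blast
  obtain M where M: "M-lipschitz_on UNIV chord" using lip_chord unfolding lip_def by blast
  have n1: "norm (spiral z) \<le> 3/2" for z
  proof -
    have "1 \<le> rad (clip z)" by (simp add: rad_def)
    moreover have "2 - 4 * clip z \<le> 3/2" "4 * (clip z - T) - 1 \<le> 3/2"
      using clip_bounds[of z] by argo+
    then have "rad (clip z) \<le> 3/2" unfolding rad_def by linarith
    ultimately show ?thesis unfolding spiral_def norm_polar by simp
  qed
  have n2: "norm (chord z) \<le> 3/2" for z
    unfolding chord_def norm_polar by simp
  \<comment> \<open>The fixed part enters the open cylinder of radius 2 only at heights up to 1/8
    and from \<open>T + 5/8\<close> on, where \<open>spiral\<close> and \<open>chord\<close> agree;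
    from time 3/4 on \<open>outward\<close> is at radius 2.\<close>
  have rest: "norm (x, y) \<ge> 2 \<or> spiral z = chord z" if "(x, y, z) \<in> B" for x y z
  proof -
    have cylD: "norm (x, y) = \<bar>fst q\<bar> \<and> z = snd q" if "(x, y, z) = cyl \<theta> q" for \<theta> q
      using that by (simp add: cyl_def norm_polar)
    from that consider s where "s \<in> {0..1/8}" "(x, y, z) = cyl (2 * pi * (U + s) / T) (inward s)"
      | s where "s \<in> {5/8..1}" "(x, y, z) = cyl (2 * pi * (U + s) / T) (outward s)"
      | k \<tau> where "k < p" "\<tau> \<in> {0..U}" "(x, y, z) = cyl (2 * pi * \<tau> / T) (strand u k \<tau> + (1, 0))"
      | k s where "(x, y, z) = cyl (2 * pi * (U + s) / T) (real k + 2, 0)"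
      unfolding B_def seg_def main_part_def by (elim UnE imageE) auto
    then show ?thesis
    proof cases
      case 1
      then have "z \<le> 1/8" using cylD[OF 1(2)] by (simp add: inward_def)
      then show ?thesis using spiral_chord_ends by blast
    next
      case 2
      show ?thesis
      proof (cases "s \<le> 3/4")
        case True
        have "(4 * T + 3) * s \<le> (4 * T + 3) * (3/4)" using True T1 by (intro mult_left_mono) auto
        then have "z = T + s" using cylD[OF 2(2)] True by (simp add: outward_def algebra_simps)
        then show ?thesis using spiral_chord_ends[of z] 2(1) by simp
      next
        case False
        then show ?thesis using cylD[OF 2(2)] by (simp add: outward_def)
      qed
    next
      case 3
      then show ?thesis using cylD[OF 3(3)] u_simps(5)[OF 3(1,2)] by simp
    next
      case 4
      then show ?thesis using cylD[OF 4] by simp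
    qed
  qed
  show ?thesis
    unfolding 1 2 by (rule replace_monotone_strand[OF L n1 _ M n2 rest]) simp_all
qed

end

text \<open>Markov stabilization at the innermost string: lifting the inner loop to monotone height makes it a
  strand in the cylinder inside the second string, which can be shortened there.\<close>
lemma stabilization:
  assumes "braid p u" "p \<ge> 1"
  shows "ambient_isotopic (closure_of_track (Suc p) (cat (lift u) (letter 1 (swap 0 1) (\<lambda>i. - real i))))
     (closure_of_track p (cat u (letter 1 id h)))"
  using to_spiral[OF assms refl refl] spiral_to_straight[OF assms refl refl] straight_to_cat[OF assms refl refl]
    ambient_isotopic_trans by blast

section \<open>The comparison of braid indices\<close>

text \<open>Splitting needs injective heights, so strings outside the window get the values
  \<open>- real x\<close>, all below the heights inside, which are at least 1. Those strings form no
  inverted pair, so the order condition of \<open>lin_letter_heights\<close> concerns the window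
  alone.\<close>

lemma crossing_letter:
  assumes c: "ncrossing n p c" and d: "d > 0"
  shows "\<exists>g. inj_on g {..<p} \<and> sim p (cross_track d c) (letter d (cross_target c) g)"
proof -
  obtain j lev where jl: "c = (j, lev)" by (cases c)
  have lev: "length lev = n" "distinct lev" "set lev = {1..n}" "j + n \<le> p"
    using c by (auto simp: jl ncrossing_def)
  define W where "W x \<longleftrightarrow> j \<le> x \<and> x < j + n" for x
  define g where "g x = (if W x then height c x else - real x)" for x
  have hW: "height c x = real (n + 1 - lev ! (x - j)) \<and> lev ! (x - j) \<in> {1..n}" if "W x" for x
    using that lev nth_mem[of "x - j" lev] by (auto simp: W_def height_def jl)
  have inj: "inj_on g {..<p}"
  proof (rule inj_onI)
    fix x y assume "x \<in> {..<p}" "y \<in> {..<p}" and eq: "g x = g y"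
    consider "W x" "W y" | "W x" "\<not> W y" | "\<not> W x" "W y" | "\<not> W x" "\<not> W y" by blast
    then show "x = y"
    proof cases
      case 1
      then have "lev ! (x - j) = lev ! (y - j)"
        using eq hW[of x] hW[of y] by (simp add: g_def) linarith
      moreover have "x - j < length lev" "y - j < length lev" using 1 lev(1) by (auto simp: W_def)
      ultimately have "x - j = y - j" using nth_eq_iff_index_eq[OF lev(2)] by blast
      then show ?thesis using 1 by (auto simp: W_def)
    next
      case 2
      then have "height c x \<ge> 1" using hW[of x] by auto
      then show ?thesis using 2 eq by (simp add: g_def)
    next
      case 3
      then have "height c y \<ge> 1" using hW[of y] by auto
      then show ?thesis using 3 eq by (simp add: g_def)
    next
      case 4
      then show ?thesis using eq by (simp add: g_def)
    qed
  qed
  have gc: "good p (cross_target c) (height c)" using good_crossing[OF c] .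
  have "lin p (cross_track d c) (letter d (cross_target c) g)"
    unfolding cross_track_def
  proof (rule lin_letter_heights[OF gc _ d])
    show "good p (cross_target c) g" using gc inj by (intro good_inj) (auto simp: good_def)
    fix i k assume ik: "i < k" "k < p" "cross_target c k < cross_target c i"
    then have "W i" "W k" using flip_inverted[of i k n j] lev by (auto simp: jl cross_target_flip W_def)
    then show "height c i < height c k \<longleftrightarrow> g i < g k" by (simp add: g_def)
  qed
  then show ?thesis using inj by blast
qed

lemma sim_cats_map:
  assumes "\<And>c. c \<in> set w \<Longrightarrow> sim p (f c) (g c) \<and> braid p (f c)"
  shows "sim p (cats (map f w)) (cats (map g w))"
  using assms
proof (induction w)
  case (Cons c w)
  then show ?case using braid_cats[of "map f w" p] by (auto intro!: sim_cat)
qed simp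

lemma word_track_closure:
  assumes a: "word_track n p d a" "dur a > 0" and d: "d > 0"
  shows "\<exists>w. nbraid n p w \<and> ambient_isotopic (braid_closure p w) (closure_of_track p a)"
proof -
  obtain w where w: "nbraid n p w" "sim p a (cats (map (cross_track d) w))"
    using a(1) unfolding word_track_def by blast
  have "w \<noteq> []" using sim_same(1)[OF w(2)] a(2) by auto
  then have "braid_closure p w = closure_of_track p (cats (map (cross_track d) w))"
    using braid_closure_track w(1) d by blast
  then show ?thesis
    using w(1) ambient_isotopic_sym[OF sim_closure[OF w(2) a(2)]] by auto
qed

section \<open>Rewriting words of letters by n-crossings\<close>

context flips
begin

text \<open>A duration k/4 is filled with \<open>k * l\<close> crossings of duration
  \<open>d = 1 / (4 * l)\<close>, where \<open>l\<close> is even and beyond the bound of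
  \<open>flip_words_even\<close>. For an even word the leftover letter is the identity, which is
  itself realized by a word.\<close>

lemma word_track_even_letters:
  assumes p4: "p \<ge> 4" and ws: "ws \<noteq> []" "\<And>\<pi> h. (\<pi>, h) \<in> set ws \<Longrightarrow> \<pi> permutes {..<p} \<and> inj_on h {..<p}"
    and even: "\<not> oddness ws"
  shows "\<exists>d>0. word_track n p d (letters ws)"
proof -
  obtain l0 where l0: "\<And>l \<pi>. even l \<Longrightarrow> l \<ge> l0 \<Longrightarrow> \<pi> permutes {..<p} \<Longrightarrow> evenperm \<pi> \<Longrightarrow> \<pi> \<in> flip_words n p l"
    using flip_words_even by blast
  define l where "l = 2 * (l0 + 1)"
  define d where "d = 1 / (4 * real l)"
  have l: "l > 0" by (simp add: l_def)
  then have d: "d > 0" by (simp add: d_def)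
  have ev: "word_track n p d (letter (real k / 4) \<pi> h)"
    if "k > 0" "\<pi> permutes {..<p}" "evenperm \<pi>" "inj_on h {..<p}" for k \<pi> h
  proof -
    have "l0 \<le> 1 * l" by (simp add: l_def)
    also have "1 * l \<le> k * l" using that(1) by (intro mult_right_mono) auto
    finally have "\<pi> \<in> flip_words n p (k * l)" using that by (intro l0) (auto simp: l_def)
    then have "word_track n p d (letter (real (k * l) * d) \<pi> h)"
      using that l d by (intro word_track_flip_words) auto
    moreover have "real (k * l) * d = real k / 4" using l by (simp add: d_def)
    ultimately show ?thesis by (simp only:)
  qed
  obtain x h where x: "word_track n p d x" "braid p x" "inj_on h {..<p}"
      "sim p (letters ws) (cat x (letter (1/4) (if oddness ws then swap 0 1 else id) h))"
    using letters_normal_form[OF ev p4 d ws] by blast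
  have "word_track n p d (letter (1/4) id h)"
    using ev[of 1 id h] x(3) by (simp add: permutes_id)
  moreover have "braid p (letter (1/4) id h)" by (intro braid_letter) (auto simp: good_def permutes_id)
  ultimately have "word_track n p d (cat x (letter (1/4) id h))"
    using x d by (intro word_track_cat)
  moreover have "sim p (letters ws) (cat x (letter (1/4) id h))" using x(4) even by simp
  ultimately show ?thesis using d word_track_sim by blast
qed

text \<open>If \<open>n div 2\<close> is odd then a reversal is odd, so prefixing one reversal
  reduces an odd permutation to an even one. All letters get the same odd length
  \<open>q\<close>.\<close>

lemma word_track_odd_letters:
  assumes n4: "odd (n div 2)"
    and ws: "\<And>\<pi> h. (\<pi>, h) \<in> set ws \<Longrightarrow> \<pi> permutes {..<p} \<and> inj_on h {..<p} \<and> \<not> evenperm \<pi>"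
  shows "\<exists>d>0. word_track n p d (letters ws)"
proof -
  obtain l0 where l0: "\<And>l \<pi>. even l \<Longrightarrow> l \<ge> l0 \<Longrightarrow> \<pi> permutes {..<p} \<Longrightarrow> evenperm \<pi> \<Longrightarrow> \<pi> \<in> flip_words n p l"
    using flip_words_even by blast
  define q where "q = Suc (2 * l0)"
  define d where "d = 1 / real q"
  have d: "d > 0" by (simp add: d_def q_def)
  have f: "flip n 0 permutes {..<p}" using p by (intro permutes_flip) simp
  have "word_track n p d (letter 1 \<pi> h) \<and> braid p (letter 1 \<pi> h)" if "(\<pi>, h) \<in> set ws" for \<pi> h
  proof -
    have \<pi>: "\<pi> permutes {..<p}" "inj_on h {..<p}" "\<not> evenperm \<pi>" using ws[OF that] by auto
    have "permutation \<pi>" using \<pi>(1) permutation_permutes by blast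
    then have "evenperm (\<pi> \<circ> flip n 0)"
      using \<pi>(3) n4 by (simp add: evenperm_comp permutation_flip evenperm_flip)
    then have "\<pi> \<circ> flip n 0 \<in> flip_words n p (2 * l0)"
      by (intro l0 permutes_compose[OF f \<pi>(1)]) auto
    then obtain js where js: "\<pi> \<circ> flip n 0 = run n js" "length js = 2 * l0" "\<forall>j\<in>set js. j + n \<le> p"
      unfolding flip_words_def by blast
    have "run n (0 # js) = \<pi> \<circ> (flip n 0 \<circ> flip n 0)" by (simp only: run.simps js(1)[symmetric] comp_assoc)
    then have "run n (0 # js) = \<pi>" by (simp only: flip_comp_flip comp_id)
    then have "\<pi> \<in> flip_words n p q"
      unfolding flip_words_def using js p by (intro CollectI exI[of _ "0 # js"]) (auto simp: q_def)
    then have "word_track n p d (letter (real q * d) \<pi> h)"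
      using \<pi> d by (intro word_track_flip_words) (auto simp: q_def)
    moreover have "real q * d = 1" by (simp add: d_def q_def)
    ultimately show ?thesis using \<pi> by (auto intro!: braid_letter good_inj)
  qed
  then have "word_track n p d (letters ws)"
    unfolding letters_def using d by (intro word_track_cats) auto
  then show ?thesis using d by blast
qed

end

lemma letters_Cons: "letters ((\<pi>, h) # ws) = cat (letter 1 \<pi> h) (letters ws)"
  by (simp add: letters_def)

lemma word_letters:
  assumes w: "nbraid m p w"
  shows "\<exists>g. \<forall>c\<in>set w. inj_on (g c) {..<p} \<and> sim p (cross_track 1 c) (letter 1 (cross_target c) (g c))"
proof -
  have "\<forall>c\<in>set w. \<exists>g. inj_on g {..<p} \<and> sim p (cross_track 1 c) (letter 1 (cross_target c) g)"
    using w crossing_letter[of m p _ 1] by (auto simp: nbraid_def)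
  then show ?thesis by (rule bchoice)
qed

lemma cross_target_props:
  assumes "ncrossing m p c"
  shows "cross_target c permutes {..<p}" "evenperm (cross_target c) \<longleftrightarrow> even (m div 2)"
  using assms permutes_flip[of "fst c" m p] evenperm_flip[of m "fst c"]
  by (cases c; auto simp: ncrossing_def cross_target_flip)+

lemma oddness_word: "oddness (map (\<lambda>c. (f c, g c)) w) \<longleftrightarrow> odd (length w)"
  if "\<And>c. c \<in> set w \<Longrightarrow> \<not> evenperm (f c)"
proof -
  have "filter (\<lambda>(\<pi>, h). \<not> evenperm \<pi>) (map (\<lambda>c. (f c, g c)) w) = map (\<lambda>c. (f c, g c)) w"
    using that by (auto simp: filter_id_conv)
  then show ?thesis by (simp add: oddness_def)
qed

text \<open>Three cases: all letters are even; the number of odd letters is even; or reversals of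
  length \<open>n\<close> are odd and each odd letter is treated on its own.\<close>

lemma same_strings:
  assumes w: "nbraid m p w" "w \<noteq> []" and nn: "even n" "n \<ge> 2" and pp: "p \<ge> 2 * n" "p \<ge> 4"
    and par: "even (m div 2) \<or> even (length w) \<or> odd (n div 2)"
  shows "\<exists>w'. nbraid n p w' \<and> ambient_isotopic (braid_closure p w') (braid_closure p w)"
proof -
  interpret flips n p by unfold_locales (use nn pp in auto)
  have cr: "ncrossing m p c" if "c \<in> set w" for c using w that by (simp add: nbraid_def)
  obtain g where g: "\<And>c. c \<in> set w \<Longrightarrow> inj_on (g c) {..<p}"
      "\<And>c. c \<in> set w \<Longrightarrow> sim p (cross_track 1 c) (letter 1 (cross_target c) (g c))"
    using word_letters[OF w(1)] by blast
  let ?ws = "map (\<lambda>c. (cross_target c, g c)) w"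
  have "sim p (cats (map (cross_track 1) w)) (cats (map (\<lambda>c. letter 1 (cross_target c) (g c)) w))"
    using g(2) cr braid_cross_track[of m p _ 1] by (intro sim_cats_map) auto
  then have s: "sim p (cats (map (cross_track 1) w)) (letters ?ws)"
    by (simp add: letters_def comp_def)
  have ws: "\<pi> permutes {..<p} \<and> inj_on h {..<p} \<and> (evenperm \<pi> \<longleftrightarrow> even (m div 2))" if "(\<pi>, h) \<in> set ?ws" for \<pi> h
    using that g(1) cross_target_props[OF cr] by auto
  have "\<exists>d>0. word_track n p d (letters ?ws)"
  proof (cases "even (m div 2) \<or> even (length w)")
    case True
    have "\<not> oddness ?ws"
    proof (cases "even (m div 2)")
      case True
      then have "filter (\<lambda>(\<pi>, h). \<not> evenperm \<pi>) ?ws = []" using ws by (auto simp: filter_empty_conv)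
      then show ?thesis by (simp add: oddness_def)
    next
      case False
      then have "oddness ?ws \<longleftrightarrow> odd (length w)" using cross_target_props(2)[OF cr] by (intro oddness_word) auto
      then show ?thesis using True False by blast
    qed
    then show ?thesis using ws w(2) pp by (intro word_track_even_letters) auto
  next
    case False
    then show ?thesis using ws par by (intro word_track_odd_letters) auto
  qed
  then obtain d where d: "d > 0" "word_track n p d (cats (map (cross_track 1) w))"
    using word_track_sim[OF s] by blast
  moreover have "dur (cats (map (cross_track 1) w)) > 0"
    using w(2) by (simp add: dur_cats comp_def sum_list_triv)
  ultimately show ?thesis
    using word_track_closure braid_closure_track[OF w(2,1), of 1] by fastforce
qed

definition lift_perm :: "(nat \<Rightarrow> nat) \<Rightarrow> nat \<Rightarrow> nat" where
  "lift_perm \<pi> i = (case i of 0 \<Rightarrow> 0 | Suc k \<Rightarrow> Suc (\<pi> k))"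

lemma permutes_lift_perm: "\<pi> permutes {..<p} \<Longrightarrow> lift_perm \<pi> permutes {..<Suc p}"
  using permutes_lift unfolding lift_perm_def[abs_def] .

lemma evenperm_lift_perm:
  assumes "\<pi> permutes {..<p}"
  shows "evenperm (lift_perm \<pi>) \<longleftrightarrow> evenperm \<pi>"
  using assms finite_lessThan
proof (induction \<pi> rule: permutes_induct)
  case id
  have "lift_perm id = id" by (auto simp: lift_perm_def fun_eq_iff split: nat.splits)
  then show ?case by (simp only:)
next
  case (swap a b \<pi>)
  have "lift_perm (swap a b \<circ> \<pi>) = swap (Suc a) (Suc b) \<circ> lift_perm \<pi>"
    by (auto simp: lift_perm_def fun_eq_iff Transposition.transpose_def split: nat.splits)
  moreover have "permutation \<pi>" using swap permutation_permutes by blast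
  moreover have "permutation (lift_perm \<pi>)" using permutes_lift_perm[OF swap.hyps(4)] permutation_permutes by blast
  ultimately show ?case
    using swap.hyps(3) swap.IH by (simp only: evenperm_comp permutation_swap_id evenperm_swap) simp
qed

lemma lift_cat: "lift (cat a b) = cat (lift a) (lift b)"
  by (auto simp: lift_def cat_def fun_eq_iff split: nat.splits)

text \<open>Injectivity requires a height for the new string unlike all others, whereas lifting
  leaves it at height 0. It rests at radius 1 while the others have radius at least 2, so its height
  can be deformed freely.\<close>

lemma lift_letter:
  assumes \<pi>: "\<pi> permutes {..<p}" and h: "inj_on h {..<p}" and d: "d > 0"
  shows "\<exists>h'. inj_on h' {..<Suc p} \<and> sim (Suc p) (lift (letter d \<pi> h)) (letter d (lift_perm \<pi>) h')"
proof -
  obtain y where y: "y \<notin> h ` {..<p}" using ex_new_if_finite[OF infinite_UNIV_char_0, of "h ` {..<p}"] by blast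
  define h' where "h' i = (case i of 0 \<Rightarrow> y | Suc k \<Rightarrow> h k)" for i
  have h': "inj_on h' {..<Suc p}"
    using h y by (auto simp: inj_on_def h'_def split: nat.splits)
  have b: "braid (Suc p) (lift (letter d \<pi> h))"
    using \<pi> h d by (intro braid_lift braid_letter good_inj)
  have b': "braid (Suc p) (letter d (lift_perm \<pi>) h')"
    using h' d permutes_lift_perm[OF \<pi>] by (intro braid_letter good_inj)
  have S: "strand (lift (letter d \<pi> h)) (Suc k) \<tau> = strand (letter d (lift_perm \<pi>) h') (Suc k) \<tau>" for k \<tau>
    by (simp add: lift_def strand_letter h'_def lift_perm_def algebra_simps)
  have "lin (Suc p) (lift (letter d \<pi> h)) (letter d (lift_perm \<pi>) h')"
    unfolding lin_def
  proof (intro conjI b b' ballI allI impI)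
    show "dur (lift (letter d \<pi> h)) = dur (letter d (lift_perm \<pi>) h')"
      "perm (lift (letter d \<pi> h)) = perm (letter d (lift_perm \<pi>) h')"
      by (auto simp: lift_def lift_perm_def fun_eq_iff split: nat.splits)
    fix t \<tau> i j assume *: "t \<in> {0..1::real}" "\<tau> \<in> {0..dur (lift (letter d \<pi> h))}" "i < Suc p" "j < Suc p" "i \<noteq> j"
    let ?F = "\<lambda>i. (1 - t) *\<^sub>R strand (lift (letter d \<pi> h)) i \<tau> + t *\<^sub>R strand (letter d (lift_perm \<pi>) h') i \<tau>"
    have FS: "?F (Suc k) = strand (letter d \<pi> h) k \<tau> + (1, 0)" for k
      unfolding S[symmetric] by (simp add: lift_def algebra_simps flip: scaleR_left.add)
    have F0: "fst (?F 0) = 1" by (simp add: lift_def strand_letter lift_perm_def)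
    have bl: "braid p (letter d \<pi> h)" using \<pi> h d by (intro braid_letter good_inj)
    have ge: "fst (?F (Suc k)) \<ge> 2" if "k < p" for k
      using bl that *(2) unfolding FS by (auto simp: braid_def lift_def)
    have ne: "?F 0 \<noteq> ?F (Suc k)" if "k < p" for k
    proof
      assume "?F 0 = ?F (Suc k)"
      then have "fst (?F 0) = fst (?F (Suc k))" by (rule arg_cong)
      then show False using F0 ge[OF that] by linarith
    qed
    show "?F i \<noteq> ?F j"
    proof (cases i)
      case 0
      then obtain k where k: "j = Suc k" using *(5) by (cases j) auto
      have "k < p" using k *(4) by simp
      from ne[OF this] show ?thesis unfolding 0 k .
    next
      case i: (Suc l)
      show ?thesis
      proof (cases j)
        case 0
        have "l < p" using i *(3) by simp
        from not_sym[OF ne[OF this]] show ?thesis unfolding 0 i .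
      next
        case j: (Suc k)
        then show ?thesis
          using bl * unfolding i j FS by (auto simp: braid_def lift_def)
      qed
    qed
  qed
  then show ?thesis using h' by blast
qed

lemma lift_letters:
  assumes "\<And>\<pi> h. (\<pi>, h) \<in> set us \<Longrightarrow> \<pi> permutes {..<p} \<and> inj_on h {..<p}"
  shows "\<exists>vs. (\<forall>(\<pi>, h)\<in>set vs. \<pi> permutes {..<Suc p} \<and> inj_on h {..<Suc p}) \<and> oddness vs = oddness us \<and>
     sim (Suc p) (lift (letters us)) (letters vs)"
  using assms
proof (induction us)
  case Nil
  have "lin (Suc p) unit_track (lift unit_track)"
    by (rule lin_refl[OF braid_unit]) (auto simp: lift_def fun_eq_iff split: nat.splits)
  then have "sim (Suc p) (lift (letters [])) (letters [])"
    using lin_sym by (auto simp: letters_def)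
  then show ?case by (intro exI[of _ "[]"]) auto
next
  case (Cons c us)
  obtain \<pi> h where c: "c = (\<pi>, h)" by (cases c)
  have \<pi>: "\<pi> permutes {..<p}" "inj_on h {..<p}" using Cons.prems[of \<pi> h] c by auto
  have us: "\<And>\<pi> h. (\<pi>, h) \<in> set us \<Longrightarrow> \<pi> permutes {..<p} \<and> inj_on h {..<p}" using Cons.prems by auto
  obtain vs where vs: "\<forall>(\<pi>, h)\<in>set vs. \<pi> permutes {..<Suc p} \<and> inj_on h {..<Suc p}" "oddness vs = oddness us"
     "sim (Suc p) (lift (letters us)) (letters vs)" using Cons.IH us by blast
  obtain h' where h': "inj_on h' {..<Suc p}" "sim (Suc p) (lift (letter 1 \<pi> h)) (letter 1 (lift_perm \<pi>) h')"
    using lift_letter[OF \<pi>, of 1] by auto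
  have "lift (letters (c # us)) = cat (lift (letter 1 \<pi> h)) (lift (letters us))"
    by (simp add: letters_def c lift_cat)
  moreover have "letters ((lift_perm \<pi>, h') # vs) = cat (letter 1 (lift_perm \<pi>) h') (letters vs)"
    by (simp add: letters_def)
  moreover have "sim (Suc p) (cat (lift (letter 1 \<pi> h)) (lift (letters us))) (cat (letter 1 (lift_perm \<pi>) h') (letters vs))"
    by (intro sim_cat h' vs braid_lift braid_letters us) (use \<pi> in \<open>auto intro!: braid_letter good_inj\<close>)
  moreover have "oddness ((lift_perm \<pi>, h') # vs) = oddness (c # us)"
    using vs(2) evenperm_lift_perm[OF \<pi>(1)] by (simp add: oddness_def c)
  ultimately show ?case
    using vs(1) h'(1) permutes_lift_perm[OF \<pi>(1)] by (intro exI[of _ "(lift_perm \<pi>, h') # vs"]) auto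
qed

text \<open>An odd number of odd letters becomes even by stabilization, whose last letter is the odd
  transposition (0 1) on one more string.\<close>

lemma extra_string:
  assumes w: "nbraid m p w" "w \<noteq> []" and nn: "even n" "n \<ge> 2" and pp: "p \<ge> 2 * n" "p \<ge> 4"
    and m: "odd (m div 2)" and len: "odd (length w)"
  shows "\<exists>w'. nbraid n (Suc p) w' \<and> ambient_isotopic (braid_closure (Suc p) w') (braid_closure p w)"
proof -
  interpret flips n "Suc p" by unfold_locales (use nn pp in auto)
  have cr: "ncrossing m p c" if "c \<in> set w" for c using w that by (simp add: nbraid_def)
  \<comment> \<open>Duration 2 leaves room for an idle letter after each crossing; the last of them
    is the \<open>letter 1 id h\<close> that stabilization trades for the new letter.\<close>
  have "\<exists>g g'. inj_on g {..<p} \<and> inj_on g' {..<p} \<and>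
      sim p (cross_track 2 c) (cat (letter 1 (cross_target c) g) (letter 1 id g'))" if c: "c \<in> set w" for c
  proof -
    obtain g where g: "inj_on g {..<p}" "sim p (cross_track 2 c) (letter 2 (cross_target c) g)"
      using crossing_letter[OF cr[OF c], of 2] by auto
    obtain g' where g': "inj_on g' {..<p}"
        "sim p (letter 2 (cross_target c) g) (cat (letter 1 (cross_target c) g) (letter 1 id g'))"
      using sim_letter_split'[OF cross_target_props(1)[OF cr[OF c]] permutes_id g(1), of 1 1 2 "cross_target c"] by auto
    show ?thesis using g(1) g'(1) rtranclp_trans[OF g(2) g'(2)] by blast
  qed
  then obtain g g' where g: "\<And>c. c \<in> set w \<Longrightarrow> inj_on (g c) {..<p}" "\<And>c. c \<in> set w \<Longrightarrow> inj_on (g' c) {..<p}"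
      "\<And>c. c \<in> set w \<Longrightarrow> sim p (cross_track 2 c) (cat (letter 1 (cross_target c) (g c)) (letter 1 id (g' c)))"
    by metis
  define full where "full w = concat (map (\<lambda>c. [(cross_target c, g c), (id, g' c)]) w)" for w
  have full: "letters (full w) = cats (map (\<lambda>c. cat (letter 1 (cross_target c) (g c)) (letter 1 id (g' c))) w)" for w
  proof (induction w)
    case (Cons c w)
    have "full (c # w) = (cross_target c, g c) # (id, g' c) # full w" by (simp add: full_def)
    then show ?case by (simp only: letters_Cons Cons.IH list.map cats_simps) (simp only: cat_assoc dur_letter zero_le_one)
  qed (simp add: full_def letters_def)
  have s: "sim p (cats (map (cross_track 2) w)) (letters (full w))"
    unfolding full using g(3) cr braid_cross_track[of m p _ 2] by (intro sim_cats_map) auto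
  obtain v c where vc: "w = v @ [c]" using w(2) by (cases w rule: rev_cases) auto
  define us where "us = full v @ [(cross_target c, g c)]"
  have fu: "full w = us @ [(id, g' c)]" by (simp add: full_def us_def vc)
  have valid: "\<pi> permutes {..<p} \<and> inj_on h {..<p}" if "(\<pi>, h) \<in> set (full w)" for \<pi> h
    using that g(1,2) cross_target_props(1)[OF cr] by (auto simp: full_def permutes_id)
  have odd_full: "oddness (full w') \<longleftrightarrow> odd (length w')" if "set w' \<subseteq> set w" for w'
    using that
  proof (induction w')
    case (Cons c w')
    then show ?case using cross_target_props(2)[OF cr, of c] m by (auto simp: full_def oddness_def)
  qed (simp add: full_def oddness_def)
  have "oddness us \<longleftrightarrow> oddness (full w)" unfolding fu by (simp add: oddness_def)
  then have odd_us: "oddness us" using odd_full[of w] len by simp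
  have valid_us: "\<pi> permutes {..<p} \<and> inj_on h {..<p}" if "(\<pi>, h) \<in> set us" for \<pi> h
    using valid that fu by auto
  obtain vs where vs: "\<forall>(\<pi>, h)\<in>set vs. \<pi> permutes {..<Suc p} \<and> inj_on h {..<Suc p}" "oddness vs = oddness us"
     "sim (Suc p) (lift (letters us)) (letters vs)"
    using lift_letters[of us p] valid_us by blast
  let ?s = "(swap 0 1, \<lambda>i. - real i) :: (nat \<Rightarrow> nat) \<times> (nat \<Rightarrow> real)"
  have sw: "swap 0 1 permutes {..<Suc p}" "inj_on (\<lambda>i. - real i) {..<Suc p}"
    using pp by (auto intro!: permutes_swap_id simp: inj_on_def)
  have snoc: "sim q (cat (letters xs) (letter 1 \<pi> h)) (letters (xs @ [(\<pi>, h)]))"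
    if "\<And>\<pi> h. (\<pi>, h) \<in> set xs \<Longrightarrow> \<pi> permutes {..<q} \<and> inj_on h {..<q}" "\<pi> permutes {..<q}" "inj_on h {..<q}" for q xs \<pi> h
  proof -
    have b: "braid q (letter 1 \<pi> h)" using that by (auto intro!: braid_letter good_inj)
    have bx: "braid q (letters xs)" by (rule braid_letters) (rule that(1))
    have "sim q (cat (letters xs) (letter 1 \<pi> h)) (cat (letters xs) (letters [(\<pi>, h)]))"
      using lin_sym[OF lin_unit_right[OF b]] b bx by (intro sim_cat) (auto simp: letters_def)
    moreover have "sim q (cat (letters xs) (letters [(\<pi>, h)])) (letters (xs @ [(\<pi>, h)]))"
      unfolding letters_def map_append
    proof (rule sim_cats_append)
      fix a assume "a \<in> set (map (\<lambda>(\<pi>, h). letter 1 \<pi> h) xs)"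
      then show "braid q a" using that(1) by (auto intro!: braid_letter good_inj)
    qed (use b in auto)
    ultimately show ?thesis by (rule rtranclp_trans)
  qed
  have "sim p (cat (letters us) (letter 1 id (g' c))) (letters (full w))"
    unfolding fu using valid_us g(2)[of c] by (intro snoc) (auto simp: vc permutes_id)
  from rtranclp_trans[OF s sim_sym[OF this]]
  have s1: "sim p (cats (map (cross_track 2) w)) (cat (letters us) (letter 1 id (g' c)))" .
  have bu: "braid p (letters us)" by (rule braid_letters) (rule valid_us)
  have "sim (Suc p) (cat (lift (letters us)) (letter 1 (swap 0 1) (\<lambda>i. - real i))) (cat (letters vs) (letter 1 (swap 0 1) (\<lambda>i. - real i)))"
    using vs(3) sw bu by (intro sim_cat braid_lift) (auto intro!: braid_letter good_inj)
  moreover have "sim (Suc p) (cat (letters vs) (letter 1 (swap 0 1) (\<lambda>i. - real i))) (letters (vs @ [?s]))"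
    using vs(1) sw by (intro snoc) auto
  ultimately have s2: "sim (Suc p) (cat (lift (letters us)) (letter 1 (swap 0 1) (\<lambda>i. - real i))) (letters (vs @ [?s]))"
    by (rule rtranclp_trans)
  have "\<not> oddness (vs @ [?s])" using vs(2) odd_us by (simp add: oddness_def evenperm_swap)
  then obtain d where d: "d > 0" "word_track n (Suc p) d (letters (vs @ [?s]))"
    using word_track_even_letters[of "vs @ [?s]"] vs(1) sw pp by fastforce
  let ?S = "cat (lift (letters us)) (letter 1 (swap 0 1) (\<lambda>i. - real i))"
  have "word_track n (Suc p) d ?S" using word_track_sim[OF s2 d(2)] .
  moreover have "dur ?S > 0" using bu by (simp add: lift_def braid_def)
  ultimately obtain w' where w': "nbraid n (Suc p) w'" "ambient_isotopic (braid_closure (Suc p) w') (closure_of_track (Suc p) ?S)"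
    using word_track_closure d(1) by blast
  have "ambient_isotopic (closure_of_track (Suc p) ?S) (closure_of_track p (cat (letters us) (letter 1 id (g' c))))"
    using stabilization[OF bu] pp by simp
  moreover have "ambient_isotopic (braid_closure p w) (closure_of_track p (cat (letters us) (letter 1 id (g' c))))"
    unfolding braid_closure_track[OF w(2,1), of 2, simplified]
    using w(2) by (intro sim_closure[OF s1]) (simp add: dur_cats comp_def sum_list_triv)
  ultimately show ?thesis
    using w' ambient_isotopic_trans ambient_isotopic_sym by blast
qed

text \<open>The empty word closes to concentric circles, an unlink, or to the empty set if
  \<open>p = 0\<close>; both are excluded. A single crossing already occupies \<open>m\<close>
  strings.\<close>

lemma nonunlink_word:
  assumes L: "is_link L" "\<not> is_unlink L" and w: "nbraid m p w" "ambient_isotopic (braid_closure p w) L"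
  shows "w \<noteq> []" "m \<le> p"
proof -
  show ne: "w \<noteq> []"
  proof
    assume "w = []"
    then have u: "ambient_isotopic (std_unlink p) L"
      using w(2) concentric_unlink ambient_isotopic_trans ambient_isotopic_sym by blast
    show False
    proof (cases "p = 0")
      case True
      then have "L = {}" using u by (auto simp: std_unlink_def ambient_isotopic_def)
      moreover obtain c where "c \<ge> 1" "L homeomorphic std_unlink c" using L(1) by (auto simp: is_link_def)
      moreover have "(real (3 * 0) + cos 0, sin 0, 0) \<in> std_unlink c" if "c \<ge> 1" for c
        unfolding std_unlink_def using that by (intro CollectI exI[of _ 0]) auto
      ultimately show False using homeomorphic_empty(2) by fastforce
    next
      case False
      then show False using u L(2) by (auto simp: is_unlink_def)
    qed
  qed
  then obtain c where "ncrossing m p c" using w(1) by (auto simp: nbraid_def neq_Nil_conv)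
  then show "m \<le> p" by (auto simp: ncrossing_def split: prod.splits)
qed

text \<open>A nonempty set of extended naturals contains its infimum, so a finite
  \<open>beta m L\<close> is attained by some braid, to which the assumption applies.\<close>

lemma beta_le_add:
  assumes "\<And>p w. nbraid m p w \<Longrightarrow> ambient_isotopic (braid_closure p w) L \<Longrightarrow>
      \<exists>p' w'. p' \<le> p + e \<and> nbraid n p' w' \<and> ambient_isotopic (braid_closure p' w') L"
  shows "beta n L \<le> beta m L + enat e"
proof -
  let ?S = "{p. \<exists>w. nbraid m p w \<and> ambient_isotopic (braid_closure p w) L}"
  show ?thesis
  proof (cases "?S = {}")
    case True
    have "beta m L = \<infinity>" unfolding beta_def True by (simp add: top_enat_def)
    then show ?thesis by simp
  next
    case False
    then obtain y where "y \<in> enat ` ?S" by blast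
    then have "(LEAST x. x \<in> enat ` ?S) \<in> enat ` ?S" by (rule LeastI)
    then have "Inf (enat ` ?S) \<in> enat ` ?S" using False by (simp only: Inf_enat_def image_is_empty if_False)
    then obtain p where p: "p \<in> ?S" "beta m L = enat p" unfolding beta_def by auto
    obtain p' w' where p': "p' \<le> p + e" "nbraid n p' w'" "ambient_isotopic (braid_closure p' w') L"
      using assms p(1) by blast
    have "beta n L \<le> enat p'" unfolding beta_def using p' by (intro INF_lower) auto
    also have "\<dots> \<le> enat p + enat e" using p'(1) by simp
    finally show ?thesis using p(2) by simp
  qed
qed

theorem theorem5p4:
  fixes L :: "R3 set"
  assumes "is_link L" and "\<not> is_unlink L"
  shows "(\<forall>k n m :: nat. n = 4 * k + 2 \<and> m \<ge> 3 * n + 1 \<longrightarrow> beta n L \<le> beta m L)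
       \<and> (\<forall>k n m :: nat. k \<ge> 1 \<and> n = 4 * k \<and> m \<ge> 3 * n + 1 \<longrightarrow>
            beta n L \<le> beta m L + 1
            \<and> (m mod 4 = 0 \<or> m mod 4 = 1 \<longrightarrow> beta n L \<le> beta m L))"
proof -
  have same: "\<exists>p' w'. p' \<le> p + 0 \<and> nbraid n p' w' \<and> ambient_isotopic (braid_closure p' w') L"
    if w: "nbraid m p w" "ambient_isotopic (braid_closure p w) L"
      and n: "even n" "n \<ge> 2" "m \<ge> 3 * n + 1" and par: "even (m div 2) \<or> even (length w) \<or> odd (n div 2)" for n m p w
  proof -
    note nw = nonunlink_word[OF assms w]
    \<comment> \<open>\<open>p \<ge> m \<ge> 3 * n + 1\<close> and \<open>n \<ge> 2\<close> give
      \<open>p \<ge> 7\<close>, enough for the disjoint transpositions (0 1) and (2 3).\<close>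
    have "p \<ge> 2 * n" "p \<ge> 4" using nw(2) n by auto
    from same_strings[OF w(1) nw(1) n(1,2) this par] show ?thesis
      using w(2) ambient_isotopic_trans by (metis add_0_right order_refl)
  qed
  have extra: "\<exists>p' w'. p' \<le> p + 1 \<and> nbraid n p' w' \<and> ambient_isotopic (braid_closure p' w') L"
    if w: "nbraid m p w" "ambient_isotopic (braid_closure p w) L" and n: "even n" "n \<ge> 2" "m \<ge> 3 * n + 1" for n m p w
  proof (cases "even (m div 2) \<or> even (length w)")
    case True
    then show ?thesis using same[OF w n] by (metis add_0_right trans_le_add1)
  next
    case False
    note nw = nonunlink_word[OF assms w]
    have "p \<ge> 2 * n" "p \<ge> 4" using nw(2) n by auto
    from extra_string[OF w(1) nw(1) n(1,2) this] False show ?thesis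
      using w(2) ambient_isotopic_trans by (metis Suc_eq_plus1 order_refl)
  qed
  have 1: "beta n L \<le> beta m L" if "n = 4 * k + 2" "m \<ge> 3 * n + 1" for k n m
  proof -
    have "n div 2 = 2 * k + 1" using that by simp
    then have "odd (n div 2)" by simp
    then have "beta n L \<le> beta m L + enat 0" using that by (intro beta_le_add same) auto
    then show ?thesis by (simp flip: zero_enat_def)
  qed
  have 2: "beta n L \<le> beta m L + 1" if "k \<ge> 1" "n = 4 * k" "m \<ge> 3 * n + 1" for k n m
  proof -
    have "beta n L \<le> beta m L + enat 1" using that by (intro beta_le_add extra) auto
    then show ?thesis by (simp add: one_enat_def)
  qed
  have 3: "beta n L \<le> beta m L" if "k \<ge> 1" "n = 4 * k" "m \<ge> 3 * n + 1" "m mod 4 = 0 \<or> m mod 4 = 1" for k n m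
  proof -
    \<comment> \<open>These residues say that reversals of \<open>m\<close> positions are
      even.\<close>
    have "even (m div 2)" using that(4) by presburger
    then have "beta n L \<le> beta m L + enat 0" using that by (intro beta_le_add same) auto
    then show ?thesis by (simp flip: zero_enat_def)
  qed
  show ?thesis
  proof (intro conjI allI impI; elim conjE)
    fix k n m :: nat
    assume "n = 4 * k + 2" "m \<ge> 3 * n + 1"
    then show "beta n L \<le> beta m L" by (rule 1)
  next
    fix k n m :: nat
    assume k: "k \<ge> 1" "n = 4 * k" "m \<ge> 3 * n + 1"
    then show "beta n L \<le> beta m L + 1" by (rule 2)
    assume "m mod 4 = 0 \<or> m mod 4 = 1"
    then show "beta n L \<le> beta m L" by (rule 3[OF k])
  qed
qed

end
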